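(* For $0\le t\le n$, the gate $\mathrm{exact}[t]$, which maps $|x\rangle|y\rangle\mapsto|x\rangle|y\oplus g(x)\rangle$ for $x\in\{0,1\}^n$, $y\in\{0,1\}$, with $g(x)=1$ if and only if $|x|=t$, belongs to $\mathrm{QNC}_{\mathrm f}(\log^* n)$; that is, $\mathrm{exact}[t]$ can be computed exactly by quantum circuits with fan-out of depth $O(\log^*n)$ and size $O(n\log n)$.
   Context: $|x|$ denotes the Hamming weight of a bit string $x$. $\log^{(k)}x$ denotes the $k$-times iterated (base 2) logarithm, and $\log^*x$ is the maximum number of iterations $k$ such that $\log^{(k)}x$ exists and is real. A quantum circuit is a sequence of layers of quantum gates; gates in one layer act on disjoint qubits. The size of a gate is the number of qubits it acts on, the depth of a circuit is its number of layers, and its size is the total size of its gates. A circuit may use ancilla qubits initialised to $|0\rangle$, which are returned to $|0\rangle$. The (unbounded) fan-out gate maps $|y_1\rangle\cdots|y_k\rangle|x\rangle\mapsto|y_1\oplus x\rangle\cdots|y_k\oplus x\rangle|x\rangle$, for any $k$, and counts as one gate. A quantum circuit with fan-out uses one-qubit gates, controlled-not gates and fan-out gates. $\mathrm{QNC}_{\mathrm f}(d(n))$ is the class of operators computed exactly (without error) by uniform families (descriptions generated by a log-space Turing machine) of quantum circuits with fan-out of depth $O(d(n))$ and polynomial size; here arbitrary one-qubit gates are allowed (instead of a fixed basis). The family is indexed by $n$ and $t$, with the $O$-constants independent of $t$. *)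

theory Defs
  imports "HOL-Analysis.Analysis"
begin

text \<open>Iterated logarithm. The iterate \<open>(log 2 ^^ k) x\<close> exists as a real number iff all earlier
  iterates are positive; the guard is needed because \<^term>\<open>log 2 y\<close> is a total function.\<close>

definition log_star :: "real \<Rightarrow> nat" where
  "log_star x = Max {k. \<forall>j<k. (log 2 ^^ j) x > 0}"


text \<open>Gates and circuits are polymorphic in the labels \<open>'u\<close> of the one-qubit gates: the label is a
  matrix in an actual circuit and a finite code in the description of a circuit.
  The first argument of \<open>CNOT\<close> and of \<open>Fanout\<close> is the control qubit.\<close>

datatype 'u gate = One 'u nat | CNOT nat nat | Fanout nat "nat list"

datatype 'u circuit = Circuit (wires: nat) (layers: "'u gate list list")

fun gate_qubits :: "'u gate \<Rightarrow> nat list" where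
  "gate_qubits (One u q) = [q]"
| "gate_qubits (CNOT c t) = [c, t]"
| "gate_qubits (Fanout c ts) = c # ts"

definition depth :: "'u circuit \<Rightarrow> nat" where
  "depth C = length (layers C)"

definition circuit_size :: "'u circuit \<Rightarrow> nat" where
  "circuit_size C = (\<Sum>l\<leftarrow>layers C. \<Sum>g\<leftarrow>l. length (gate_qubits g))"

definition unitary :: "complex^bool^bool \<Rightarrow> bool" where
  "unitary U \<longleftrightarrow> U ** (\<chi> i j. cnj (U $ j $ i)) = mat 1 \<and> (\<chi> i j. cnj (U $ j $ i)) ** U = mat 1"

definition wf_circuit :: "(complex^bool^bool) circuit \<Rightarrow> bool" where
  "wf_circuit C \<longleftrightarrow>
     (\<forall>l\<in>set (layers C). distinct (concat (map gate_qubits l)) \<and>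
        (\<forall>g\<in>set l. \<forall>q\<in>set (gate_qubits g). q < wires C)) \<and>
     (\<forall>U\<in>set_circuit C. unitary U)"


text \<open>A state of \<open>N\<close> qubits is given by its amplitudes on the bit strings of length \<open>N\<close>.\<close>

type_synonym state = "bool list \<Rightarrow> complex"

definition ket :: "bool list \<Rightarrow> state" where
  "ket x = (\<lambda>z. of_bool (z = x))"

definition fanout_bits :: "nat \<Rightarrow> nat list \<Rightarrow> bool list \<Rightarrow> bool list" where
  "fanout_bits c ts z = map (\<lambda>i. if i \<in> set ts then z ! i \<noteq> z ! c else z ! i) [0..<length z]"

text \<open>If \<open>c\<close> is not among the targets then \<open>fanout_bits c ts\<close> is an involution, so composing the
  amplitudes with it is the linear map sending \<open>ket z\<close> to \<open>ket (fanout_bits c ts z)\<close>.\<close>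

fun apply_gate :: "(complex^bool^bool) gate \<Rightarrow> state \<Rightarrow> state" where
  "apply_gate (One U q) \<psi> = (\<lambda>z. \<Sum>b\<in>UNIV. U $ (z ! q) $ b * \<psi> (z[q := b]))"
| "apply_gate (CNOT c t) \<psi> = (\<lambda>z. \<psi> (fanout_bits c [t] z))"
| "apply_gate (Fanout c ts) \<psi> = (\<lambda>z. \<psi> (fanout_bits c ts z))"

definition run_circuit :: "(complex^bool^bool) circuit \<Rightarrow> state \<Rightarrow> state" where
  "run_circuit C = fold (fold apply_gate) (layers C)"

text \<open>An operator on \<open>m\<close> qubits is a pair \<open>(m, K)\<close> with \<open>K z x\<close> the matrix entry in row \<open>z\<close> and
  column \<open>x\<close>. The remaining wires of the circuit are ancillas, which start in and return to zero.\<close>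

type_synonym operator = "nat \<times> (bool list \<Rightarrow> bool list \<Rightarrow> complex)"

fun computes :: "(complex^bool^bool) circuit \<Rightarrow> operator \<Rightarrow> bool" where
  "computes C (m, K) \<longleftrightarrow> m \<le> wires C \<and>
     (let anc = replicate (wires C - m) False in
      \<forall>x. length x = m \<longrightarrow>
        run_circuit C (ket (x @ anc)) =
        (\<lambda>z. \<Sum>y | length y = m. K y x * ket (y @ anc) z))"


text \<open>Every one-qubit gate has the form \<open>u_gate \<alpha> \<gamma> \<phi> \<omega>\<close>.\<close>

definition u_gate :: "real \<Rightarrow> real \<Rightarrow> real \<Rightarrow> real \<Rightarrow> complex^bool^bool" where
  "u_gate \<alpha> \<gamma> \<phi> \<omega> = (\<chi> i j.
     if \<not> i \<and> \<not> j then cis \<alpha> * cos \<gamma>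
     else if \<not> i then - cis (\<alpha> + \<omega>) * sin \<gamma>
     else if \<not> j then cis (\<alpha> + \<phi>) * sin \<gamma>
     else cis (\<alpha> + \<phi> + \<omega>) * cos \<gamma>)"

lemma unitary_iff_entries:
  "unitary U \<longleftrightarrow>
     (\<forall>i j. (\<Sum>k\<in>UNIV. U $ i $ k * cnj (U $ j $ k)) = of_bool (i = j)) \<and>
     (\<forall>i j. (\<Sum>k\<in>UNIV. cnj (U $ k $ i) * U $ k $ j) = of_bool (i = j))"
  by (simp add: unitary_def vec_eq_iff matrix_matrix_mult_def mat_def of_bool_def)

lemma unitary_iff_u_gate: "unitary U \<longleftrightarrow> (\<exists>\<alpha> \<gamma> \<phi> \<omega>. U = u_gate \<alpha> \<gamma> \<phi> \<omega>)"
proof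
  assume U: "unitary U"
  define a b c d where
    abcd: "a = U $ False $ False" "b = U $ False $ True" "c = U $ True $ False" "d = U $ True $ True"
  have eqs: "a * cnj a + b * cnj b = 1" "c * cnj c + d * cnj d = 1" "cnj a * a + cnj c * c = 1"
    "cnj a * b + cnj c * d = 0"
    using U[unfolded unitary_iff_entries all_bool_eq UNIV_bool] by (simp_all flip: abcd add: add.commute)
  have sq: "x * cnj x = complex_of_real ((cmod x)\<^sup>2)" "cnj x * x = complex_of_real ((cmod x)\<^sup>2)" for x
    by (metis complex_norm_square mult.commute)+
  have n: "(cmod a)\<^sup>2 + (cmod b)\<^sup>2 = 1" "(cmod c)\<^sup>2 + (cmod d)\<^sup>2 = 1" "(cmod a)\<^sup>2 + (cmod c)\<^sup>2 = 1"
    using eqs(1-3) unfolding sq of_real_add[symmetric] of_real_eq_1_iff .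
  have "(cmod b)\<^sup>2 = (cmod c)\<^sup>2" "(cmod d)\<^sup>2 = (cmod a)\<^sup>2"
    using n by linarith+
  then have bc: "cmod b = cmod c" and da: "cmod d = cmod a"
    by simp_all
  obtain \<gamma> where g: "cmod a = cos \<gamma>" "cmod c = sin \<gamma>"
    using sincos_total_2pi[OF n(3)] by metis
  have pol: "z = cis (Arg z) * cmod z" for z
    using rcis_cmod_Arg[of z] by (simp add: rcis_def mult.commute)
  have ext: "U = u_gate \<alpha> \<gamma> \<phi> \<omega>"
    if "a = cis \<alpha> * cos \<gamma>" "b = - cis (\<alpha> + \<omega>) * sin \<gamma>" "c = cis (\<alpha> + \<phi>) * sin \<gamma>"
      "d = cis (\<alpha> + \<phi> + \<omega>) * cos \<gamma>" for \<alpha> \<phi> \<omega>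
    using that by (simp add: vec_eq_iff u_gate_def abcd all_bool_eq)
  show "\<exists>\<alpha> \<gamma> \<phi> \<omega>. U = u_gate \<alpha> \<gamma> \<phi> \<omega>"
  proof (cases "a = 0")
    case True
    then have "d = 0" "cos \<gamma> = 0" using da g by auto
    moreover have "- b = cis (Arg (- b)) * sin \<gamma>" "c = cis (Arg c) * sin \<gamma>"
      using pol[of "- b"] pol[of c] unfolding norm_minus_cancel bc g(2) .
    then have "b = - cis (Arg (- b)) * sin \<gamma>" "c = cis (Arg c) * sin \<gamma>"
      by (metis minus_minus mult_minus_left)+
    ultimately have "U = u_gate 0 \<gamma> (Arg c) (Arg (- b))"
      using True by (intro ext) (simp_all only: add_0 add_0_right mult_zero_right of_real_0 flip: add.assoc)
    then show ?thesis by blast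
  next
    case False
    have a: "a = cis (Arg a) * cos \<gamma>" and c: "c = cis (Arg c) * sin \<gamma>" and d: "d = cis (Arg d) * cos \<gamma>"
      using pol g da by metis+
    have "cnj a \<noteq> 0" using False by simp
    moreover have "cnj a * b = cnj a * (- cis (Arg a + (Arg d - Arg c)) * sin \<gamma>)"
    proof -
      have "cnj a * b = - (cnj c * d)" using eqs(4) by (simp add: eq_neg_iff_add_eq_0)
      also have "cnj c * d = cis (Arg d - Arg c) * sin \<gamma> * cos \<gamma>"
        by (subst c, subst d) (simp add: cis_cnj cis_mult[symmetric] diff_conv_add_uminus
            del: add_uminus_conv_diff)
      also have "- \<dots> = cnj a * (- cis (Arg a + (Arg d - Arg c)) * sin \<gamma>)"
      proof -
        have "cnj a = cis (- Arg a) * cos \<gamma>" by (subst a) (simp add: cis_cnj)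
        moreover have "cis (- Arg a) * cis (Arg a + (Arg d - Arg c)) = cis (Arg d - Arg c)"
          by (simp add: cis_mult)
        ultimately show ?thesis by (simp add: algebra_simps)
      qed
      finally show ?thesis .
    qed
    ultimately have b: "b = - cis (Arg a + (Arg d - Arg c)) * sin \<gamma>" by (metis mult_left_cancel)
    have "U = u_gate (Arg a) \<gamma> (Arg c - Arg a) (Arg d - Arg c)"
      by (intro ext) (use a b c d in \<open>simp_all only: add_diff_cancel_left' diff_add_cancel
          add.commute[of "Arg a"] add.commute[of "Arg c"]\<close>)
    then show ?thesis by blast
  qed
next
  assume "\<exists>\<alpha> \<gamma> \<phi> \<omega>. U = u_gate \<alpha> \<gamma> \<phi> \<omega>"
  then obtain \<alpha> \<gamma> \<phi> \<omega> where U: "U = u_gate \<alpha> \<gamma> \<phi> \<omega>" by blast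
  define p q r C S where d: "p = cis \<alpha>" "q = cis \<phi>" "r = cis \<omega>"
    "C = complex_of_real (cos \<gamma>)" "S = complex_of_real (sin \<gamma>)"
  have sc: "C\<^sup>2 + S\<^sup>2 = 1"
    unfolding d by (metis of_real_1 of_real_add of_real_power sin_cos_squared_add2)
  have cc: "p * cnj p = 1" "q * cnj q = 1" "r * cnj r = 1" "cnj C = C" "cnj S = S"
    by (simp_all add: d cis_cnj cis_mult)
  have e: "U $ False $ False = p * C" "U $ False $ True = - (p * r) * S"
    "U $ True $ False = p * q * S" "U $ True $ True = p * q * r * C"
    by (simp_all add: U u_gate_def d cis_mult)
  have ent:
    "p * C * cnj (p * C) + p * r * S * cnj (p * r * S) = (p * cnj p) * (C\<^sup>2 + (r * cnj r) * S\<^sup>2)"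
    "p * q * S * cnj (p * q * S) + p * q * r * C * cnj (p * q * r * C) = (p * cnj p) * (q * cnj q) * (S\<^sup>2 + (r * cnj r) * C\<^sup>2)"
    "cnj (p * C) * (p * C) + cnj (p * q * S) * (p * q * S) = (p * cnj p) * (C\<^sup>2 + (q * cnj q) * S\<^sup>2)"
    "cnj (p * r * S) * (p * r * S) + cnj (p * q * r * C) * (p * q * r * C) = (p * cnj p) * (r * cnj r) * (S\<^sup>2 + (q * cnj q) * C\<^sup>2)"
    "p * C * cnj (p * q * S) = (p * cnj p) * cnj q * C * S"
    "p * r * S * cnj (p * q * r * C) = (p * cnj p) * (r * cnj r) * cnj q * C * S"
    "p * q * S * cnj (p * C) = (p * cnj p) * q * C * S"
    "p * q * r * C * cnj (p * r * S) = (p * cnj p) * (r * cnj r) * q * C * S"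
    "cnj (p * C) * (p * r * S) = (p * cnj p) * r * C * S"
    "cnj (p * q * S) * (p * q * r * C) = (p * cnj p) * (q * cnj q) * r * C * S"
    "cnj (p * r * S) * (p * C) = (p * cnj p) * cnj r * C * S"
    "cnj (p * q * r * C) * (p * q * S) = (p * cnj p) * (q * cnj q) * cnj r * C * S"
    by (simp_all add: cc(4,5) power2_eq_square distrib_left mult_ac)
  have "S\<^sup>2 + C\<^sup>2 = 1" using sc by (simp add: add.commute)
  note ent = ent[unfolded cc(1-3) mult_1_left sc this]
  show "unitary U"
    unfolding unitary_iff_entries all_bool_eq UNIV_bool
    by (simp add: e ent add.commute del: complex_cnj_mult)
qed

text \<open>A finite description of a circuit cannot contain an arbitrary complex matrix. Each circuit
  family may fix finitely many arbitrary real constants \<open>\<theta>s\<close>, and a one-qubit gate is described by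
  its four angles, each a rational multiple \<open>(p / q) \<theta>s ! k\<close> of one of these constants. Hence every
  one-qubit gate may occur in a uniform family, and no finite basis is imposed.\<close>

type_synonym angle_code = "nat \<times> nat \<times> nat"
type_synonym gate_code = "angle_code \<times> angle_code \<times> angle_code \<times> angle_code"

fun angle_of :: "real list \<Rightarrow> angle_code \<Rightarrow> real" where
  "angle_of \<theta>s (k, p, q) = (if k < length \<theta>s then real p / real q * \<theta>s ! k else 0)"

fun gate_of :: "real list \<Rightarrow> gate_code \<Rightarrow> complex^bool^bool" where
  "gate_of \<theta>s (a, b, c, d) = u_gate (angle_of \<theta>s a) (angle_of \<theta>s b) (angle_of \<theta>s c) (angle_of \<theta>s d)"

datatype token = Bit bool | Sep | One_Tok | CNOT_Tok | Fanout_Tok | Layer_Tok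

text \<open>Binary representation, least significant bit first, without superfluous zeros.\<close>

fun nat_bits :: "nat \<Rightarrow> bool list" where
  "nat_bits n = (if n = 0 then [] else odd n # nat_bits (n div 2))"

declare nat_bits.simps [simp del]

definition encode_nats :: "nat list \<Rightarrow> token list" where
  "encode_nats ns = concat (map (\<lambda>n. map Bit (nat_bits n) @ [Sep]) ns)"

fun encode_gate :: "gate_code gate \<Rightarrow> token list" where
  "encode_gate (One ((k1, p1, q1), (k2, p2, q2), (k3, p3, q3), (k4, p4, q4)) q) =
     One_Tok # encode_nats [q, k1, p1, q1, k2, p2, q2, k3, p3, q3, k4, p4, q4]"
| "encode_gate (CNOT c t) = CNOT_Tok # encode_nats [c, t]"
| "encode_gate (Fanout c ts) = Fanout_Tok # encode_nats (c # ts)"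

definition encode_circuit :: "gate_code circuit \<Rightarrow> token list" where
  "encode_circuit D = encode_nats [wires D] @
     concat (map (\<lambda>l. Layer_Tok # concat (map encode_gate l)) (layers D))"


text \<open>Deterministic Turing machines with a two-way read-only input tape, finitely many work tapes
  that are infinite to the right, and a write-only output tape. States and work symbols are
  numbers below fixed bounds; the initial state and the blank symbol are \<open>0\<close>. The value \<open>None\<close>
  of the transition function means that the machine halts.\<close>

datatype move = Left | Stay | Right

datatype input_symbol = Left_End | Input bool | Right_End

record machine =
  tm_states :: nat
  tm_symbols :: nat
  tm_tapes :: nat
  tm_delta :: "nat \<Rightarrow> input_symbol \<Rightarrow> nat list \<Rightarrow>
                 (nat \<times> move \<times> (nat \<times> move) list \<times> token option) option"

definition wf_machine :: "machine \<Rightarrow> bool" where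
  "wf_machine M \<longleftrightarrow> 0 < tm_states M \<and> 0 < tm_symbols M \<and>
     (\<forall>s a ws s' mv acts out.
        s < tm_states M \<longrightarrow> length ws = tm_tapes M \<longrightarrow> (\<forall>b\<in>set ws. b < tm_symbols M) \<longrightarrow>
        tm_delta M s a ws = Some (s', mv, acts, out) \<longrightarrow>
        s' < tm_states M \<and> length acts = tm_tapes M \<and> (\<forall>(b, _)\<in>set acts. b < tm_symbols M))"

fun move_head :: "move \<Rightarrow> nat \<Rightarrow> nat" where
  "move_head Left p = p - 1"
| "move_head Stay p = p"
| "move_head Right p = p + 1"

definition read_input :: "bool list \<Rightarrow> nat \<Rightarrow> input_symbol" where
  "read_input w p =
     (if p = 0 then Left_End else if p \<le> length w then Input (w ! (p - 1)) else Right_End)"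

record config =
  cf_state :: nat
  cf_input :: nat
  cf_work :: "((nat \<Rightarrow> nat) \<times> nat) list"
  cf_output :: "token list"

definition tm_init :: "machine \<Rightarrow> config" where
  "tm_init M = \<lparr>cf_state = 0, cf_input = 0, cf_work = replicate (tm_tapes M) (\<lambda>_. 0, 0),
                cf_output = []\<rparr>"

text \<open>The input head cannot move beyond the right end marker.\<close>

definition tm_step :: "machine \<Rightarrow> bool list \<Rightarrow> config \<Rightarrow> config option" where
  "tm_step M w c =
     (case tm_delta M (cf_state c) (read_input w (cf_input c)) (map (\<lambda>(f, p). f p) (cf_work c)) of
        None \<Rightarrow> None
      | Some (s, mv, acts, out) \<Rightarrow>
          Some \<lparr>cf_state = s,
                cf_input = min (length w + 1) (move_head mv (cf_input c)),
                cf_work = map2 (\<lambda>(f, p) (b, m). (f(p := b), move_head m p)) (cf_work c) acts,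
                cf_output = cf_output c @ (case out of None \<Rightarrow> [] | Some a \<Rightarrow> [a])\<rparr>)"

definition tm_reachable :: "machine \<Rightarrow> bool list \<Rightarrow> config \<Rightarrow> bool" where
  "tm_reachable M w c \<longleftrightarrow> (\<lambda>c c'. tm_step M w c = Some c')\<^sup>*\<^sup>* (tm_init M) c"

definition tm_outputs :: "machine \<Rightarrow> bool list \<Rightarrow> token list \<Rightarrow> bool" where
  "tm_outputs M w v \<longleftrightarrow> (\<exists>c. tm_reachable M w c \<and> tm_step M w c = None \<and> cf_output c = v)"

text \<open>On every work tape only the first \<open>s\<close> cells are visited.\<close>

definition tm_space_le :: "machine \<Rightarrow> bool list \<Rightarrow> real \<Rightarrow> bool" where
  "tm_space_le M w s \<longleftrightarrow>
     (\<forall>c. tm_reachable M w c \<longrightarrow> (\<forall>(f, p)\<in>set (cf_work c). real (p + 1) \<le> s))"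


text \<open>Families are indexed by \<open>n\<close> and a parameter \<open>t \<le> n\<close>. The machine receives both in unary.\<close>

definition index_word :: "nat \<Rightarrow> nat \<Rightarrow> bool list" where
  "index_word n t = replicate n True @ [False] @ replicate t True"

definition log_space_uniform :: "(nat \<Rightarrow> nat \<Rightarrow> gate_code circuit) \<Rightarrow> bool" where
  "log_space_uniform D \<longleftrightarrow>
     (\<exists>M. wf_machine M \<and>
        (\<forall>n. \<forall>t\<le>n. tm_outputs M (index_word n t) (encode_circuit (D n t))) \<and>
        (\<exists>c. \<forall>\<^sub>F n in at_top. \<forall>t\<le>n. tm_space_le M (index_word n t) (c * log 2 (real n))))"

text \<open>The family \<open>F\<close> is computed exactly by a uniform family of quantum circuits with fan-out of
  depth \<open>O(d n)\<close> and size \<open>O(s n)\<close>, with constants independent of \<open>t\<close>.\<close>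

definition fanout_computable ::
    "(nat \<Rightarrow> nat \<Rightarrow> operator) \<Rightarrow> (nat \<Rightarrow> real) \<Rightarrow> (nat \<Rightarrow> real) \<Rightarrow> bool" where
  "fanout_computable F d s \<longleftrightarrow>
     (\<exists>\<theta>s D. log_space_uniform D \<and>
        (\<forall>n. \<forall>t\<le>n. let C = map_circuit (gate_of \<theta>s) (D n t) in wf_circuit C \<and> computes C (F n t)) \<and>
        (\<exists>c. \<forall>\<^sub>F n in at_top. \<forall>t\<le>n. real (depth (D n t)) \<le> c * d n) \<and>
        (\<exists>c. \<forall>\<^sub>F n in at_top. \<forall>t\<le>n. real (circuit_size (D n t)) \<le> c * s n))"

definition QNC_f :: "(nat \<Rightarrow> real) \<Rightarrow> (nat \<Rightarrow> nat \<Rightarrow> operator) set" where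
  "QNC_f d = {F. \<exists>k. fanout_computable F d (\<lambda>n. real n ^ k)}"


text \<open>The last of the \<open>n + 1\<close> qubits is the target.\<close>

definition exact_gate :: "nat \<Rightarrow> nat \<Rightarrow> operator" where
  "exact_gate n t =
     (n + 1, \<lambda>z v. let x = butlast v; y = last v in
                   of_bool (z = x @ [y \<noteq> (count_list x True = t)]))"

end

theory Submission
  imports Defs
begin

text \<open>Constant depth suffices. Using fan-out, the phase \<open>t - \<bar>x\<bar>\<close> is rotated in parallel into about
  \<open>log n\<close> qubits, with angles such that all of them end in the state zero if \<open>\<bar>x\<bar> = t\<close> and at least
  one of them ends in the state one otherwise (the OR reduction of Hoyer and Spalek). There are only
  \<open>O(n)\<close> parities of these qubits; they are computed at once, and either all or exactly half of them
  vanish, so one more rotation by an angle proportional to their number yields the exact answer.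
  All three steps are instances of one gadget consisting of self-inverse gates, so the result can be
  copied to the target and the computation be undone by the reversed circuit. Wire numbers and angles
  are given by bounded sums, hence a log-space machine can print them with binary counters.\<close>

section \<open>Programming log-space machines\<close>

subsection \<open>A structured language for Turing machines\<close>

text \<open>A phase gate is diagonal and not self-inverse. It is replaced by an off-diagonal
  reflection, which multiplies by a phase while flipping the bit; the flip is undone with the rest
  of the computation. As all gates are self-inverse, reversing the layers inverts the circuit, and
  correctness needs no amplitudes, only the support of the computed state. Exactness rests on the
  2-adic valuation: a nonzero \<open>t - |x|\<close> is an odd multiple of a power of two
  \<open>c <= n\<close>, and the qubit that belongs to \<open>c\<close> is turned by an odd multiple
  of pi. With \<open>m\<close> such qubits there are \<open>2 ^ m <= 2 * n + 2\<close> parities, and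
  the three stages have \<open>n * m\<close>, at most \<open>m * 2 ^ m\<close>, and
  \<open>2 ^ m\<close> edges: this gives the size \<open>O(n log n)\<close>. The depth is 37, which
  is within the bound since \<open>log_star\<close> is at least 1 on positive reals. Uniformity is
  the reason for the shape of the index functions: everything has to be computed with counters of
  polynomially bounded value. So qubits keep the sparse indices \<open>c - 1\<close> instead of
  being renumbered by logarithms, and a wire number is a numeral in base
  \<open>2 * n + 3\<close>.\<close>

datatype com =
    Input_Right
  | Write nat nat
  | Move nat move
  | Emit token
  | Seq com com (infixr ";;" 60)
  | Cond nat "input_symbol \<Rightarrow> nat \<Rightarrow> bool" com com
  | While nat "input_symbol \<Rightarrow> nat \<Rightarrow> bool" com

text \<open>There are infinitely many tapes, so that programs can be composed before the number of
  tapes is known; \<open>uses K\<close> cuts them down to \<open>K\<close>, a bound that serves for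
  tapes and tape symbols alike.\<close>

type_synonym mem = "nat \<times> (nat \<Rightarrow> (nat \<Rightarrow> nat) \<times> nat) \<times> token list"

fun step :: "bool list \<Rightarrow> com list \<times> mem \<Rightarrow> (com list \<times> mem) option" where
  "step w ([], \<sigma>) = None"
| "step w (Input_Right # cs, (p, T, v)) = Some (cs, (min (length w + 1) (p + 1), T, v))"
| "step w (Write r b # cs, (p, T, v)) = Some (cs, (p, T(r := ((fst (T r))(snd (T r) := b), snd (T r))), v))"
| "step w (Move r m # cs, (p, T, v)) = Some (cs, (p, T(r := (fst (T r), move_head m (snd (T r)))), v))"
| "step w (Emit a # cs, (p, T, v)) = Some (cs, (p, T, v @ [a]))"
| "step w (Seq a b # cs, \<sigma>) = Some (a # b # cs, \<sigma>)"
| "step w (Cond r t a b # cs, (p, T, v)) =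
     Some ((if t (read_input w p) (fst (T r) (snd (T r))) then a else b) # cs, (p, T, v))"
| "step w (While r t a # cs, (p, T, v)) =
     Some (if t (read_input w p) (fst (T r) (snd (T r))) then a # While r t a # cs else cs, (p, T, v))"

fun uses :: "nat \<Rightarrow> com \<Rightarrow> bool" where
  "uses K Input_Right = True"
| "uses K (Write r b) = (r < K \<and> b < K)"
| "uses K (Move r m) = (r < K)"
| "uses K (Emit a) = True"
| "uses K (Seq a b) = (uses K a \<and> uses K b)"
| "uses K (Cond r t a b) = (r < K \<and> uses K a \<and> uses K b)"
| "uses K (While r t a) = (r < K \<and> uses K a)"

lemma uses_mono: "uses K c \<Longrightarrow> K \<le> K' \<Longrightarrow> uses K' c"
  by (induction c) auto

lemma ex_uses: "\<exists>K. uses K c"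
proof (induction c)
  case (Seq a b)
  then obtain K K' where "uses K a" "uses K' b" by blast
  then have "uses (max K K') (a ;; b)" by (auto intro: uses_mono)
  then show ?case ..
next
  case (Cond r t a b)
  then obtain K K' where "uses K a" "uses K' b" by blast
  then have "uses (max (Suc r) (max K K')) (Cond r t a b)" by (auto intro: uses_mono)
  then show ?case ..
next
  case (While r t a)
  then obtain K where "uses K a" by blast
  then have "uses (max (Suc r) K) (While r t a)" by (auto intro: uses_mono)
  then show ?case ..
next
  case (Write r b)
  show ?case by (rule exI[of _ "Suc (max r b)"]) auto
qed (auto intro: exI[of _ "Suc _"])

text \<open>The body of a loop runs on top of the loop itself, which is removed and pushed again in
  each round. The depth of a stack is thus bounded by the nesting of \<open>c\<close>, and finitely
  many machine states suffice.\<close>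

fun stacks :: "com \<Rightarrow> com list \<Rightarrow> com list set" where
  "stacks (Seq a b) cs = insert (Seq a b # cs) (stacks a (b # cs) \<union> stacks b cs)"
| "stacks (Cond r t a b) cs = insert (Cond r t a b # cs) (stacks a cs \<union> stacks b cs)"
| "stacks (While r t a) cs = insert (While r t a # cs) (stacks a (While r t a # cs))"
| "stacks c cs = {c # cs}"

lemma finite_stacks: "finite (stacks c cs)"
  by (induction c cs rule: stacks.induct) auto

lemma head_in_stacks: "c # cs \<in> stacks c cs"
  by (cases c) auto

lemma step_stacks: "x \<in> stacks c cs \<Longrightarrow> step w (x, \<sigma>) = Some (y, \<sigma>') \<Longrightarrow> y \<in> insert cs (stacks c cs)"
proof (induction c cs arbitrary: x rule: stacks.induct)
  case (1 a b cs)
  then show ?case using head_in_stacks[of a "b # cs"] head_in_stacks[of b cs] by auto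
next
  case (2 r t a b cs)
  then show ?case using head_in_stacks[of a cs] head_in_stacks[of b cs]
    by (cases \<sigma>) (auto split: if_splits)
next
  case (3 r t a cs)
  then show ?case using head_in_stacks[of a "While r t a # cs"]
    by (cases \<sigma>) (auto split: if_splits)
qed (cases \<sigma>; auto)+

lemma uses_stacks: "uses K c \<Longrightarrow> list_all (uses K) cs \<Longrightarrow> x \<in> stacks c cs \<Longrightarrow> list_all (uses K) x"
  by (induction c cs arbitrary: x rule: stacks.induct) auto

section \<open>Translation of commands into a transition function\<close>

definition keep :: "nat list \<Rightarrow> (nat \<times> move) list" where
  "keep ws = map (\<lambda>b. (b, Stay)) ws"

fun act :: "com list \<Rightarrow> input_symbol \<Rightarrow> nat list \<Rightarrow>
    (com list \<times> move \<times> (nat \<times> move) list \<times> token option) option" where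
  "act [] a ws = None"
| "act (Input_Right # cs) a ws = Some (cs, Right, keep ws, None)"
| "act (Write r b # cs) a ws = Some (cs, Stay, (keep ws)[r := (b, Stay)], None)"
| "act (Move r m # cs) a ws = Some (cs, Stay, (keep ws)[r := (ws ! r, m)], None)"
| "act (Emit x # cs) a ws = Some (cs, Stay, keep ws, Some x)"
| "act (Seq c d # cs) a ws = Some (c # d # cs, Stay, keep ws, None)"
| "act (Cond r t c d # cs) a ws = Some ((if t a (ws ! r) then c else d) # cs, Stay, keep ws, None)"
| "act (While r t c # cs) a ws =
     Some (if t a (ws ! r) then c # While r t c # cs else cs, Stay, keep ws, None)"

lemma set_list_update_subset: "x \<in> set (xs[i := y]) \<Longrightarrow> x \<in> set xs \<or> x = y"
  using set_update_subset_insert[of xs i y] by auto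

lemma act_wf:
  assumes "act x a ws = Some (y, mv, acts, out)" "list_all (uses K) x"
    "length ws = K" "\<forall>b\<in>set ws. b < K"
  shows "length acts = K" "\<forall>(b, m)\<in>set acts. b < K"
proof -
  show "length acts = K"
    using assms by (cases "(x, a, ws)" rule: act.cases) (auto simp: keep_def)
  show "\<forall>(b, m)\<in>set acts. b < K"
    using assms
    by (cases "(x, a, ws)" rule: act.cases)
      (auto simp: keep_def dest!: set_list_update_subset)
qed

text \<open>The states of the machine are the finitely many stacks of pending commands that can occur.\<close>

locale compiled =
  fixes c :: com and K :: nat and h :: "com list \<Rightarrow> nat"
  assumes K: "uses K c" "0 < K"
    and bij: "bij_betw h (insert [] (stacks c [])) {..<card (insert [] (stacks c []))}"
    and h0: "h [c] = 0"
begin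

abbreviation Q where "Q \<equiv> insert [] (stacks c [])"

definition M :: machine where
  "M = \<lparr>tm_states = card Q, tm_symbols = K, tm_tapes = K,
        tm_delta = (\<lambda>s a ws. map_option (\<lambda>(x, r). (h x, r)) (act (the_inv_into Q h s) a ws))\<rparr>"

fun conf :: "com list \<times> mem \<Rightarrow> config" where
  "conf (x, (p, T, v)) = \<lparr>cf_state = h x, cf_input = p, cf_work = map T [0..<K], cf_output = v\<rparr>"

lemma decode: "x \<in> Q \<Longrightarrow> the_inv_into Q h (h x) = x"
  using bij by (simp add: bij_betw_def the_inv_into_f_f)

lemma h_less: "x \<in> Q \<Longrightarrow> h x < card Q"
  using bij by (auto simp: bij_betw_def)

lemma uses_Q: "x \<in> Q \<Longrightarrow> list_all (uses K) x"
  using uses_stacks[OF K(1), of "[]"] by auto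

lemma step_Q: "x \<in> Q \<Longrightarrow> step w (x, \<sigma>) = Some (y, \<sigma>') \<Longrightarrow> y \<in> Q"
  using step_stacks[of x c "[]" w \<sigma> y \<sigma>'] by (cases "x = []") simp_all

text \<open>Every combination of scanned symbols occurs for some input word and some memory, so
  closure of \<open>Q\<close> under \<open>act\<close> follows from closure under
  \<open>step\<close>.\<close>

lemma act_Q: "x \<in> Q \<Longrightarrow> act x a ws = Some (y, r) \<Longrightarrow> y \<in> Q"
proof -
  assume x: "x \<in> Q" and "act x a ws = Some (y, r)"
  moreover have "\<exists>w \<sigma> \<sigma>'. act x a ws = Some (y, r) \<longrightarrow> step w (x, \<sigma>) = Some (y, \<sigma>')"
  proof -
    obtain w p where p: "read_input w p = a"
    proof (cases a)
      case Left_End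
      then show ?thesis using that[of "[]" 0] by (simp add: read_input_def)
    next
      case (Input b)
      then show ?thesis using that[of "[b]" 1] by (simp add: read_input_def)
    next
      case Right_End
      then show ?thesis using that[of "[]" 1] by (simp add: read_input_def)
    qed
    let ?\<sigma> = "(p, \<lambda>r. (\<lambda>_. ws ! r, 0::nat), []::token list)"
    have "act x a ws = Some (y, r) \<longrightarrow> (\<exists>\<sigma>'. step w (x, ?\<sigma>) = Some (y, \<sigma>'))"
      using p by (cases "(x, a, ws)" rule: act.cases) auto
    then show ?thesis by blast
  qed
  ultimately show ?thesis using step_Q[OF x] by blast
qed

lemma wf: "wf_machine M"
proof -
  have "finite Q" by (simp add: finite_stacks)
  then have pos: "0 < card Q" by (auto simp: card_gt_0_iff)
  show ?thesis
    unfolding wf_machine_def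
  proof (intro conjI allI impI)
    show "0 < tm_states M" "0 < tm_symbols M" using pos K by (simp_all add: M_def)
  next
    fix s a ws s' mv acts out
    assume s: "s < tm_states M" and l: "length ws = tm_tapes M" "\<forall>b\<in>set ws. b < tm_symbols M"
      and d: "tm_delta M s a ws = Some (s', mv, acts, out)"
    define x where "x = the_inv_into Q h s"
    have x: "x \<in> Q"
      unfolding x_def using bij s by (intro the_inv_into_into) (auto simp: bij_betw_def M_def)
    obtain y where y: "act x a ws = Some (y, mv, acts, out)" "s' = h y"
      using d by (auto simp: M_def x_def)
    show "s' < tm_states M" using h_less[OF act_Q[OF x y(1)]] y(2) by (simp add: M_def)
    show "length acts = tm_tapes M" "\<forall>(b, _)\<in>set acts. b < tm_symbols M"
      using act_wf[OF y(1) uses_Q[OF x]] l by (auto simp: M_def)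
  qed
qed

lemma map2_keep:
  "map2 (\<lambda>(f, p) (b, m). (f(p := b), move_head m p)) (map T [0..<K]) (keep (map (\<lambda>(f, p). f p) (map T [0..<K])))
    = map T [0..<K]"
  by (rule nth_equalityI) (auto simp: keep_def split: prod.split)

lemma map2_update:
  assumes "r < K"
  shows "map2 (\<lambda>(f, p) (b, m). (f(p := b), move_head m p)) (map T [0..<K])
      ((keep (map (\<lambda>(f, p). f p) (map T [0..<K])))[r := (b, m)])
    = map (T(r := ((fst (T r))(snd (T r) := b), move_head m (snd (T r))))) [0..<K]"
  by (rule nth_equalityI) (use assms in \<open>auto simp: keep_def nth_list_update split: prod.split\<close>)

lemma tm_step_conf:
  assumes x: "x \<in> Q" and p: "p \<le> length w + 1"
  shows "tm_step M w (conf (x, (p, T, v))) = map_option conf (step w (x, (p, T, v)))"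
proof -
  have sym: "r < K \<Longrightarrow> map (\<lambda>(f, p). f p) (map T [0..<K]) ! r = fst (T r) (snd (T r))" for r
    by (simp add: split_def)
  have sym': "(case T r of (f, x) \<Rightarrow> f x) = fst (T r) (snd (T r))" for r
    by (simp add: split_def)
  have min: "min (Suc (length w)) p = p" using p by simp
  note u = uses_Q[OF x]
  show ?thesis
    using x u
    by (cases "(w, x, p, T, v)" rule: step.cases)
      (simp_all add: tm_step_def M_def decode map2_keep map2_update sym sym' min del: map_map)
qed

lemma step_input: "p \<le> length w + 1 \<Longrightarrow> step w (x, (p, T, v)) = Some (y, (p', T', v')) \<Longrightarrow> p' \<le> length w + 1"
  by (cases "(w, x, p, T, v)" rule: step.cases) (auto split: if_splits)

end

section \<open>Runs in bounded space and their simulation by the machine\<close>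

definition ok :: "nat \<Rightarrow> mem \<Rightarrow> bool" where
  "ok S \<sigma> \<longleftrightarrow> (\<forall>r. snd (fst (snd \<sigma>) r) < S)"

definition path :: "nat \<Rightarrow> bool list \<Rightarrow> com list \<times> mem \<Rightarrow> com list \<times> mem \<Rightarrow> bool" where
  "path S w = (\<lambda>x y. step w x = Some y \<and> ok S (snd x) \<and> ok S (snd y))\<^sup>*\<^sup>*"

text \<open>The quantification over the pending commands \<open>cs\<close> makes sequencing
  compositional. An empty path carries no information on space, hence the separate \<open>ok\<close>
  for both ends.\<close>

definition exec :: "nat \<Rightarrow> bool list \<Rightarrow> com \<Rightarrow> mem \<Rightarrow> mem \<Rightarrow> bool" where
  "exec S w c \<sigma> \<sigma>' \<longleftrightarrow> ok S \<sigma> \<and> ok S \<sigma>' \<and> (\<forall>cs. path S w (c # cs, \<sigma>) (cs, \<sigma>'))"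

context compiled begin

text \<open>The machine is deterministic, so one halting run passes through all reachable
  configurations, and a space bound for the run is one for the machine. Tapes from \<open>K\<close>
  on are free because \<open>conf\<close> forgets them.\<close>

lemma simulation:
  assumes e: "exec S w c (0, T, []) (p', T', v)" and T: "map T [0..<K] = replicate K (\<lambda>_. 0, 0)"
  shows "tm_outputs M w v" and "real S \<le> s \<Longrightarrow> tm_space_le M w s"
proof -
  let ?R = "\<lambda>c c'. tm_step M w c = Some c'"
  let ?good = "\<lambda>z. fst z \<in> Q \<and> fst (snd z) \<le> length w + 1"
  have good_step: "?good y" if "?good x" "step w x = Some y" for x y
    using that step_Q[of "fst x" w "snd x" "fst y" "snd y"]
      step_input[of "fst (snd x)" w "fst x" "fst (snd (snd x))" "snd (snd (snd x))" "fst y"]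
    by (cases y) auto
  have tm: "tm_step M w (conf x) = map_option conf (step w x)" if "?good x" for x
    using that tm_step_conf[of "fst x" "fst (snd x)" w] by (cases x) auto
  have init: "tm_init M = conf ([c], (0, T, []))"
    by (simp add: tm_init_def h0 T) (simp add: M_def)
  have g0: "?good ([c], (0, T, []))" using head_in_stacks[of c "[]"] by simp
  have ok: "ok S (0, T, [])" using e by (simp add: exec_def)
  have "path S w ([c], (0, T, [])) ([], (p', T', v))"
    using e by (simp add: exec_def)
  then have "?good ([c], (0, T, [])) \<Longrightarrow> ?R\<^sup>*\<^sup>* (conf ([c], (0, T, []))) (conf ([], (p', T', v))) \<and> ?good ([], (p', T', v))"
    unfolding path_def
  proof (induction rule: rtranclp_induct)
    case (step y z)
    then have "?R (conf y) (conf z)" using tm[of y] by simp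
    then show ?case using step good_step[of y z] by (meson rtranclp.rtrancl_into_rtrancl)
  qed simp
  then have r: "?R\<^sup>*\<^sup>* (conf ([c], (0, T, []))) (conf ([], (p', T', v)))" "?good ([], (p', T', v))"
    using g0 by blast+
  have "tm_step M w (conf ([], (p', T', v))) = None" using tm[OF r(2)] by simp
  then show "tm_outputs M w v"
    unfolding tm_outputs_def tm_reachable_def init
    by (intro exI[of _ "conf ([], (p', T', v))"]) (use r in auto)
  \<comment> \<open>The rest of the halting path travels along as the invariant: its first step is
    the only possible one.\<close>
  have all: "\<exists>x. d = conf x \<and> ?good x \<and> ok S (snd x) \<and> path S w x ([], (p', T', v))"
    if "?R\<^sup>*\<^sup>* (conf ([c], (0, T, []))) d" for d
    using that
  proof (induction rule: rtranclp_induct)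
    case base
    show ?case using e g0 ok by (intro exI[of _ "([c], (0, T, []))"]) (auto simp: exec_def)
  next
    case (step y z)
    then obtain x where x: "y = conf x" "?good x" "ok S (snd x)" "path S w x ([], (p', T', v))"
      by blast
    then obtain x' where x': "step w x = Some x'" "z = conf x'"
      using step tm[of x] by auto
    from x(4) obtain x'' where "step w x = Some x''" "ok S (snd x'')" "path S w x'' ([], (p', T', v))"
      unfolding path_def using x'(1) by (cases rule: converse_rtranclpE) auto
    then show ?case using x' good_step[OF x(2) x'(1)] by (intro exI[of _ x']) auto
  qed
  show "tm_space_le M w s" if s: "real S \<le> s"
    unfolding tm_space_le_def tm_reachable_def init
  proof (intro allI impI)
    fix d assume "?R\<^sup>*\<^sup>* (conf ([c], (0, T, []))) d"
    then obtain x where x: "d = conf x" "ok S (snd x)" using all by blast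
    obtain cs q T v where c: "x = (cs, q, T, v)" by (metis prod_cases4)
    have "snd y < S" if "y \<in> set (cf_work d)" for y
      using that x by (auto simp: c ok_def)
    then show "\<forall>(f, p)\<in>set (cf_work d). real (p + 1) \<le> s" using s by fastforce
  qed
qed

end

lemma bij_betw_transpose_lessThan: "a < N \<Longrightarrow> bij_betw (Transposition.transpose a 0) {..<N} {..<N::nat}"
  by (intro bij_betw_byWitness[where f' = "Transposition.transpose a 0"])
    (auto simp: Transposition.transpose_def)

lemma compiled_exists:
  assumes "uses K c" "0 < K"
  shows "\<exists>h. compiled c K h"
proof -
  let ?Q = "insert [] (stacks c [])"
  have fin: "finite ?Q" by (simp add: finite_stacks)
  then obtain g where g: "bij_betw g ?Q {..<card ?Q}"
    using ex_bij_betw_finite_nat[OF fin] by (auto simp: atLeast0LessThan)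
  have mem: "[c] \<in> ?Q" using head_in_stacks[of c "[]"] by simp
  have lt: "g [c] < card ?Q" using bij_betwE[OF g] mem by simp
  \<comment> \<open>The transposition gives the initial stack the number 0, which is the initial
    state.\<close>
  let ?h = "Transposition.transpose (g [c]) 0 \<circ> g"
  have "bij_betw (Transposition.transpose (g [c]) 0) {..<card ?Q} {..<card ?Q}"
    using lt by (rule bij_betw_transpose_lessThan)
  then have "bij_betw ?h ?Q {..<card ?Q}" using bij_betw_trans[OF g] by blast
  moreover have "?h [c] = 0" by (simp add: Transposition.transpose_def)
  ultimately show ?thesis using assms by (intro exI[of _ ?h]) (simp add: compiled_def)
qed

section \<open>Rules for the execution of commands\<close>

lemma exec_ok: "exec S w c \<sigma> \<sigma>' \<Longrightarrow> ok S \<sigma>" "exec S w c \<sigma> \<sigma>' \<Longrightarrow> ok S \<sigma>'"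
  by (simp_all add: exec_def)

lemma path_step:
  "step w x = Some y \<Longrightarrow> ok S (snd x) \<Longrightarrow> ok S (snd y) \<Longrightarrow> path S w y z \<Longrightarrow> path S w x z"
  unfolding path_def by (rule converse_rtranclp_into_rtranclp) auto

lemma path_trans: "path S w x y \<Longrightarrow> path S w y z \<Longrightarrow> path S w x z"
  unfolding path_def by (rule rtranclp_trans)

lemma path_refl: "path S w x x"
  unfolding path_def by simp

lemma exec_basic:
  "(\<And>cs. step w (c # cs, \<sigma>) = Some (cs, \<sigma>')) \<Longrightarrow> ok S \<sigma> \<Longrightarrow> ok S \<sigma>' \<Longrightarrow> exec S w c \<sigma> \<sigma>'"
  unfolding exec_def by (auto intro: path_step path_refl)

lemma exec_Seq:
  assumes "exec S w a \<sigma> \<sigma>1" "exec S w b \<sigma>1 \<sigma>2"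
  shows "exec S w (a ;; b) \<sigma> \<sigma>2"
  unfolding exec_def
proof (intro conjI allI)
  fix cs
  have "path S w (a # b # cs, \<sigma>) (cs, \<sigma>2)"
    using assms by (auto simp: exec_def intro: path_trans)
  then show "path S w ((a ;; b) # cs, \<sigma>) (cs, \<sigma>2)"
    by (rule path_step[rotated 3]) (use exec_ok[OF assms(1)] in auto)
qed (use assms exec_ok in blast)+

lemma exec_Cond:
  assumes "exec S w (if t (read_input w p) (fst (T r) (snd (T r))) then a else b) (p, T, v) \<sigma>'"
  shows "exec S w (Cond r t a b) (p, T, v) \<sigma>'"
  unfolding exec_def
proof (intro conjI allI)
  fix cs
  show "path S w (Cond r t a b # cs, (p, T, v)) (cs, \<sigma>')"
    by (rule path_step[where y = "((if t (read_input w p) (fst (T r) (snd (T r))) then a else b) # cs, (p, T, v))"])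
      (use assms in \<open>auto simp: exec_def\<close>)
qed (use assms exec_ok in blast)+

lemma exec_While_stop:
  "\<not> t (read_input w p) (fst (T r) (snd (T r))) \<Longrightarrow> ok S (p, T, v)
    \<Longrightarrow> exec S w (While r t a) (p, T, v) (p, T, v)"
  by (intro exec_basic) auto

lemma exec_While_step:
  assumes "t (read_input w p) (fst (T r) (snd (T r)))" "exec S w a (p, T, v) \<sigma>1"
    "exec S w (While r t a) \<sigma>1 \<sigma>2"
  shows "exec S w (While r t a) (p, T, v) \<sigma>2"
  unfolding exec_def
proof (intro conjI allI)
  fix cs
  have "path S w (a # While r t a # cs, (p, T, v)) (cs, \<sigma>2)"
    using assms(2,3) by (auto simp: exec_def intro: path_trans)
  then show "path S w (While r t a # cs, (p, T, v)) (cs, \<sigma>2)"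
    by (rule path_step[rotated 3]) (use assms(1) exec_ok[OF assms(2)] in auto)
qed (use assms exec_ok in blast)+

lemma exec_Seq_inv:
  assumes "exec S w (a ;; b) \<sigma> \<sigma>'"
  shows "path S w (a # b # cs, \<sigma>) (cs, \<sigma>')"
proof -
  have "path S w ((a ;; b) # cs, \<sigma>) (cs, \<sigma>')" using assms by (simp add: exec_def)
  then show ?thesis
    unfolding path_def by (cases rule: converse_rtranclpE) auto
qed

text \<open>Peels one round off a loop together with its tail. The counter routines have this shape,
  and the induction hypotheses about them cover loop and tail at once.\<close>

lemma exec_While_Seq:
  assumes "t (read_input w p) (fst (T r) (snd (T r)))" "exec S w a (p, T, v) \<sigma>1"
    "exec S w (While r t a ;; b) \<sigma>1 \<sigma>2"
  shows "exec S w (While r t a ;; b) (p, T, v) \<sigma>2"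
  unfolding exec_def
proof (intro conjI allI)
  fix cs
  have "path S w (a # While r t a # b # cs, (p, T, v)) (cs, \<sigma>2)"
    using assms(2) exec_Seq_inv[OF assms(3)] by (auto simp: exec_def intro: path_trans)
  then have "path S w (While r t a # b # cs, (p, T, v)) (cs, \<sigma>2)"
    by (rule path_step[rotated 3]) (use assms(1) exec_ok[OF assms(2)] in auto)
  then show "path S w ((While r t a ;; b) # cs, (p, T, v)) (cs, \<sigma>2)"
    by (rule path_step[rotated 3]) (use exec_ok[OF assms(2)] in auto)
qed (use assms exec_ok in blast)+

lemma ok_upd: "ok S (p, T, v) \<Longrightarrow> q < S \<Longrightarrow> ok S (p', T(r := (f, q)), v')"
  by (simp add: ok_def)

lemma ok_upd' [simp]: "ok S (p, T, v) \<Longrightarrow> q < S \<Longrightarrow> ok S (p, T(r := (f, q)), v)"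
  by (rule ok_upd)

text \<open>For memories in which tape \<open>r\<close> is displayed as an update the test
  simplifies to one on \<open>f q\<close>.\<close>

lemmas exec_While_stop_upd = exec_While_stop[where T = "T(r := (f, q))" and r = r for T r f q, simplified]
lemmas exec_While_step_upd = exec_While_step[where T = "T(r := (f, q))" and r = r for T r f q, simplified]
lemmas exec_While_Seq_upd = exec_While_Seq[where T = "T(r := (f, q))" and r = r for T r f q, simplified]
lemmas exec_Cond_upd = exec_Cond[where T = "T(r := (f, q))" and r = r for T r f q, simplified]

lemma exec_Write:
  "ok S (p, T, v) \<Longrightarrow> q < S \<Longrightarrow>
    exec S w (Write r b) (p, T(r := (f, q)), v) (p, T(r := (f(q := b), q)), v)"
  by (rule exec_basic) auto

lemma exec_Move:
  "ok S (p, T, v) \<Longrightarrow> q < S \<Longrightarrow> move_head m q < S \<Longrightarrow>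
    exec S w (Move r m) (p, T(r := (f, q)), v) (p, T(r := (f, move_head m q)), v)"
  by (rule exec_basic) auto

lemma exec_Emit: "ok S (p, T, v) \<Longrightarrow> exec S w (Emit a) (p, T, v) (p, T, v @ [a])"
  by (rule exec_basic) (auto simp: ok_def)

lemma exec_Input_Right:
  "ok S (p, T, v) \<Longrightarrow> exec S w Input_Right (p, T, v) (min (length w + 1) (p + 1), T, v)"
  by (rule exec_basic) (auto simp: ok_def)

subsection \<open>Binary counters\<close>

text \<open>Cell 0 of every work tape holds the end marker 3; the symbols 1 and 2 stand for the bits 0
  and 1. Between commands the head rests on cell 1, so a counter is zero iff it reads a blank.\<close>

definition bits_tape :: "bool list \<Rightarrow> nat \<Rightarrow> nat" where
  "bits_tape bs i = (case i of 0 \<Rightarrow> 3 | Suc j \<Rightarrow> if j < length bs then if bs ! j then 2 else 1 else 0)"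

lemma bits_tape_head [simp]: "bits_tape (bs @ b # cs) (Suc (length bs)) = (if b then 2 else 1)"
  by (simp add: bits_tape_def)

lemma bits_tape_end [simp]: "bits_tape bs (Suc (length bs)) = 0"
  by (simp add: bits_tape_def)

lemma bits_tape_marker [simp]: "bits_tape bs 0 = 3"
  by (simp add: bits_tape_def)

lemma bits_tape_not_marker: "bits_tape bs (Suc i) \<noteq> 3"
  by (simp add: bits_tape_def)

lemma bits_tape_update:
  "(bits_tape (bs @ b # cs))(Suc (length bs) := Suc 0) = bits_tape (bs @ False # cs)"
  "(bits_tape (bs @ b # cs))(Suc (length bs) := 2) = bits_tape (bs @ True # cs)"
  "(bits_tape bs)(Suc (length bs) := 2) = bits_tape (bs @ [True])"
  "(bits_tape (bs @ [b]))(Suc (length bs) := 0) = bits_tape bs"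
  by (auto simp: bits_tape_def fun_eq_iff nth_append nth_Cons less_Suc_eq split: nat.split)

definition rewind :: "nat \<Rightarrow> com" where
  "rewind r = While r (\<lambda>_ b. b \<noteq> 3) (Move r Left) ;; Move r Right"

lemma exec_rewind:
  assumes "ok S (p, T, v)" "q < S" "1 < S"
  shows "exec S w (rewind r) (p, T(r := (bits_tape bs, q)), v) (p, T(r := (bits_tape bs, 1)), v)"
proof -
  have "exec S w (While r (\<lambda>_ b. b \<noteq> 3) (Move r Left)) (p, T(r := (bits_tape bs, q)), v)
      (p, T(r := (bits_tape bs, 0)), v)"
    using assms(2)
  proof (induction q)
    case 0
    then show ?case using assms(1) by (intro exec_While_stop_upd ok_upd') (auto simp del: fun_upd_apply)
  next
    case (Suc q)
    show ?case
      by (rule exec_While_step_upd[OF _ _ Suc.IH])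
        (use Suc.prems assms(1) exec_Move[OF assms(1), of "Suc q" Left w r "bits_tape bs"]
          bits_tape_not_marker in \<open>auto simp del: fun_upd_apply\<close>)
  qed
  moreover have "exec S w (Move r Right) (p, T(r := (bits_tape bs, 0)), v) (p, T(r := (bits_tape bs, 1)), v)"
    using exec_Move[OF assms(1), of 0 Right] assms(3) by simp
  ultimately show ?thesis unfolding rewind_def by (rule exec_Seq)
qed

definition inc :: "nat \<Rightarrow> com" where
  "inc r = While r (\<lambda>_ b. b = 2) (Write r 1 ;; Move r Right) ;; Write r 2 ;; rewind r"

definition dec :: "nat \<Rightarrow> com" where
  "dec r = While r (\<lambda>_ b. b = 1) (Write r 2 ;; Move r Right) ;; Move r Right ;;
     Cond r (\<lambda>_ b. b = 0) (Move r Left ;; Write r 0) (Move r Left ;; Write r 1) ;; rewind r"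

definition show_counter :: "nat \<Rightarrow> com" where
  "show_counter r = While r (\<lambda>_ b. b \<noteq> 0)
     (Cond r (\<lambda>_ b. b = 2) (Emit (Bit True)) (Emit (Bit False)) ;; Move r Right) ;; Emit Sep ;; rewind r"

lemma nat_bits_0 [simp]: "nat_bits 0 = []"
  by (subst nat_bits.simps) simp

lemma nat_bits_pos: "0 < n \<Longrightarrow> nat_bits n = odd n # nat_bits (n div 2)"
  by (subst nat_bits.simps) simp

lemma nat_bits_eq_Nil_iff [simp]: "nat_bits n = [] \<longleftrightarrow> n = 0"
  using nat_bits_pos[of n] by (cases "n = 0") (auto simp del: fun_upd_apply)

lemma length_nat_bits_mono: "m \<le> n \<Longrightarrow> length (nat_bits m) \<le> length (nat_bits n)"
proof (induction m arbitrary: n rule: less_induct)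
  case (less m)
  show ?case
  proof (cases "m = 0")
    case False
    then have "length (nat_bits (m div 2)) \<le> length (nat_bits (n div 2))"
      using less by (intro less.IH div_le_mono) (auto simp del: fun_upd_apply)
    then show ?thesis using False less.prems by (simp add: nat_bits_pos)
  qed simp
qed

text \<open>\<open>bs\<close> consists of the low-order bits that the loop has already rewritten,
  and the head stands behind them. Each round moves one bit into \<open>bs\<close>, which is the
  induction step from \<open>n\<close> to \<open>n div 2\<close>.\<close>

lemma exec_inc_aux:
  assumes "ok S (p, T, v)" "length bs + length (nat_bits n) + 2 < S"
  shows "exec S w (inc r) (p, T(r := (bits_tape (bs @ nat_bits n), Suc (length bs))), v)
           (p, T(r := (bits_tape (bs @ nat_bits (Suc n)), 1)), v)"
  using assms(2)
proof (induction n arbitrary: bs rule: less_induct)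
  case (less n)
  let ?W = "While r (\<lambda>_ b. b = 2) (Write r 1 ;; Move r Right)"
  show ?case
  proof (cases "odd n")
    case False
    have "(bits_tape (bs @ nat_bits n))(Suc (length bs) := 2) = bits_tape (bs @ nat_bits (Suc n))"
      using False by (cases "n = 0") (simp_all add: bits_tape_update nat_bits_pos)
    moreover have "exec S w ?W (p, T(r := (bits_tape (bs @ nat_bits n), Suc (length bs))), v)
        (p, T(r := (bits_tape (bs @ nat_bits n), Suc (length bs))), v)"
      by (intro exec_While_stop_upd ok_upd')
        (use False less.prems assms(1) in \<open>auto simp del: fun_upd_apply simp: nat_bits_pos bits_tape_def nth_append\<close>)
    ultimately show ?thesis
      unfolding inc_def
      using exec_Write[OF assms(1), of "Suc (length bs)" w r 2 "bits_tape (bs @ nat_bits n)"]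
        exec_rewind[OF assms(1), of "Suc (length bs)" w r "bs @ nat_bits (Suc n)"] less.prems
      by (intro exec_Seq) (auto simp del: fun_upd_apply)
  next
    case True
    then have n: "0 < n" by presburger
    have s: "nat_bits (Suc n) = False # nat_bits (Suc (n div 2))"
      using True nat_bits_pos[of "Suc n"] by simp
    let ?bs = "bs @ [False]"
    have "exec S w (Write r 1 ;; Move r Right) (p, T(r := (bits_tape (bs @ nat_bits n), Suc (length bs))), v)
       (p, T(r := (bits_tape (?bs @ nat_bits (n div 2)), Suc (length ?bs))), v)"
      using exec_Write[OF assms(1), of "Suc (length bs)" w r 1 "bits_tape (bs @ nat_bits n)"]
        exec_Move[OF assms(1), of "Suc (length bs)" Right w r "bits_tape (?bs @ nat_bits (n div 2))"]
        less.prems n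
      by (intro exec_Seq) (auto simp del: fun_upd_apply simp: nat_bits_pos bits_tape_update)
    moreover have "exec S w (inc r) (p, T(r := (bits_tape (?bs @ nat_bits (n div 2)), Suc (length ?bs))), v)
       (p, T(r := (bits_tape (?bs @ nat_bits (Suc (n div 2))), 1)), v)"
      by (rule less.IH) (use n less.prems in \<open>auto simp del: fun_upd_apply simp: nat_bits_pos\<close>)
    ultimately show ?thesis
      using n True s unfolding inc_def
      by (intro exec_While_Seq_upd) (auto simp del: fun_upd_apply simp: nat_bits_pos)
  qed
qed

lemma exec_dec_aux:
  assumes "ok S (p, T, v)" "length bs + length (nat_bits n) + 2 < S" "0 < n"
  shows "exec S w (dec r) (p, T(r := (bits_tape (bs @ nat_bits n), Suc (length bs))), v)
           (p, T(r := (bits_tape (bs @ nat_bits (n - 1)), 1)), v)"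
  using assms(2,3)
proof (induction n arbitrary: bs rule: less_induct)
  case (less n)
  let ?f = "bits_tape (bs @ nat_bits n)"
  let ?q = "Suc (length bs)"
  note n = nat_bits_pos[OF less.prems(2)]
  show ?case
  proof (cases "odd n")
    case True
    have 1: "exec S w (While r (\<lambda>_ b. b = 1) (Write r 2 ;; Move r Right)) (p, T(r := (?f, ?q)), v) (p, T(r := (?f, ?q)), v)"
      by (intro exec_While_stop_upd ok_upd') (use True less.prems assms(1) n in \<open>auto simp del: fun_upd_apply\<close>)
    have 2: "exec S w (Move r Right) (p, T(r := (?f, ?q)), v) (p, T(r := (?f, Suc ?q)), v)"
      using exec_Move[OF assms(1), of ?q Right w r ?f] less.prems by simp
    have 3: "exec S w (Move r Left) (p, T(r := (?f, Suc ?q)), v) (p, T(r := (?f, ?q)), v)"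
      using exec_Move[OF assms(1), of "Suc ?q" Left w r ?f] less.prems by simp
    let ?g = "bits_tape (bs @ nat_bits (n - 1))"
    have 4: "exec S w (Write r (if n = 1 then 0 else 1)) (p, T(r := (?f, ?q)), v) (p, T(r := (?g, ?q)), v)"
    proof (cases "n = 1")
      case True
      then show ?thesis
        using exec_Write[OF assms(1), of ?q w r 0 ?f] less.prems n by (simp add: bits_tape_update del: fun_upd_apply)
    next
      case False
      have h: "(n - 1) div 2 = n div 2" using \<open>odd n\<close> by presburger
      have "nat_bits (n - 1) = False # nat_bits (n div 2)"
        using nat_bits_pos[of "n - 1"] h \<open>odd n\<close> False less.prems by simp
      then show ?thesis
        using exec_Write[OF assms(1), of ?q w r 1 ?f] less.prems n \<open>odd n\<close> False
        by (simp add: bits_tape_update del: fun_upd_apply)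
    qed
    \<comment> \<open>The cell behind the lowest bit is blank iff \<open>n div 2\<close> has no
      bits, which for odd \<open>n\<close> means \<open>n = 1\<close>.\<close>
    have sym: "?f (Suc ?q) = 0 \<longleftrightarrow> n = 1"
    proof -
      have "?f (Suc ?q) = 0 \<longleftrightarrow> nat_bits (n div 2) = []"
        by (cases "nat_bits (n div 2)") (auto simp: n bits_tape_def nth_append)
      then show ?thesis using True by (auto elim: oddE)
    qed
    have 5: "exec S w (Cond r (\<lambda>_ b. b = 0) (Move r Left ;; Write r 0) (Move r Left ;; Write r 1))
        (p, T(r := (?f, Suc ?q)), v) (p, T(r := (?g, ?q)), v)"
      using exec_Seq[OF 3 4] sym by (intro exec_Cond_upd) (auto simp del: fun_upd_apply split: if_splits)
    have 6: "exec S w (rewind r) (p, T(r := (?g, ?q)), v) (p, T(r := (?g, 1)), v)"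
      using exec_rewind[OF assms(1)] less.prems by simp
    show ?thesis
      unfolding dec_def by (intro exec_Seq[OF 1] exec_Seq[OF 2] exec_Seq[OF 5] 6)
  next
    case False
    let ?bs = "bs @ [True]"
    have pos: "0 < n div 2" "n div 2 < n" "(n - 1) div 2 = n div 2 - 1" "odd (n - 1)"
      using False less.prems by presburger+
    have s: "nat_bits (n - 1) = True # nat_bits (n div 2 - 1)"
      using nat_bits_pos[of "n - 1"] pos by (cases "n = 1") (auto simp del: fun_upd_apply)
    have "exec S w (Write r 2 ;; Move r Right) (p, T(r := (?f, ?q)), v)
       (p, T(r := (bits_tape (?bs @ nat_bits (n div 2)), Suc (length ?bs))), v)"
      using exec_Write[OF assms(1), of ?q w r 2 ?f]
        exec_Move[OF assms(1), of ?q Right w r "bits_tape (?bs @ nat_bits (n div 2))"]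
        less.prems
      by (intro exec_Seq) (auto simp del: fun_upd_apply simp: n bits_tape_update)
    moreover have "exec S w (dec r) (p, T(r := (bits_tape (?bs @ nat_bits (n div 2)), Suc (length ?bs))), v)
       (p, T(r := (bits_tape (?bs @ nat_bits (n div 2 - 1)), 1)), v)"
      by (rule less.IH) (use pos less.prems n in \<open>auto simp del: fun_upd_apply\<close>)
    ultimately show ?thesis
      using n False s unfolding dec_def
      by (intro exec_While_Seq_upd) (auto simp del: fun_upd_apply)
  qed
qed

lemma exec_show_counter_aux:
  assumes "ok S (p, T, v)" "length bs + length (nat_bits n) + 2 < S"
  shows "exec S w (show_counter r) (p, T(r := (bits_tape (bs @ nat_bits n), Suc (length bs))), v)
           (p, T(r := (bits_tape (bs @ nat_bits n), 1)), v @ map Bit (nat_bits n) @ [Sep])"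
  using assms
proof (induction n arbitrary: bs v rule: less_induct)
  case (less n)
  let ?f = "bits_tape (bs @ nat_bits n)"
  let ?q = "Suc (length bs)"
  have ok: "ok S (p, T, v')" for v' using less.prems(1) by (simp add: ok_def)
  have ok': "ok S (p, T(r := (?f, ?q)), v')" for v' using ok less.prems(2) by simp
  show ?case
  proof (cases "n = 0")
    case True
    show ?thesis
      unfolding show_counter_def
      using exec_Emit[OF ok', of w Sep v]
        exec_rewind[OF ok, of ?q w r "bs @ nat_bits n" "v @ [Sep]"] less.prems True
      by (intro exec_Seq[OF exec_While_stop_upd] exec_Seq) (auto simp del: fun_upd_apply simp: ok')
  next
    case False
    then have n: "nat_bits n = odd n # nat_bits (n div 2)" by (simp add: nat_bits_pos)
    let ?bs = "bs @ [odd n]"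
    have "exec S w (Cond r (\<lambda>_ b. b = 2) (Emit (Bit True)) (Emit (Bit False)))
        (p, T(r := (?f, ?q)), v) (p, T(r := (?f, ?q)), v @ [Bit (odd n)])"
      using exec_Emit[OF ok', of w "Bit (odd n)" v] n
      by (intro exec_Cond_upd) (cases "odd n"; simp del: fun_upd_apply)
    moreover have "exec S w (Move r Right) (p, T(r := (?f, ?q)), v @ [Bit (odd n)])
        (p, T(r := (?f, Suc ?q)), v @ [Bit (odd n)])"
      using exec_Move[OF ok, of ?q Right w r ?f] less.prems n by simp
    ultimately have "exec S w (Cond r (\<lambda>_ b. b = 2) (Emit (Bit True)) (Emit (Bit False)) ;; Move r Right)
        (p, T(r := (?f, ?q)), v) (p, T(r := (?f, Suc ?q)), v @ [Bit (odd n)])"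
      by (rule exec_Seq)
    moreover have "exec S w (show_counter r) (p, T(r := (bits_tape (?bs @ nat_bits (n div 2)), Suc (length ?bs))), v @ [Bit (odd n)])
        (p, T(r := (bits_tape (?bs @ nat_bits (n div 2)), 1)), (v @ [Bit (odd n)]) @ map Bit (nat_bits (n div 2)) @ [Sep])"
      by (rule less.IH) (use False less.prems n ok in \<open>auto simp del: fun_upd_apply\<close>)
    ultimately show ?thesis
      unfolding show_counter_def using n by (intro exec_While_Seq_upd) (auto simp del: fun_upd_apply)
  qed
qed

section \<open>Counters as registers with natural values\<close>

definition counters :: "(nat \<Rightarrow> nat) \<Rightarrow> nat \<Rightarrow> (nat \<Rightarrow> nat) \<times> nat" where
  "counters \<rho> = (\<lambda>r. (bits_tape (nat_bits (\<rho> r)), 1))"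

text \<open>The bound on \<open>S\<close> makes room for the end marker, the bits of a counter of value at most \<open>Y\<close> and
  the blank after them.\<close>

definition does :: "nat \<Rightarrow> com \<Rightarrow> (nat \<Rightarrow> nat) \<Rightarrow> (nat \<Rightarrow> nat) \<Rightarrow> token list \<Rightarrow> bool" where
  "does Y c \<rho> \<rho>' v \<longleftrightarrow> (\<forall>S w p out. length (nat_bits Y) + 3 \<le> S \<longrightarrow>
     exec S w c (p, counters \<rho>, out) (p, counters \<rho>', out @ v))"

lemma counters_upd: "counters (\<rho>(r := n)) = (counters \<rho>)(r := (bits_tape (nat_bits n), Suc 0))"
  by (auto simp: counters_def)

lemma counters_triv: "(counters \<rho>)(r := (bits_tape (nat_bits (\<rho> r)), Suc 0)) = counters \<rho>"
  by (auto simp: counters_def)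

lemma ok_counters: "1 < S \<Longrightarrow> ok S (p, counters \<rho>, v)"
  by (simp add: ok_def counters_def)

lemma does_inc: "\<rho> r \<le> Y \<Longrightarrow> does Y (inc r) \<rho> (\<rho>(r := Suc (\<rho> r))) []"
  unfolding does_def
proof (intro allI impI)
  fix S w p out
  assume "\<rho> r \<le> Y" and S: "length (nat_bits Y) + 3 \<le> S"
  then have "length (nat_bits (\<rho> r)) + 2 < S" using length_nat_bits_mono[of "\<rho> r" Y] by simp
  then show "exec S w (inc r) (p, counters \<rho>, out) (p, counters (\<rho>(r := Suc (\<rho> r))), out @ [])"
    using exec_inc_aux[of S p "counters \<rho>" out "[]" "\<rho> r" w r]
    by (simp add: ok_counters counters_upd counters_triv del: fun_upd_apply)
qed

lemma does_dec: "\<rho> r \<le> Y \<Longrightarrow> 0 < \<rho> r \<Longrightarrow> does Y (dec r) \<rho> (\<rho>(r := \<rho> r - 1)) []"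
  unfolding does_def
proof (intro allI impI)
  fix S w p out
  assume "\<rho> r \<le> Y" "0 < \<rho> r" and S: "length (nat_bits Y) + 3 \<le> S"
  then have "length (nat_bits (\<rho> r)) + 2 < S" using length_nat_bits_mono[of "\<rho> r" Y] by simp
  then show "exec S w (dec r) (p, counters \<rho>, out) (p, counters (\<rho>(r := \<rho> r - 1)), out @ [])"
    using exec_dec_aux[of S p "counters \<rho>" out "[]" "\<rho> r" w r] \<open>0 < \<rho> r\<close>
    by (simp add: ok_counters counters_upd counters_triv del: fun_upd_apply)
qed

lemma does_show_counter: "\<rho> r \<le> Y \<Longrightarrow> does Y (show_counter r) \<rho> \<rho> (encode_nats [\<rho> r])"
  unfolding does_def
proof (intro allI impI)
  fix S w p out
  assume "\<rho> r \<le> Y" and S: "length (nat_bits Y) + 3 \<le> S"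
  then have "length (nat_bits (\<rho> r)) + 2 < S" using length_nat_bits_mono[of "\<rho> r" Y] by simp
  then show "exec S w (show_counter r) (p, counters \<rho>, out) (p, counters \<rho>, out @ encode_nats [\<rho> r])"
    using exec_show_counter_aux[of S p "counters \<rho>" out "[]" "\<rho> r" w r]
    by (simp add: ok_counters counters_upd counters_triv encode_nats_def del: fun_upd_apply)
qed

lemma does_Emit: "does Y (Emit a) \<rho> \<rho> [a]"
  unfolding does_def by (intro allI impI exec_Emit ok_counters) simp

lemma does_Seq: "does Y a \<rho> \<rho>1 u \<Longrightarrow> does Y b \<rho>1 \<rho>2 v \<Longrightarrow> does Y (a ;; b) \<rho> \<rho>2 (u @ v)"
  unfolding does_def
proof (intro allI impI)
  fix S w p out
  assume "\<forall>S w p out. length (nat_bits Y) + 3 \<le> S \<longrightarrow> exec S w a (p, counters \<rho>, out) (p, counters \<rho>1, out @ u)"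
    "\<forall>S w p out. length (nat_bits Y) + 3 \<le> S \<longrightarrow> exec S w b (p, counters \<rho>1, out) (p, counters \<rho>2, out @ v)"
    "length (nat_bits Y) + 3 \<le> S"
  then have "exec S w a (p, counters \<rho>, out) (p, counters \<rho>1, out @ u)"
    "exec S w b (p, counters \<rho>1, out @ u) (p, counters \<rho>2, (out @ u) @ v)" by blast+
  then show "exec S w (a ;; b) (p, counters \<rho>, out) (p, counters \<rho>2, out @ u @ v)"
    unfolding append_assoc by (rule exec_Seq)
qed

definition while_pos :: "nat \<Rightarrow> com \<Rightarrow> com" where
  "while_pos r c = While r (\<lambda>_ b. b \<noteq> 0) c"

definition cond_zero :: "nat \<Rightarrow> com \<Rightarrow> com \<Rightarrow> com" where
  "cond_zero r a b = Cond r (\<lambda>_ b. b = 0) a b"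

lemma counter_zero_iff: "fst (counters \<rho> r) (snd (counters \<rho> r)) = 0 \<longleftrightarrow> \<rho> r = 0"
  using nat_bits_pos[of "\<rho> r"] by (cases "\<rho> r = 0") (auto simp: counters_def bits_tape_def)

lemma does_cond_zero: "does Y (if \<rho> r = 0 then a else b) \<rho> \<rho>' v \<Longrightarrow> does Y (cond_zero r a b) \<rho> \<rho>' v"
  unfolding does_def cond_zero_def
  by (intro allI impI exec_Cond) (simp add: counter_zero_iff split: if_splits)

lemma does_while_pos:
  assumes "\<And>i. i < N \<Longrightarrow> does Y c (\<sigma> i) (\<sigma> (Suc i)) (v i)" "\<And>i. i < N \<Longrightarrow> 0 < \<sigma> i r" "\<sigma> N r = 0"
  shows "does Y (while_pos r c) (\<sigma> 0) (\<sigma> N) (concat (map v [0..<N]))"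
  unfolding does_def while_pos_def
proof (intro allI impI)
  fix S w p out
  assume S: "length (nat_bits Y) + 3 \<le> S"
  have "exec S w (While r (\<lambda>_ b. b \<noteq> 0) c) (p, counters (\<sigma> i), out) (p, counters (\<sigma> N), out @ concat (map v [i..<N]))"
    if "i \<le> N" for i out
    using that
  proof (induction arbitrary: out rule: inc_induct)
    case base
    show ?case using exec_While_stop[of "\<lambda>_ b. b \<noteq> 0"] assms(3) S by (simp add: counter_zero_iff ok_counters)
  next
    case (step i)
    have "exec S w c (p, counters (\<sigma> i), out) (p, counters (\<sigma> (Suc i)), out @ v i)"
      using assms(1)[OF step.hyps(2)] S by (simp add: does_def)
    moreover have "exec S w (While r (\<lambda>_ b. b \<noteq> 0) c) (p, counters (\<sigma> (Suc i)), out @ v i)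
        (p, counters (\<sigma> N), out @ concat (map v [i..<N]))"
      using step.IH[of "out @ v i"] step.hyps by (simp only: upt_conv_Cons list.map concat.simps append_assoc)
    ultimately show ?case
      using assms(2)[OF step.hyps(2)]
      by (intro exec_While_step[where a = c]) (auto simp: counter_zero_iff)
  qed
  from this[of 0] show "exec S w (While r (\<lambda>_ b. b \<noteq> 0) c) (p, counters (\<sigma> 0), out)
      (p, counters (\<sigma> N), out @ concat (map v [0..<N]))" by simp
qed

lemma does_loop:
  assumes "\<And>i. i < N \<Longrightarrow> does Y c (\<sigma> i) (\<sigma> (Suc i)) (v i)" "\<And>i. i < N \<Longrightarrow> 0 < \<sigma> i r" "\<sigma> N r = 0"
    "\<rho> = \<sigma> 0" "\<rho>' = \<sigma> N" "out = concat (map v [0..<N])"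
  shows "does Y (while_pos r c) \<rho> \<rho>' out"
  unfolding assms(4-6) by (rule does_while_pos) (use assms in auto)

lemma does_Seq': "does Y a \<rho> \<rho>1 u \<Longrightarrow> does Y b \<rho>1 \<rho>2 v \<Longrightarrow> t = u @ v \<Longrightarrow> does Y (a ;; b) \<rho> \<rho>2 t"
  by (simp add: does_Seq)

lemma does_inc': "\<rho> r \<le> Y \<Longrightarrow> \<rho>' = \<rho>(r := Suc (\<rho> r)) \<Longrightarrow> does Y (inc r) \<rho> \<rho>' []"
  by (simp add: does_inc)

lemma does_dec': "\<rho> r \<le> Y \<Longrightarrow> 0 < \<rho> r \<Longrightarrow> \<rho>' = \<rho>(r := \<rho> r - 1) \<Longrightarrow> does Y (dec r) \<rho> \<rho>' []"
  using does_dec by blast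

definition clear :: "nat \<Rightarrow> com" where
  "clear r = while_pos r (dec r)"

lemma does_clear: "\<rho> r \<le> Y \<Longrightarrow> does Y (clear r) \<rho> (\<rho>(r := 0)) []"
  unfolding clear_def
  by (rule does_loop[where N = "\<rho> r" and \<sigma> = "\<lambda>i. \<rho>(r := \<rho> r - i)" and v = "\<lambda>_. []"])
    (auto intro!: does_dec' simp: fun_eq_iff)

definition transfer :: "nat \<Rightarrow> nat \<Rightarrow> com" where
  "transfer r d = while_pos r (inc d ;; dec r)"

lemma does_transfer:
  "r \<noteq> d \<Longrightarrow> \<rho> r + \<rho> d \<le> Y \<Longrightarrow> does Y (transfer r d) \<rho> (\<rho>(d := \<rho> d + \<rho> r, r := 0)) []"
  unfolding transfer_def
  by (rule does_loop[where N = "\<rho> r" and \<sigma> = "\<lambda>i. \<rho>(d := \<rho> d + i, r := \<rho> r - i)" and v = "\<lambda>_. []"])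
    (auto intro!: does_Seq'[OF does_inc does_dec'] simp: fun_eq_iff)

text \<open>A loop over a counter consumes it, so a second copy is made in \<open>tmp\<close> and
  moved back.\<close>

definition copy :: "nat \<Rightarrow> nat \<Rightarrow> nat \<Rightarrow> com" where
  "copy r d tmp = while_pos r (inc d ;; inc tmp ;; dec r) ;; transfer tmp r"

lemma does_copy:
  assumes "r \<noteq> d" "r \<noteq> tmp" "d \<noteq> tmp" "\<rho> r + \<rho> d \<le> Y" "\<rho> tmp = 0"
  shows "does Y (copy r d tmp) \<rho> (\<rho>(d := \<rho> d + \<rho> r)) []"
  unfolding copy_def
proof (rule does_Seq')
  let ?\<rho> = "\<rho>(d := \<rho> d + \<rho> r, tmp := \<rho> r, r := 0)"
  show "does Y (while_pos r (inc d ;; inc tmp ;; dec r)) \<rho> ?\<rho> []"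
    by (rule does_loop[where N = "\<rho> r" and \<sigma> = "\<lambda>i. \<rho>(d := \<rho> d + i, tmp := i, r := \<rho> r - i)" and v = "\<lambda>_. []"])
      (use assms in \<open>auto intro!: does_Seq'[OF does_inc does_Seq'[OF does_inc does_dec']] simp: fun_eq_iff\<close>)
  have "\<rho>(d := \<rho> d + \<rho> r) = ?\<rho>(r := ?\<rho> r + ?\<rho> tmp, tmp := 0)"
    using assms by (auto simp: fun_eq_iff)
  then show "does Y (transfer tmp r) ?\<rho> (\<rho>(d := \<rho> d + \<rho> r)) []"
    using does_transfer[of tmp r ?\<rho> Y] assms by simp
qed simp

subsection \<open>Functions and outputs computable with polynomially bounded counters\<close>

text \<open>\<open>e\<close> lists the values of the variables in scope, the innermost first; \<open>rs\<close> are the registers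
  that hold them, registers from \<open>m\<close> on are zero and can be used as scratch space. The program adds
  \<open>f e\<close> to register \<open>d\<close> and outputs \<open>out e\<close>.\<close>

definition program_for ::
    "nat \<Rightarrow> (nat list \<Rightarrow> nat) \<Rightarrow> (nat list \<Rightarrow> token list) \<Rightarrow> nat list \<Rightarrow> nat \<Rightarrow> nat \<Rightarrow> com \<Rightarrow> bool" where
  "program_for c f out rs m d p \<longleftrightarrow> (\<forall>\<rho> Y. (\<forall>i. \<rho> i \<le> Y) \<longrightarrow> (\<forall>i\<ge>m. \<rho> i = 0) \<longrightarrow>
     (2 + sum_list (map \<rho> rs)) ^ c \<le> Y \<longrightarrow> \<rho> d + f (map \<rho> rs) \<le> Y \<longrightarrow>
     does Y p \<rho> (\<rho>(d := \<rho> d + f (map \<rho> rs))) (out (map \<rho> rs)))"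

text \<open>One exponent \<open>c\<close> bounds the value of \<open>f\<close> and the counter size
  granted to the program; composed programs pass to a common exponent by \<open>eff_by_mono\<close>.
  The destination lies outside \<open>rs\<close> because the program adds to it while it still reads
  its arguments.\<close>

definition eff_by :: "nat \<Rightarrow> nat \<Rightarrow> (nat list \<Rightarrow> nat) \<Rightarrow> (nat list \<Rightarrow> token list) \<Rightarrow> bool" where
  "eff_by c k f out \<longleftrightarrow> (\<forall>e. length e = k \<longrightarrow> f e \<le> (2 + sum_list e) ^ c) \<and>
     (\<forall>rs m d. length rs = k \<longrightarrow> (\<forall>r\<in>set rs. r < m) \<longrightarrow> d < m \<longrightarrow> d \<notin> set rs \<longrightarrow>
        (\<exists>p. program_for c f out rs m d p))"

definition eff :: "nat \<Rightarrow> (nat list \<Rightarrow> nat) \<Rightarrow> (nat list \<Rightarrow> token list) \<Rightarrow> bool" where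
  "eff k f out \<longleftrightarrow> (\<exists>c. eff_by c k f out)"

lemma pow_mono: "c \<le> c' \<Longrightarrow> (2 + x) ^ c \<le> (2 + x :: nat) ^ c'"
  by (rule power_increasing) auto

lemma program_for_mono: "program_for c f out rs m d p \<Longrightarrow> c \<le> c' \<Longrightarrow> program_for c' f out rs m d p"
  unfolding program_for_def by (intro allI impI) (use pow_mono le_trans in blast)

lemma eff_by_mono:
  assumes "eff_by c k f out" "c \<le> c'"
  shows "eff_by c' k f out"
  unfolding eff_by_def
proof (intro conjI allI impI)
  fix e :: "nat list" assume "length e = k"
  then show "f e \<le> (2 + sum_list e) ^ c'"
    using assms(1) pow_mono[OF assms(2), of "sum_list e"] unfolding eff_by_def by (blast intro: le_trans)
next
  fix rs :: "nat list" and m d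
  assume "length rs = k" "\<forall>r\<in>set rs. r < m" "d < m" "d \<notin> set rs"
  then obtain p where "program_for c f out rs m d p" using assms(1) unfolding eff_by_def by blast
  then show "\<exists>p. program_for c' f out rs m d p" using program_for_mono assms(2) by blast
qed

lemma eff_by_le: "eff_by c k f out \<Longrightarrow> length e = k \<Longrightarrow> f e \<le> (2 + sum_list e) ^ c"
  unfolding eff_by_def by blast

lemma eff_byE:
  assumes "eff_by c k f out" "length rs = k" "\<And>r. r \<in> set rs \<Longrightarrow> r < m" "d < m" "d \<notin> set rs"
  obtains p where "program_for c f out rs m d p"
  using assms unfolding eff_by_def by blast

lemma eff_byI:
  assumes "\<And>e. length e = k \<Longrightarrow> f e \<le> (2 + sum_list e) ^ c"
    "\<And>rs m d. length rs = k \<Longrightarrow> \<forall>r\<in>set rs. r < m \<Longrightarrow> d < m \<Longrightarrow> d \<notin> set rs \<Longrightarrow> \<exists>p. program_for c f out rs m d p"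
  shows "eff k f out"
  unfolding eff_def eff_by_def using assms by blast

lemma eff2E:
  assumes "eff k f u" "eff k' g v"
  obtains c where "eff_by c k f u" "eff_by c k' g v"
proof -
  obtain c c' where "eff_by c k f u" "eff_by c' k' g v" using assms unfolding eff_def by blast
  then show thesis using that[of "max c c'"] by (simp add: eff_by_mono)
qed

lemma eff_Emit: "eff k (\<lambda>_. 0) (\<lambda>_. [a])"
  by (rule eff_byI[where c = 0]) (auto simp: program_for_def intro!: exI[of _ "Emit a"] does_Emit)

lemma eff_0: "eff k (\<lambda>_. 0) (\<lambda>_. [])"
proof (rule eff_byI[where c = 0])
  fix rs :: "nat list" and m d
  show "\<exists>p. program_for 0 (\<lambda>_. 0) (\<lambda>_. []) rs m d p"
    unfolding program_for_def
  \<comment> \<open>The language has no empty command; clearing the scratch register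
    \<open>m\<close>, which is zero already, takes its place.\<close>
  proof (intro exI[of _ "clear m"] allI impI)
    fix \<rho> :: "nat \<Rightarrow> nat" and Y assume "\<forall>i. \<rho> i \<le> Y" "\<forall>i\<ge>m. \<rho> i = 0"
    then have "\<rho>(m := 0) = \<rho>(d := \<rho> d + 0)" "\<rho> m \<le> Y" by auto
    then show "does Y (clear m) \<rho> (\<rho>(d := \<rho> d + 0)) []"
      using does_clear[of \<rho> m Y] by metis
  qed
qed simp

lemma eff_1: "eff k (\<lambda>_. 1) (\<lambda>_. [])"
  by (rule eff_byI[where c = 0]) (auto simp: program_for_def intro!: exI[of _ "inc _"] does_inc')

lemma eff_nth:
  assumes "i < k"
  shows "eff k (\<lambda>e. e ! i) (\<lambda>_. [])"
proof (rule eff_byI[where c = 1])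
  fix e :: "nat list" assume "length e = k"
  then show "e ! i \<le> (2 + sum_list e) ^ 1" using elem_le_sum_list[of i e] assms by simp
next
  fix rs :: "nat list" and m d
  assume h: "length rs = k" "\<forall>r\<in>set rs. r < m" "d < m" "d \<notin> set rs"
  have r: "rs ! i \<in> set rs" using h assms by simp
  show "\<exists>p. program_for 1 (\<lambda>e. e ! i) (\<lambda>_. []) rs m d p"
    unfolding program_for_def
  proof (intro exI[of _ "copy (rs ! i) d m"] allI impI)
    fix \<rho> :: "nat \<Rightarrow> nat" and Y assume "\<forall>i\<ge>m. \<rho> i = 0" "\<rho> d + map \<rho> rs ! i \<le> Y"
    then have "does Y (copy (rs ! i) d m) \<rho> (\<rho>(d := \<rho> d + \<rho> (rs ! i))) []"
      using h r assms by (intro does_copy) auto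
    then show "does Y (copy (rs ! i) d m) \<rho> (\<rho>(d := \<rho> d + map \<rho> rs ! i)) []"
      using h assms by simp
  qed
qed

lemma map_upd_notin: "d \<notin> set rs \<Longrightarrow> map (\<rho>(d := x)) rs = map \<rho> rs"
  by simp

lemma eff_add:
  assumes "eff k f u" "eff k g v"
  shows "eff k (\<lambda>e. f e + g e) (\<lambda>e. u e @ v e)"
proof -
  obtain c where c: "eff_by c k f u" "eff_by c k g v" using assms by (rule eff2E)
  show ?thesis
  \<comment> \<open>\<open>2 * x ^ c <= x ^ Suc c\<close> holds for \<open>x >= 2\<close>; this is
    why the bounds have base \<open>2 + sum_list e\<close>.\<close>
  proof (rule eff_byI[where c = "Suc c"])
    fix e :: "nat list" assume "length e = k"
    then have "f e \<le> (2 + sum_list e) ^ c" "g e \<le> (2 + sum_list e) ^ c"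
      using c by (blast dest: eff_by_le)+
    then show "f e + g e \<le> (2 + sum_list e) ^ Suc c" by simp
  next
    fix rs :: "nat list" and m d
    assume h: "length rs = k" "\<forall>r\<in>set rs. r < m" "d < m" "d \<notin> set rs"
    obtain p where p: "program_for c f u rs m d p" by (rule eff_byE[OF c(1), of rs m d]) (use h in auto)
    obtain q where q: "program_for c g v rs m d q" by (rule eff_byE[OF c(2), of rs m d]) (use h in auto)
    show "\<exists>p. program_for (Suc c) (\<lambda>e. f e + g e) (\<lambda>e. u e @ v e) rs m d p"
      unfolding program_for_def
    proof (intro exI[of _ "p ;; q"] allI impI)
      fix \<rho> :: "nat \<Rightarrow> nat" and Y
      let ?e = "map \<rho> rs"
      assume a: "\<forall>i. \<rho> i \<le> Y" "\<forall>i\<ge>m. \<rho> i = 0" "(2 + sum_list ?e) ^ Suc c \<le> Y"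
        "\<rho> d + (f ?e + g ?e) \<le> Y"
      have Y: "(2 + sum_list ?e) ^ c \<le> Y" using a(3) pow_mono[of c "Suc c" "sum_list ?e"] by linarith
      have 1: "does Y p \<rho> (\<rho>(d := \<rho> d + f ?e)) (u ?e)"
        using p a Y by (simp add: program_for_def)
      have "does Y q (\<rho>(d := \<rho> d + f ?e)) ((\<rho>(d := \<rho> d + f ?e))(d := (\<rho>(d := \<rho> d + f ?e)) d + g (map (\<rho>(d := \<rho> d + f ?e)) rs)))
          (v (map (\<rho>(d := \<rho> d + f ?e)) rs))"
        using q[unfolded program_for_def, rule_format, of "\<rho>(d := \<rho> d + f ?e)" Y] a Y h
        by (simp add: map_upd_notin del: map_fun_upd)
      then have 2: "does Y q (\<rho>(d := \<rho> d + f ?e)) (\<rho>(d := \<rho> d + (f ?e + g ?e))) (v ?e)"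
        using h by (simp add: map_upd_notin add.assoc del: map_fun_upd)
      show "does Y (p ;; q) \<rho> (\<rho>(d := \<rho> d + (f ?e + g ?e))) (u ?e @ v ?e)"
        using 1 2 by (rule does_Seq)
    qed
  qed
qed

lemma program_into_scratch:
  assumes "program_for c f (\<lambda>_. []) rs (Suc m) m p" "\<forall>r\<in>set rs. r < m"
    "\<forall>i. \<rho> i \<le> Y" "\<forall>i\<ge>m. \<rho> i = 0" "(2 + sum_list (map \<rho> rs)) ^ c \<le> Y" "f (map \<rho> rs) \<le> Y"
  shows "does Y p \<rho> (\<rho>(m := f (map \<rho> rs))) []"
  using assms(1)[unfolded program_for_def, rule_format, of \<rho> Y] assms by simp

text \<open>The loop passes the round number \<open>a\<close> to its body as innermost variable.
  With \<open>x = 2 + sum_list e\<close>, a value \<open>a < x ^ c\<close> raises the base for the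
  body to at most \<open>x ^ Suc c\<close>, hence its value to at most
  \<open>x ^ (Suc c * c)\<close>; the number of rounds contributes another factor
  \<open>x ^ c\<close>.\<close>

lemma eff_loop:
  assumes "eff k f (\<lambda>_. [])" "eff (Suc k) g v"
  shows "eff k (\<lambda>e. \<Sum>a<f e. g (a # e)) (\<lambda>e. concat (map (\<lambda>a. v (a # e)) [0..<f e]))"
proof -
  obtain c where c: "eff_by c k f (\<lambda>_. [])" "eff_by c (Suc k) g v" using assms by (rule eff2E)
  have inner: "(2 + sum_list (a # e)) ^ c \<le> (2 + sum_list e) ^ (Suc c * c)"
    if "length e = k" "a < f e" for a e
  proof -
    have "f e \<le> (2 + sum_list e) ^ c" using c(1) that(1) by (rule eff_by_le)
    then have "2 + sum_list (a # e) \<le> (2 + sum_list e) + ((2 + sum_list e) ^ c - 1)" using that by simp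
    also have "\<dots> \<le> (2 + sum_list e) ^ Suc c"
    proof (cases c)
      case (Suc c')
      have "2 + sum_list e \<le> (2 + sum_list e) ^ c" by (rule self_le_power) (simp_all add: Suc)
      then have "2 + sum_list e + (2 + sum_list e) ^ c \<le> 2 * (2 + sum_list e) ^ c" by simp
      also have "\<dots> \<le> (2 + sum_list e) ^ Suc c" unfolding power_Suc by (intro mult_right_mono) auto
      finally show ?thesis by simp
    qed simp
    finally show ?thesis unfolding power_mult by (rule power_mono) simp
  qed
  have gb: "g (a # e) \<le> (2 + sum_list e) ^ (Suc c * c)" if "length e = k" "a < f e" for a e
  proof -
    have "g (a # e) \<le> (2 + sum_list (a # e)) ^ c" using c(2) by (rule eff_by_le) (simp add: that(1))
    then show ?thesis using inner[OF that] by linarith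
  qed
  show ?thesis
  proof (rule eff_byI[where c = "c + Suc c * c"])
    fix e :: "nat list" assume e: "length e = k"
    have "(\<Sum>a<f e. g (a # e)) \<le> (\<Sum>a<f e. (2 + sum_list e) ^ (Suc c * c))"
      by (intro sum_mono) (use gb[OF e] in simp)
    also have "\<dots> = f e * (2 + sum_list e) ^ (Suc c * c)" by simp
    also have "\<dots> \<le> (2 + sum_list e) ^ c * (2 + sum_list e) ^ (Suc c * c)"
      using eff_by_le[OF c(1) e] by (rule mult_right_mono) simp
    finally show "(\<Sum>a<f e. g (a # e)) \<le> (2 + sum_list e) ^ (c + Suc c * c)" by (simp only: power_add)
  next
    fix rs :: "nat list" and m d
    assume h: "length rs = k" "\<forall>r\<in>set rs. r < m" "d < m" "d \<notin> set rs"
    obtain p where p: "program_for c f (\<lambda>_. []) rs (Suc m) m p"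
      by (rule eff_byE[OF c(1), of rs "Suc m" m]) (use h in \<open>auto simp: less_Suc_eq\<close>)
    obtain q where q: "program_for c g v (Suc m # rs) (Suc (Suc m)) d q"
      by (rule eff_byE[OF c(2), of "Suc m # rs" "Suc (Suc m)" d]) (use h in \<open>auto simp: less_Suc_eq\<close>)
    \<comment> \<open>Register \<open>m\<close> counts the remaining rounds down, while
      \<open>Suc m\<close> holds the round number that the body reads.\<close>
    let ?p = "p ;; while_pos m (q ;; inc (Suc m) ;; dec m) ;; clear (Suc m)"
    show "\<exists>p. program_for (c + Suc c * c) (\<lambda>e. \<Sum>a<f e. g (a # e))
        (\<lambda>e. concat (map (\<lambda>a. v (a # e)) [0..<f e])) rs m d p"
      unfolding program_for_def
    proof (intro exI[of _ ?p] allI impI)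
      fix \<rho> :: "nat \<Rightarrow> nat" and Y
      let ?e = "map \<rho> rs"
      let ?G = "\<lambda>i. \<Sum>a<i. g (a # ?e)"
      let ?N = "f ?e"
      assume a: "\<forall>i. \<rho> i \<le> Y" "\<forall>i\<ge>m. \<rho> i = 0" "(2 + sum_list ?e) ^ (c + Suc c * c) \<le> Y"
        "\<rho> d + ?G ?N \<le> Y"
      have e: "length ?e = k" using h by simp
      have Yc: "(2 + sum_list ?e) ^ c \<le> Y" "(2 + sum_list ?e) ^ (Suc c * c) \<le> Y"
        using a(3) pow_mono[of c "c + Suc c * c" "sum_list ?e"]
          pow_mono[of "Suc c * c" "c + Suc c * c" "sum_list ?e"] by linarith+
      then have N: "?N \<le> Y" using eff_by_le[OF c(1) e] by linarith
      have G: "\<rho> d + ?G i \<le> Y" if "i \<le> ?N" for i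
      proof -
        have "?G i \<le> ?G ?N" using that by (intro sum_mono2) auto
        then show ?thesis using a(4) by linarith
      qed
      have 1: "does Y p \<rho> (\<rho>(m := ?N)) []"
        by (rule program_into_scratch[OF p]) (use h a Yc N in auto)
      let ?\<sigma> = "\<lambda>i. \<rho>(d := \<rho> d + ?G i, m := ?N - i, Suc m := i)"
      have rs: "map (?\<sigma> i) (Suc m # rs) = i # ?e" "?\<sigma> i d = \<rho> d + ?G i" for i
        using h by auto
      have 2: "does Y (while_pos m (q ;; inc (Suc m) ;; dec m)) (\<rho>(m := ?N)) (?\<sigma> ?N)
          (concat (map (\<lambda>a. v (a # ?e)) [0..<?N]))"
      proof (rule does_loop[where N = ?N and \<sigma> = ?\<sigma> and v = "\<lambda>i. v (i # ?e)"])
        fix i assume i: "i < ?N"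
        have "does Y q (?\<sigma> i) ((?\<sigma> i)(d := ?\<sigma> i d + g (map (?\<sigma> i) (Suc m # rs)))) (v (map (?\<sigma> i) (Suc m # rs)))"
        proof (rule q[unfolded program_for_def, rule_format])
          fix j show "?\<sigma> i j \<le> Y" using a(1) G[of i] i N by (simp add: le_diff_conv trans_le_add1)
        next
          fix j assume "Suc (Suc m) \<le> j" then show "?\<sigma> i j = 0" using a(2) h by simp
        next
          have "(2 + sum_list (i # ?e)) ^ c \<le> Y" using inner[OF e i] Yc by linarith
          then show "(2 + sum_list (map (?\<sigma> i) (Suc m # rs))) ^ c \<le> Y" unfolding rs .
        next
          show "?\<sigma> i d + g (map (?\<sigma> i) (Suc m # rs)) \<le> Y"
            unfolding rs using G[of "Suc i"] i by simp
        qed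
        then have q': "does Y q (?\<sigma> i) ((?\<sigma> i)(d := \<rho> d + ?G (Suc i))) (v (i # ?e))"
          unfolding rs by (simp add: add.assoc)
        show "does Y (q ;; inc (Suc m) ;; dec m) (?\<sigma> i) (?\<sigma> (Suc i)) (v (i # ?e))"
          by (rule does_Seq'[OF q' does_Seq'[OF does_inc does_dec']]) (use i N h in \<open>auto simp: fun_eq_iff\<close>)
      next
        show "\<rho>(m := ?N) = ?\<sigma> 0" using a(2) h by (auto simp: fun_eq_iff)
      qed (use h in auto)
      have 3: "does Y (clear (Suc m)) (?\<sigma> ?N) ((?\<sigma> ?N)(Suc m := 0)) []"
        by (rule does_clear) (use N in simp)
      have "(?\<sigma> ?N)(Suc m := 0) = \<rho>(d := \<rho> d + ?G ?N)"
        using a(2) h by (auto simp: fun_eq_iff)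
      then show "does Y ?p \<rho> (\<rho>(d := \<rho> d + ?G ?N)) (concat (map (\<lambda>a. v (a # ?e)) [0..<?N]))"
        using does_Seq'[OF 1 does_Seq'[OF 2 3]] by simp
    qed
  qed
qed

lemma eff_if:
  assumes "eff k f (\<lambda>_. [])" "eff k g u" "eff k h v"
  shows "eff k (\<lambda>e. if f e = 0 then g e else h e) (\<lambda>e. if f e = 0 then u e else v e)"
proof -
  obtain c0 where c0: "eff_by c0 k f (\<lambda>_. [])" using assms(1) unfolding eff_def by blast
  obtain c1 where c1: "eff_by c1 k g u" "eff_by c1 k h v" using assms(2,3) by (rule eff2E)
  define c where "c = max c0 c1"
  have c: "eff_by c k f (\<lambda>_. [])" "eff_by c k g u" "eff_by c k h v"
    using c0 c1 by (simp_all add: eff_by_mono c_def)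
  show ?thesis
  proof (rule eff_byI[where c = c])
    fix rs :: "nat list" and m d
    assume a: "length rs = k" "\<forall>r\<in>set rs. r < m" "d < m" "d \<notin> set rs"
    obtain p where p: "program_for c f (\<lambda>_. []) rs (Suc m) m p"
      by (rule eff_byE[OF c(1), of rs "Suc m" m]) (use a in \<open>auto simp: less_Suc_eq\<close>)
    obtain q where q: "program_for c g u rs m d q" by (rule eff_byE[OF c(2), of rs m d]) (use a in auto)
    obtain q' where q': "program_for c h v rs m d q'" by (rule eff_byE[OF c(3), of rs m d]) (use a in auto)
    let ?p = "p ;; cond_zero m q (clear m ;; q')"
    show "\<exists>p. program_for c (\<lambda>e. if f e = 0 then g e else h e) (\<lambda>e. if f e = 0 then u e else v e) rs m d p"
      unfolding program_for_def
    proof (intro exI[of _ ?p] allI impI)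
      fix \<rho> :: "nat \<Rightarrow> nat" and Y
      let ?e = "map \<rho> rs"
      assume b: "\<forall>i. \<rho> i \<le> Y" "\<forall>i\<ge>m. \<rho> i = 0" "(2 + sum_list ?e) ^ c \<le> Y"
        "\<rho> d + (if f ?e = 0 then g ?e else h ?e) \<le> Y"
      have N: "f ?e \<le> Y" using eff_by_le[OF c(1), of ?e] b(3) a(1) by simp
      have 1: "does Y p \<rho> (\<rho>(m := f ?e)) []"
        by (rule program_into_scratch[OF p]) (use a b N in auto)
      let ?\<rho>' = "\<rho>(d := \<rho> d + (if f ?e = 0 then g ?e else h ?e))"
      have m: "\<rho>(m := 0) = \<rho>" using b by (auto simp: fun_eq_iff)
      have "does Y (if f ?e = 0 then q else clear m ;; q') (\<rho>(m := f ?e)) ?\<rho>' (if f ?e = 0 then u ?e else v ?e)"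
      proof (cases "f ?e = 0")
        case True
        then show ?thesis
          using q[unfolded program_for_def, rule_format, of \<rho> Y] b m by simp
      next
        case False
        have "does Y (clear m) (\<rho>(m := f ?e)) \<rho> []"
          using does_clear[of "\<rho>(m := f ?e)" m Y] N m by simp
        moreover have "does Y q' \<rho> ?\<rho>' (v ?e)"
          using q'[unfolded program_for_def, rule_format, of \<rho> Y] b False by simp
        ultimately have "does Y (clear m ;; q') (\<rho>(m := f ?e)) ?\<rho>' (v ?e)"
          by (rule does_Seq') simp
        then show ?thesis using False by simp
      qed
      then have "does Y (cond_zero m q (clear m ;; q')) (\<rho>(m := f ?e)) ?\<rho>' (if f ?e = 0 then u ?e else v ?e)"
        by (intro does_cond_zero) simp
      then show "does Y ?p \<rho> ?\<rho>' (if f ?e = 0 then u ?e else v ?e)"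
        using does_Seq'[OF 1] by simp
    qed
  qed (use eff_by_le[OF c(2)] eff_by_le[OF c(3)] in auto)
qed

lemma eff_show:
  assumes "eff k f (\<lambda>_. [])"
  shows "eff k (\<lambda>_. 0) (\<lambda>e. encode_nats [f e])"
proof -
  obtain c where c: "eff_by c k f (\<lambda>_. [])" using assms(1) unfolding eff_def by blast
  show ?thesis
  proof (rule eff_byI[where c = c])
    fix rs :: "nat list" and m d
    assume a: "length rs = k" "\<forall>r\<in>set rs. r < m" "d < m" "d \<notin> set rs"
    obtain p where p: "program_for c f (\<lambda>_. []) rs (Suc m) m p"
      by (rule eff_byE[OF c(1), of rs "Suc m" m]) (use a in \<open>auto simp: less_Suc_eq\<close>)
    show "\<exists>p. program_for c (\<lambda>_. 0) (\<lambda>e. encode_nats [f e]) rs m d p"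
      unfolding program_for_def
    proof (intro exI[of _ "p ;; show_counter m ;; clear m"] allI impI)
      fix \<rho> :: "nat \<Rightarrow> nat" and Y
      let ?e = "map \<rho> rs"
      assume b: "\<forall>i. \<rho> i \<le> Y" "\<forall>i\<ge>m. \<rho> i = 0" "(2 + sum_list ?e) ^ c \<le> Y"
      have N: "f ?e \<le> Y" using eff_by_le[OF c(1), of ?e] b(3) a(1) by simp
      have 1: "does Y p \<rho> (\<rho>(m := f ?e)) []"
        by (rule program_into_scratch[OF p]) (use a b N in auto)
      have 2: "does Y (show_counter m) (\<rho>(m := f ?e)) (\<rho>(m := f ?e)) (encode_nats [f ?e])"
        using does_show_counter[of "\<rho>(m := f ?e)" m Y] N by simp
      have "\<rho>(m := 0) = \<rho>(d := \<rho> d + 0)" using b by (auto simp: fun_eq_iff)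
      then have 3: "does Y (clear m) (\<rho>(m := f ?e)) (\<rho>(d := \<rho> d + 0)) []"
        using does_clear[of "\<rho>(m := f ?e)" m Y] N by simp
      show "does Y (p ;; show_counter m ;; clear m) \<rho> (\<rho>(d := \<rho> d + 0)) (encode_nats [f ?e])"
        using does_Seq'[OF 1 does_Seq'[OF 2 3]] by simp
    qed
  qed simp
qed

text \<open>Both values are decremented together; the test of register \<open>m\<close> before each
  decrement makes the subtraction stop at zero.\<close>

lemma eff_diff:
  assumes "eff k f (\<lambda>_. [])" "eff k g (\<lambda>_. [])"
  shows "eff k (\<lambda>e. f e - g e) (\<lambda>_. [])"
proof -
  obtain c where c: "eff_by c k f (\<lambda>_. [])" "eff_by c k g (\<lambda>_. [])" using assms by (rule eff2E)
  show ?thesis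
  proof (rule eff_byI[where c = c])
    fix e :: "nat list" assume "length e = k"
    then have "f e \<le> (2 + sum_list e) ^ c" using c(1) by (blast dest: eff_by_le)
    then show "f e - g e \<le> (2 + sum_list e) ^ c" by linarith
  next
    fix rs :: "nat list" and m d
    assume a: "length rs = k" "\<forall>r\<in>set rs. r < m" "d < m" "d \<notin> set rs"
    obtain p where p: "program_for c f (\<lambda>_. []) rs (Suc m) m p"
      by (rule eff_byE[OF c(1), of rs "Suc m" m]) (use a in \<open>auto simp: less_Suc_eq\<close>)
    obtain q where q: "program_for c g (\<lambda>_. []) rs (Suc (Suc m)) (Suc m) q"
      by (rule eff_byE[OF c(2), of rs "Suc (Suc m)" "Suc m"]) (use a in \<open>auto simp: less_Suc_eq\<close>)
    let ?w = "while_pos (Suc m) (cond_zero m (dec (Suc m)) (dec m ;; dec (Suc m)))"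
    show "\<exists>p. program_for c (\<lambda>e. f e - g e) (\<lambda>_. []) rs m d p"
      unfolding program_for_def
    proof (intro exI[of _ "p ;; q ;; ?w ;; transfer m d"] allI impI)
      fix \<rho> :: "nat \<Rightarrow> nat" and Y
      let ?e = "map \<rho> rs"
      assume b: "\<forall>i. \<rho> i \<le> Y" "\<forall>i\<ge>m. \<rho> i = 0" "(2 + sum_list ?e) ^ c \<le> Y" "\<rho> d + (f ?e - g ?e) \<le> Y"
      have N: "f ?e \<le> Y" "g ?e \<le> Y"
        using eff_by_le[OF c(1), of ?e] eff_by_le[OF c(2), of ?e] b(3) a(1) by simp_all
      have 1: "does Y p \<rho> (\<rho>(m := f ?e)) []"
        by (rule program_into_scratch[OF p]) (use a b N in auto)
      have rs: "map (\<rho>(m := f ?e)) rs = ?e" using a by auto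
      have "does Y q (\<rho>(m := f ?e)) ((\<rho>(m := f ?e))(Suc m := g (map (\<rho>(m := f ?e)) rs))) []"
        by (rule program_into_scratch[OF q], unfold rs) (use a b N in auto)
      then have 2: "does Y q (\<rho>(m := f ?e)) (\<rho>(m := f ?e, Suc m := g ?e)) []"
        unfolding rs .
      let ?\<sigma> = "\<lambda>i. \<rho>(m := f ?e - i, Suc m := g ?e - i)"
      have 3: "does Y ?w (\<rho>(m := f ?e, Suc m := g ?e)) (?\<sigma> (g ?e)) []"
      proof (rule does_loop[where N = "g ?e" and \<sigma> = ?\<sigma> and v = "\<lambda>_. []"])
        fix i assume i: "i < g ?e"
        show "does Y (cond_zero m (dec (Suc m)) (dec m ;; dec (Suc m))) (?\<sigma> i) (?\<sigma> (Suc i)) []"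
        proof (rule does_cond_zero, cases "f ?e - i = 0")
          case True
          then show "does Y (if ?\<sigma> i m = 0 then dec (Suc m) else dec m ;; dec (Suc m)) (?\<sigma> i) (?\<sigma> (Suc i)) []"
            using i N by (auto intro!: does_dec' simp: fun_eq_iff)
        next
          case False
          have "does Y (dec m ;; dec (Suc m)) (?\<sigma> i) (?\<sigma> (Suc i)) []"
            by (rule does_Seq'[OF does_dec does_dec']) (use i N False in \<open>auto simp: fun_eq_iff\<close>)
          then show "does Y (if ?\<sigma> i m = 0 then dec (Suc m) else dec m ;; dec (Suc m)) (?\<sigma> i) (?\<sigma> (Suc i)) []"
            using False by simp
        qed
      qed auto
      have "?\<sigma> (g ?e) = \<rho>(m := f ?e - g ?e)" using b by (auto simp: fun_eq_iff)
      then have 3: "does Y ?w (\<rho>(m := f ?e, Suc m := g ?e)) (\<rho>(m := f ?e - g ?e)) []"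
        using 3 by simp
      have 4: "does Y (transfer m d) (\<rho>(m := f ?e - g ?e)) (\<rho>(d := \<rho> d + (f ?e - g ?e))) []"
      proof -
        have "(\<rho>(m := f ?e - g ?e))(d := \<rho> d + (f ?e - g ?e), m := 0) = \<rho>(d := \<rho> d + (f ?e - g ?e))"
          using a b by (auto simp: fun_eq_iff)
        then show ?thesis
          using does_transfer[of m d "\<rho>(m := f ?e - g ?e)" Y] a b by (simp add: add.commute)
      qed
      show "does Y (p ;; q ;; ?w ;; transfer m d) \<rho> (\<rho>(d := \<rho> d + (f ?e - g ?e))) []"
        using does_Seq'[OF 1 does_Seq'[OF 2 does_Seq'[OF 3 4]]] by simp
    qed
  qed
qed

lemma eff_weaken: "eff k f out \<Longrightarrow> eff (Suc k) (\<lambda>e. f (tl e)) (\<lambda>e. out (tl e))"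
proof -
  assume "eff k f out"
  then obtain c where c: "eff_by c k f out" unfolding eff_def by blast
  show ?thesis
  proof (rule eff_byI[where c = c])
    fix e :: "nat list" assume "length e = Suc k"
    then obtain a e' where e: "e = a # e'" "length e' = k" by (cases e) auto
    then have "f e' \<le> (2 + sum_list e') ^ c" using c by (blast dest: eff_by_le)
    also have "\<dots> \<le> (2 + sum_list e) ^ c" by (rule power_mono) (auto simp: e)
    finally show "f (tl e) \<le> (2 + sum_list e) ^ c" by (simp add: e)
  next
    fix rs :: "nat list" and m d
    assume h: "length rs = Suc k" "\<forall>r\<in>set rs. r < m" "d < m" "d \<notin> set rs"
    then obtain r rs' where rs: "rs = r # rs'" "length rs' = k" by (cases rs) auto
    obtain p where p: "program_for c f out rs' m d p"
      by (rule eff_byE[OF c, of rs' m d]) (use h rs in auto)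
    have "program_for c (\<lambda>e. f (tl e)) (\<lambda>e. out (tl e)) rs m d p"
      unfolding program_for_def
    proof (intro allI impI)
      fix \<rho> :: "nat \<Rightarrow> nat" and Y
      assume a: "\<forall>i. \<rho> i \<le> Y" "\<forall>i\<ge>m. \<rho> i = 0" "(2 + sum_list (map \<rho> rs)) ^ c \<le> Y"
        "\<rho> d + f (tl (map \<rho> rs)) \<le> Y"
      have "(2 + sum_list (map \<rho> rs')) ^ c \<le> (2 + sum_list (map \<rho> rs)) ^ c"
        by (rule power_mono) (auto simp: rs)
      then show "does Y p \<rho> (\<rho>(d := \<rho> d + f (tl (map \<rho> rs)))) (out (tl (map \<rho> rs)))"
        using p[unfolded program_for_def, rule_format, of \<rho> Y] a by (simp add: rs)
    qed
    then show "\<exists>p. program_for c (\<lambda>e. f (tl e)) (\<lambda>e. out (tl e)) rs m d p" ..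
  qed
qed

section \<open>Startup of the machine, reading the input, and the space bound\<close>

fun mark :: "com \<Rightarrow> nat \<Rightarrow> com" where
  "mark c 0 = c"
| "mark c (Suc r) = Write r 3 ;; Move r Right ;; mark c r"

text \<open>Only finitely many tapes can be marked, but \<open>counters\<close> speaks of all of
  them. So tapes from \<open>r\<close> on count as marked already; for \<open>r = K\<close> these
  are tapes that the machine does not have.\<close>

definition blank_below :: "nat \<Rightarrow> nat \<Rightarrow> (nat \<Rightarrow> nat) \<times> nat" where
  "blank_below r i = (if i < r then (\<lambda>_. 0, 0) else (bits_tape [], 1))"

lemma uses_mark: "r \<le> K \<Longrightarrow> 3 < K \<Longrightarrow> uses K c \<Longrightarrow> uses K (mark c r)"
  by (induction r) auto

lemma exec_mark:
  assumes "exec S w c (p, counters (\<lambda>_. 0), v) \<sigma>" "1 < S"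
  shows "exec S w (mark c r) (p, blank_below r, v) \<sigma>"
proof (induction r)
  case 0
  have "blank_below 0 = counters (\<lambda>_. 0)" by (auto simp: blank_below_def counters_def)
  then show ?case using assms(1) by simp
next
  case (Suc r)
  let ?T = "blank_below (Suc r)"
  have ok: "ok S (p, ?T, v)" using assms(2) by (auto simp: ok_def blank_below_def)
  have 0: "?T(r := (\<lambda>_. 0, 0)) = ?T" by (auto simp: blank_below_def)
  have m: "(\<lambda>_. 0)(0 := 3) = bits_tape []" by (auto simp: bits_tape_def split: nat.split)
  have 1: "?T(r := (bits_tape [], 1)) = blank_below r" by (auto simp: blank_below_def less_Suc_eq)
  have "exec S w (Write r 3) (p, ?T, v) (p, ?T(r := (bits_tape [], 0)), v)"
    using exec_Write[OF ok, of 0 w r 3 "\<lambda>_. 0"] assms(2) unfolding 0 m by simp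
  moreover have "exec S w (Move r Right) (p, ?T(r := (bits_tape [], 0)), v) (p, blank_below r, v)"
    using exec_Move[OF ok, of 0 Right w r "bits_tape []"] assms(2) unfolding 1[symmetric] by simp
  ultimately show ?case using Suc by (auto intro: exec_Seq)
qed

text \<open>The test looks at the input symbol alone; tape 0 just fills the tape argument of
  \<open>While\<close>.\<close>

definition count_input :: "nat \<Rightarrow> com" where
  "count_input r = While 0 (\<lambda>a _. a = Input True) (inc r ;; Input_Right)"

lemma exec_count_input:
  assumes "\<And>i. i < k \<Longrightarrow> read_input w (p + i) = Input True" "read_input w (p + k) \<noteq> Input True"
    "p + k \<le> length w + 1" "\<rho> r + k \<le> Y" "length (nat_bits Y) + 3 \<le> S"
  shows "exec S w (count_input r) (p, counters \<rho>, v) (p + k, counters (\<rho>(r := \<rho> r + k)), v)"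
  using assms(1-4) unfolding count_input_def
proof (induction k arbitrary: p \<rho>)
  case 0
  then show ?case using exec_While_stop[where r = 0] assms(5) by (simp add: ok_counters)
next
  case (Suc k)
  let ?\<rho> = "\<rho>(r := Suc (\<rho> r))"
  have "exec S w (inc r) (p, counters \<rho>, v) (p, counters ?\<rho>, v)"
    using does_inc[of \<rho> r Y] Suc.prems(4) assms(5) by (simp add: does_def)
  moreover have "exec S w Input_Right (p, counters ?\<rho>, v) (Suc p, counters ?\<rho>, v)"
    using exec_Input_Right[OF ok_counters, of S w p ?\<rho> v] Suc.prems(3) assms(5) by simp
  ultimately have 1: "exec S w (inc r ;; Input_Right) (p, counters \<rho>, v) (Suc p, counters ?\<rho>, v)"
    by (rule exec_Seq)
  have "exec S w (While 0 (\<lambda>a _. a = Input True) (inc r ;; Input_Right)) (Suc p, counters ?\<rho>, v)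
     (Suc p + k, counters (?\<rho>(r := ?\<rho> r + k)), v)"
    by (rule Suc.IH) (use Suc.prems(1)[of "Suc _"] Suc.prems(2-4) in auto)
  then have 2: "exec S w (While 0 (\<lambda>a _. a = Input True) (inc r ;; Input_Right)) (Suc p, counters ?\<rho>, v)
     (p + Suc k, counters (\<rho>(r := \<rho> r + Suc k)), v)"
    by simp
  show ?case by (rule exec_While_step[OF _ 1 2]) (use Suc.prems(1)[of 0] in simp)
qed

lemma read_index_word:
  "i < n \<Longrightarrow> read_input (index_word n t) (1 + i) = Input True"
  "read_input (index_word n t) (1 + n) = Input False"
  "i < t \<Longrightarrow> read_input (index_word n t) (n + 2 + i) = Input True"
  "read_input (index_word n t) (n + 2 + t) = Right_End"
  by (auto simp: read_input_def index_word_def nth_append nth_Cons split: nat.split)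

lemma log_length_nat_bits: "0 < n \<Longrightarrow> real (length (nat_bits n)) \<le> log 2 (real n) + 1"
proof (induction n rule: less_induct)
  case (less n)
  show ?case
  proof (cases "n = 1")
    case False
    then have pos: "0 < n div 2" "n div 2 < n" using less.prems by auto
    have "real (length (nat_bits n)) = 1 + real (length (nat_bits (n div 2)))"
      using less.prems by (simp add: nat_bits_pos)
    also have "\<dots> \<le> 1 + (log 2 (real (n div 2)) + 1)" using less.IH[OF pos(2,1)] by simp
    also have "log 2 (real (n div 2)) \<le> log 2 (real n / 2)"
      using pos by (intro log_mono) linarith+
    also have "log 2 (real n / 2) = log 2 (real n) - 1"
      using less.prems by (simp add: log_divide)
    finally show ?thesis by simp
  qed (simp add: nat_bits_pos)
qed

text \<open>A counter whose value is polynomial in \<open>n + t\<close> has \<open>O(log n)\<close>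
  bits for \<open>t <= n\<close>. Registers 0 and 1 receive the input; the destination register 2
  stays zero because a printing program has value 0.\<close>

lemma machine_for:
  assumes "eff 2 (\<lambda>_. 0) out"
  shows "\<exists>M. wf_machine M \<and> (\<forall>n t. tm_outputs M (index_word n t) (out [n, t])) \<and>
    (\<exists>c. \<forall>\<^sub>F n in at_top. \<forall>t\<le>n. tm_space_le M (index_word n t) (c * log 2 (real n)))"
proof -
  obtain c where c: "eff_by c 2 (\<lambda>_. 0) out" using assms unfolding eff_def by blast
  obtain p where p: "program_for c (\<lambda>_. 0) out [0, 1] 3 2 p"
    by (rule eff_byE[OF c, of "[0, 1]" 3 2]) auto
  define main where
    "main = Input_Right ;; count_input 0 ;; Input_Right ;; count_input 1 ;; p"
  obtain K0 where "uses K0 main" using ex_uses[of main] ..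
  \<comment> \<open>At least 4, since the end marker 3 has to be a tape symbol.\<close>
  define K where "K = max 4 K0"
  have "uses K (mark main K)"
    by (rule uses_mark) (use uses_mono[OF \<open>uses K0 main\<close>, of K] in \<open>auto simp: K_def\<close>)
  moreover have "0 < K" by (simp add: K_def)
  ultimately obtain h where "compiled (mark main K) K h"
    using compiled_exists by blast
  then interpret compiled "mark main K" K h .
  \<comment> \<open>The exponent \<open>Suc c\<close> in place of \<open>c\<close> ensures
    \<open>n + t + 2 <= Y n t\<close> even for \<open>c = 0\<close>.\<close>
  define Y where "Y n t = (2 + n + t) ^ Suc c" for n t :: nat
  define S where "S n t = length (nat_bits (Y n t)) + 3" for n t
  have ex: "exec (S n t) (index_word n t) (mark main K) (0, blank_below K, [])
      (n + 2 + t, counters ((\<lambda>_. 0)(0 := n, 1 := t)), out [n, t])" for n t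
  proof -
    let ?w = "index_word n t"
    let ?z = "\<lambda>_ :: nat. 0 :: nat"
    have Y: "n + t + 2 \<le> Y n t" "(2 + n + t) ^ c \<le> Y n t"
      unfolding Y_def using self_le_power[of "2 + n + t" "Suc c"] by simp_all
    have l: "length ?w = n + 1 + t" by (simp add: index_word_def)
    have ok: "ok (S n t) (q, counters \<rho>, v)" for q \<rho> v
      by (rule ok_counters) (simp add: S_def)
    have 1: "exec (S n t) ?w Input_Right (0, counters ?z, []) (1, counters ?z, [])"
      using exec_Input_Right[OF ok, of ?w 0] by simp
    have 2: "exec (S n t) ?w (count_input 0) (1, counters ?z, []) (1 + n, counters (?z(0 := n)), [])"
      using exec_count_input[of n ?w 1 ?z 0 "Y n t" "S n t" "[]"] read_index_word(1,2)[where n = n and t = t] l Y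
      by (auto simp: S_def)
    have 3: "exec (S n t) ?w Input_Right (1 + n, counters (?z(0 := n)), []) (n + 2, counters (?z(0 := n)), [])"
      using exec_Input_Right[OF ok, of ?w "1 + n"] l by simp
    have 4: "exec (S n t) ?w (count_input 1) (n + 2, counters (?z(0 := n)), [])
        (n + 2 + t, counters (?z(0 := n, 1 := t)), [])"
      using exec_count_input[of t ?w "n + 2" "?z(0 := n)" 1 "Y n t" "S n t" "[]"]
        read_index_word(3,4)[where n = n and t = t] l Y
      by (auto simp: S_def)
    let ?\<rho> = "?z(0 := n, 1 := t)"
    have "does (Y n t) p ?\<rho> (?\<rho>(2 := ?\<rho> 2 + 0)) (out (map ?\<rho> [0, 1]))"
      by (rule p[unfolded program_for_def, rule_format]) (use Y in \<open>auto simp: add.assoc\<close>)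
    moreover have "?\<rho>(2 := ?\<rho> 2 + 0) = ?\<rho>" "map ?\<rho> [0, 1] = [n, t]" by (auto simp: fun_eq_iff)
    ultimately have "does (Y n t) p ?\<rho> ?\<rho> (out [n, t])" by (simp only:)
    then have 5: "exec (S n t) ?w p (n + 2 + t, counters (?z(0 := n, 1 := t)), [])
        (n + 2 + t, counters (?z(0 := n, 1 := t)), out [n, t])"
      unfolding does_def by (metis S_def append_Nil order_refl)
    have "exec (S n t) ?w main (0, counters ?z, []) (n + 2 + t, counters (?z(0 := n, 1 := t)), out [n, t])"
      unfolding main_def by (rule exec_Seq[OF 1 exec_Seq[OF 2 exec_Seq[OF 3 exec_Seq[OF 4 5]]]])
    then show ?thesis by (rule exec_mark) (simp add: S_def)
  qed
  have T: "map (blank_below K) [0..<K] = replicate K (\<lambda>_. 0, 0)"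
    by (rule nth_equalityI) (auto simp: blank_below_def)
  \<comment> \<open>For \<open>2 <= n\<close> and \<open>t <= n\<close> the logarithm of
    \<open>2 + n + t <= 4 * n\<close> is at most \<open>log n + 2 <= 3 * log n\<close>. The 4
    absorbs three extra cells and the rounding of the bit length.\<close>
  let ?C = "3 * real (Suc c) + 4"
  have S: "real (S n t) \<le> ?C * log 2 (real n)" if "2 \<le> n" "t \<le> n" for n t
  proof -
    have l: "1 \<le> log 2 (real n)" using that by (simp add: le_log_iff)
    have "real (S n t) \<le> log 2 (real (Y n t)) + 4"
      using log_length_nat_bits[of "Y n t"] by (simp add: S_def Y_def)
    also have "log 2 (real (Y n t)) = real (Suc c) * log 2 (real (2 + n + t))"
      unfolding Y_def of_nat_power by (rule log_nat_power) simp
    finally have 1: "real (S n t) \<le> real (Suc c) * log 2 (real (2 + n + t)) + 4" .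
    have "log 2 (real (2 + n + t)) \<le> log 2 (real n * 2 ^ 2)"
      using that by (intro log_mono) auto
    also have "\<dots> = log 2 (real n) + 2"
      using that log_nat_power[of 2 2 2] by (subst log_mult) auto
    also have "\<dots> \<le> 3 * log 2 (real n)" using l by simp
    finally have "real (Suc c) * log 2 (real (2 + n + t)) \<le> real (Suc c) * (3 * log 2 (real n))"
      by (intro mult_left_mono) auto
    then have "real (S n t) \<le> real (Suc c) * (3 * log 2 (real n)) + 4 * log 2 (real n)"
      using 1 l by linarith
    then show ?thesis by (simp only: distrib_right mult.assoc mult.left_commute)
  qed
  show ?thesis
  proof (intro exI[of _ M] conjI allI)
    show "wf_machine M" by (rule wf)
    show "tm_outputs M (index_word n t) (out [n, t])" for n t
      by (rule simulation(1)[OF ex T])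
    show "\<exists>c. \<forall>\<^sub>F n in at_top. \<forall>t\<le>n. tm_space_le M (index_word n t) (c * log 2 (real n))"
      by (intro exI[of _ ?C] eventually_at_top_linorderI[of 2] allI impI simulation(2)[OF ex T] S)
  qed
qed

subsection \<open>Computable functions\<close>

definition computable :: "nat \<Rightarrow> (nat list \<Rightarrow> nat) \<Rightarrow> bool" where
  "computable k f \<longleftrightarrow> eff k f (\<lambda>_. [])"

definition prints :: "nat \<Rightarrow> (nat list \<Rightarrow> token list) \<Rightarrow> bool" where
  "prints k out \<longleftrightarrow> eff k (\<lambda>_. 0) out"

lemma computable_add: "computable k f \<Longrightarrow> computable k g \<Longrightarrow> computable k (\<lambda>e. f e + g e)"
  unfolding computable_def using eff_add[of k f "\<lambda>_. []" g "\<lambda>_. []"] by simp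

lemma computable_diff: "computable k f \<Longrightarrow> computable k g \<Longrightarrow> computable k (\<lambda>e. f e - g e)"
  unfolding computable_def by (rule eff_diff)

lemma computable_const: "computable k (\<lambda>_. c)"
proof (induction c)
  case (Suc c)
  then have "computable k (\<lambda>_. 1 + c)" using computable_add[of k "\<lambda>_. 1"] eff_1 computable_def by blast
  then show ?case by simp
qed (simp add: computable_def eff_0)

lemma computable_nth: "i < k \<Longrightarrow> computable k (\<lambda>e. e ! i)"
  unfolding computable_def by (rule eff_nth)

lemma computable_weaken: "computable k f \<Longrightarrow> computable (Suc k) (\<lambda>e. f (tl e))"
  unfolding computable_def by (drule eff_weaken)

text \<open>In the premise the bound variable is the head of the list and the outer variables are
  its tail. In this form the rule applies to nested sums by higher-order unification.\<close>

lemma computable_sum: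
  assumes "computable k f" "computable (Suc k) (\<lambda>e. g (tl e) (hd e))"
  shows "computable k (\<lambda>e. \<Sum>a<f e. g e a)"
proof -
  have "(\<lambda>e. concat (map (\<lambda>a. []) [0..<f e])) = (\<lambda>_. [] :: token list)"
    by (auto simp: fun_eq_iff)
  then show ?thesis
    using eff_loop[of k f "\<lambda>e. g (tl e) (hd e)" "\<lambda>_. []"] assms unfolding computable_def by simp
qed

text \<open>\<open>eff\<close> concerns lists of length \<open>Suc k\<close> only, on which
  \<open>hd e\<close> and \<open>e ! 0\<close> agree; as functions on all lists they need not be
  equal.\<close>

lemma eff_hd: "eff (Suc k) hd (\<lambda>_. [])"
proof -
  have "eff_by c (Suc k) (\<lambda>e. e ! 0) (\<lambda>_. []) \<Longrightarrow> eff_by c (Suc k) hd (\<lambda>_. [])" for c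
  proof -
    assume c: "eff_by c (Suc k) (\<lambda>e. e ! 0) (\<lambda>_. [])"
    have "e ! 0 = hd e" if "length e = Suc k" for e :: "nat list" using that by (cases e) auto
    moreover have "map \<rho> rs ! 0 = hd (map \<rho> rs)" if "length rs = Suc k" for rs :: "nat list" and \<rho> :: "nat \<Rightarrow> nat"
      using that by (cases rs) auto
    ultimately show ?thesis using c unfolding eff_by_def program_for_def by (metis (no_types, lifting))
  qed
  then show ?thesis using eff_nth[of 0 "Suc k"] unfolding eff_def by auto
qed

lemma computable_hd: "computable (Suc k) hd"
  unfolding computable_def by (rule eff_hd)

lemma computable_mult: "computable k f \<Longrightarrow> computable k g \<Longrightarrow> computable k (\<lambda>e. f e * g e)"
  using computable_sum[of k f "\<lambda>e a. g e", OF _ computable_weaken] by simp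

lemma computable_if: "computable k f \<Longrightarrow> computable k g \<Longrightarrow> computable k h \<Longrightarrow> computable k (\<lambda>e. if f e = 0 then g e else h e)"
  unfolding computable_def by (drule (2) eff_if) simp

lemma computable_not: "computable k f \<Longrightarrow> computable k (\<lambda>e. of_bool (f e = 0))"
  using computable_if[of k f "\<lambda>_. 1" "\<lambda>_. 0"] computable_const by (simp add: of_bool_def)

lemma computable_eq: "computable k f \<Longrightarrow> computable k g \<Longrightarrow> computable k (\<lambda>e. of_bool (f e = g e))"
proof -
  assume "computable k f" "computable k g"
  then have "computable k (\<lambda>e. of_bool ((f e - g e) + (g e - f e) = 0))"
    by (intro computable_not computable_add computable_diff)
  moreover have "((x - y) + (y - x) = 0) = (x = y)" for x y :: nat by auto
  ultimately show ?thesis by simp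
qed

lemma prints_append: "prints k u \<Longrightarrow> prints k v \<Longrightarrow> prints k (\<lambda>e. u e @ v e)"
  unfolding prints_def using eff_add[of k "\<lambda>_. 0" u "\<lambda>_. 0" v] by simp

lemma prints_Nil: "prints k (\<lambda>_. [])"
  unfolding prints_def by (rule eff_0)

lemma prints_Cons: "prints k u \<Longrightarrow> prints k (\<lambda>e. a # u e)"
  using prints_append[of k "\<lambda>_. [a]" u] eff_Emit[of k a] unfolding prints_def by simp

lemma prints_nats_Cons: "computable k f \<Longrightarrow> prints k (\<lambda>e. encode_nats (g e)) \<Longrightarrow> prints k (\<lambda>e. encode_nats (f e # g e))"
proof -
  assume "computable k f" "prints k (\<lambda>e. encode_nats (g e))"
  then have "prints k (\<lambda>e. encode_nats [f e] @ encode_nats (g e))"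
    unfolding computable_def prints_def by (intro prints_append[unfolded prints_def] eff_show)
  then show ?thesis by (simp add: encode_nats_def)
qed

lemma prints_concat:
  assumes "computable k f" "prints (Suc k) (\<lambda>e. v (tl e) (hd e))"
  shows "prints k (\<lambda>e. concat (map (v e) [0..<f e]))"
  using eff_loop[of k f "\<lambda>_. 0" "\<lambda>e. v (tl e) (hd e)"] assms unfolding computable_def prints_def
  by simp

lemma prints_if:
  assumes "computable k (\<lambda>e. of_bool (P e))" "prints k u" "prints k v"
  shows "prints k (\<lambda>e. if P e then u e else v e)"
proof -
  have "prints k (\<lambda>e. if (of_bool (P e) :: nat) = 0 then v e else u e)"
    using eff_if[of k "\<lambda>e. of_bool (P e)" "\<lambda>_. 0" v "\<lambda>_. 0" u] assms unfolding computable_def prints_def by simp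
  moreover have "(if (of_bool (P e) :: nat) = 0 then v e else u e) = (if P e then u e else v e)" for e
    by simp
  ultimately show ?thesis by simp
qed

section \<open>Quantum circuits\<close>

subsection \<open>States as functions of assignments of bits to wires\<close>

text \<open>The control may depend on the target, so that a whole layer of parallel fan-out gates is
  again a single \<open>fan\<close>.\<close>

definition fan :: "(nat \<Rightarrow> nat) \<Rightarrow> nat set \<Rightarrow> (nat \<Rightarrow> bool) \<Rightarrow> nat \<Rightarrow> bool" where
  "fan c T f = (\<lambda>i. if i \<in> T then f i \<noteq> f (c i) else f i)"

fun ap :: "(complex^bool^bool) gate \<Rightarrow> ((nat \<Rightarrow> bool) \<Rightarrow> complex) \<Rightarrow> (nat \<Rightarrow> bool) \<Rightarrow> complex" where
  "ap (One U q) \<psi> = (\<lambda>f. \<Sum>b\<in>UNIV. U $ f q $ b * \<psi> (f(q := b)))"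
| "ap (CNOT c t) \<psi> = (\<lambda>f. \<psi> (fan (\<lambda>_. c) {t} f))"
| "ap (Fanout c ts) \<psi> = (\<lambda>f. \<psi> (fan (\<lambda>_. c) (set ts) f))"

text \<open>Total assignments free the analysis from length conditions: wires beyond the string read
  \<open>False\<close>, and \<open>lift_state\<close> leads back to strings.\<close>

definition assignment :: "bool list \<Rightarrow> nat \<Rightarrow> bool" where
  "assignment z i \<longleftrightarrow> i < length z \<and> z ! i"

definition lift_state :: "nat \<Rightarrow> ((nat \<Rightarrow> bool) \<Rightarrow> complex) \<Rightarrow> state" where
  "lift_state N \<phi> = (\<lambda>z. if length z = N then \<phi> (assignment z) else 0)"

lemma assignment_update: "q < length z \<Longrightarrow> assignment (z[q := b]) = (assignment z)(q := b)"
  by (auto simp: assignment_def fun_eq_iff nth_list_update)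

lemma assignment_fanout_bits:
  "c < length z \<Longrightarrow> \<forall>t\<in>set ts. t < length z \<Longrightarrow>
    assignment (fanout_bits c ts z) = fan (\<lambda>_. c) (set ts) (assignment z)"
  by (auto simp: assignment_def fun_eq_iff fanout_bits_def fan_def)

lemma assignment_inj: "length z = length z' \<Longrightarrow> assignment z = assignment z' \<Longrightarrow> z = z'"
  by (rule nth_equalityI) (auto simp: assignment_def fun_eq_iff)

lemma apply_gate_lift:
  assumes "\<forall>q\<in>set (gate_qubits g). q < N"
  shows "apply_gate g (lift_state N \<phi>) = lift_state N (ap g \<phi>)"
proof
  fix z
  have len: "length (fanout_bits c ts z) = length z" for c ts by (simp add: fanout_bits_def)
  show "apply_gate g (lift_state N \<phi>) z = lift_state N (ap g \<phi>) z"
    using assms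
    by (cases g)
      (auto simp: lift_state_def len assignment_update assignment_fanout_bits, auto simp: assignment_def UNIV_bool)
qed

lemma run_circuit_lift:
  assumes "\<forall>l\<in>set (layers C). \<forall>g\<in>set l. \<forall>q\<in>set (gate_qubits g). q < N"
  shows "run_circuit C (lift_state N \<phi>) = lift_state N (fold (fold ap) (layers C) \<phi>)"
proof -
  have l: "fold apply_gate l (lift_state N \<phi>) = lift_state N (fold ap l \<phi>)"
    if "\<forall>g\<in>set l. \<forall>q\<in>set (gate_qubits g). q < N" for l \<phi>
    using that by (induction l arbitrary: \<phi>) (auto simp: apply_gate_lift)
  have "fold (fold apply_gate) ls (lift_state N \<phi>) = lift_state N (fold (fold ap) ls \<phi>)"
    if "\<forall>l\<in>set ls. \<forall>g\<in>set l. \<forall>q\<in>set (gate_qubits g). q < N" for ls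
    using that by (induction ls arbitrary: \<phi>) (auto simp: l)
  then show ?thesis using assms by (simp add: run_circuit_def)
qed

lemma ket_lift: "ket z = lift_state (length z) (\<lambda>f. of_bool (f = assignment z))"
proof
  fix z'
  show "ket z z' = lift_state (length z) (\<lambda>f. of_bool (f = assignment z)) z'"
    using assignment_inj[of z' z] by (auto simp: ket_def lift_state_def)
qed

subsection \<open>Layers of self-inverse gates\<close>

fun involutive :: "(complex^bool^bool) gate \<Rightarrow> bool" where
  "involutive (One U q) = (U ** U = mat 1)"
| "involutive (CNOT c t) = (c \<noteq> t)"
| "involutive (Fanout c ts) = (c \<notin> set ts)"

lemma fan_fan: "(\<And>i. i \<in> T \<Longrightarrow> c i \<notin> T) \<Longrightarrow> fan c T (fan c T f) = f"
  by (auto simp: fan_def fun_eq_iff)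

lemma ap_involutive: "involutive g \<Longrightarrow> ap g (ap g \<psi>) = \<psi>"
proof (cases g)
  case (One U q)
  assume "involutive g"
  then have "(U ** U) $ i $ k = mat 1 $ i $ k" for i k by (simp add: One)
  then have U: "U $ i $ False * U $ False $ k + U $ i $ True * U $ True $ k = of_bool (i = k)" for i k
    by (simp add: matrix_matrix_mult_def UNIV_bool mat_def add.commute)
  show ?thesis
  proof
    fix f
    have "ap g (ap g \<psi>) f =
        (U $ f q $ False * U $ False $ False + U $ f q $ True * U $ True $ False) * \<psi> (f(q := False)) +
        (U $ f q $ False * U $ False $ True + U $ f q $ True * U $ True $ True) * \<psi> (f(q := True))"
      by (simp add: One UNIV_bool algebra_simps)
    also have "\<dots> = \<psi> f" unfolding U by (cases "f q") (simp_all add: fun_upd_idem)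
    finally show "ap g (ap g \<psi>) f = \<psi> f" .
  qed
qed (auto simp: fan_fan)

lemma fan_upd:
  "q \<notin> T \<Longrightarrow> (\<And>i. i \<in> T \<Longrightarrow> c i \<noteq> q) \<Longrightarrow> fan c T (f(q := b)) = (fan c T f)(q := b)"
  by (auto simp: fan_def fun_eq_iff)

lemma fan_other: "q \<notin> T \<Longrightarrow> fan c T f q = f q"
  by (simp add: fan_def)

lemma fan_commute:
  "T \<inter> T' = {} \<Longrightarrow> (\<And>i. i \<in> T \<Longrightarrow> c i \<notin> T') \<Longrightarrow> (\<And>i. i \<in> T' \<Longrightarrow> c' i \<notin> T) \<Longrightarrow>
    fan c T (fan c' T' f) = fan c' T' (fan c T f)"
  by (auto simp: fan_def fun_eq_iff)

lemma ap_commute: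
  assumes "set (gate_qubits g) \<inter> set (gate_qubits h) = {}"
  shows "ap g (ap h \<psi>) = ap h (ap g \<psi>)"
  using assms
  by (cases g; cases h)
    (auto simp: fun_eq_iff fan_upd fan_other fun_upd_twist UNIV_bool algebra_simps
      intro!: arg_cong[of _ _ \<psi>] fan_commute)

lemma fold_ap_commute:
  "(\<And>h. h \<in> set l \<Longrightarrow> set (gate_qubits g) \<inter> set (gate_qubits h) = {}) \<Longrightarrow>
    fold ap l (ap g \<psi>) = ap g (fold ap l \<psi>)"
proof (induction l arbitrary: \<psi>)
  case (Cons h l)
  then show ?case by (simp add: ap_commute[of h g])  (metis Int_commute ap_commute)
qed simp

text \<open>Gates on disjoint qubits commute, so the two occurrences of each gate can be brought
  together and cancel.\<close>

lemma layer_involutive: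
  "distinct (concat (map gate_qubits l)) \<Longrightarrow> \<forall>g\<in>set l. involutive g \<Longrightarrow> fold ap l (fold ap l \<psi>) = \<psi>"
proof (induction l arbitrary: \<psi>)
  case (Cons g l)
  have "fold ap l (ap g (fold ap l (ap g \<psi>))) = ap g (fold ap l (fold ap l (ap g \<psi>)))"
    by (rule fold_ap_commute) (use Cons.prems in auto)
  also have "\<dots> = \<psi>" using Cons by (simp add: ap_involutive)
  finally show ?case by simp
qed simp

lemma rev_involutive:
  "\<forall>l\<in>set ls. distinct (concat (map gate_qubits l)) \<and> (\<forall>g\<in>set l. involutive g) \<Longrightarrow>
    fold (fold ap) (rev ls) (fold (fold ap) ls \<psi>) = \<psi>"
  by (induction ls arbitrary: \<psi>) (auto simp: layer_involutive)

definition flip :: "nat set \<Rightarrow> (nat \<Rightarrow> bool) \<Rightarrow> nat \<Rightarrow> bool" where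
  "flip T f = (\<lambda>i. if i \<in> T then \<not> f i else f i)"

lemma ap_flip:
  assumes "y \<notin> set (gate_qubits g)"
  shows "ap g (\<lambda>f. \<psi> (flip {y} f)) = (\<lambda>f. ap g \<psi> (flip {y} f))"
proof (cases g)
  case (One U q)
  then have "flip {y} (f(q := b)) = (flip {y} f)(q := b)" "flip {y} f q = f q" for f b
    using assms by (auto simp: flip_def fun_eq_iff)
  then show ?thesis by (simp add: One)
next
  case (CNOT c t)
  then have "flip {y} (fan (\<lambda>_. c) {t} f) = fan (\<lambda>_. c) {t} (flip {y} f)" for f
    using assms by (auto simp: flip_def fan_def fun_eq_iff)
  then show ?thesis by (simp add: CNOT)
next
  case (Fanout c ts)
  then have "flip {y} (fan (\<lambda>_. c) (set ts) f) = fan (\<lambda>_. c) (set ts) (flip {y} f)" for f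
    using assms by (auto simp: flip_def fan_def fun_eq_iff)
  then show ?thesis by (simp add: Fanout)
qed

lemma layers_flip:
  assumes "\<forall>l\<in>set ls. \<forall>g\<in>set l. y \<notin> set (gate_qubits g)"
  shows "fold (fold ap) ls (\<lambda>f. \<psi> (flip {y} f)) = (\<lambda>f. fold (fold ap) ls \<psi> (flip {y} f))"
proof -
  have l: "fold ap l (\<lambda>f. \<psi> (flip {y} f)) = (\<lambda>f. fold ap l \<psi> (flip {y} f))"
    if "\<forall>g\<in>set l. y \<notin> set (gate_qubits g)" for l \<psi>
    using that by (induction l arbitrary: \<psi>) (auto simp: ap_flip)
  show ?thesis using assms by (induction ls arbitrary: \<psi>) (auto simp: l)
qed

text \<open>Compute, copy the result bit to the target, uncompute: no phase of the computed state
  survives, so only the support of the computed state matters.\<close>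

lemma compute_copy_uncompute:
  assumes "\<forall>l\<in>set ls. distinct (concat (map gate_qubits l)) \<and>
      (\<forall>g\<in>set l. involutive g \<and> y \<notin> set (gate_qubits g))"
    and "r \<noteq> y" "\<And>f. fold (fold ap) ls \<psi> f \<noteq> 0 \<Longrightarrow> f r = v"
  shows "fold (fold ap) (ls @ [[CNOT r y]] @ rev ls) \<psi> = (if v then (\<lambda>f. \<psi> (flip {y} f)) else \<psi>)"
proof -
  let ?\<phi> = "fold (fold ap) ls \<psi>"
  let ?\<psi>' = "if v then (\<lambda>f. \<psi> (flip {y} f)) else \<psi>"
  have "ap (CNOT r y) ?\<phi> = (if v then (\<lambda>f. ?\<phi> (flip {y} f)) else ?\<phi>)"
  proof
    fix f
    have fan: "fan (\<lambda>_. r) {y} f = (if f r then flip {y} f else f)"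
      by (auto simp: fan_def flip_def fun_eq_iff)
    have r: "flip {y} f r = f r" using assms(2) by (simp add: flip_def)
    \<comment> \<open>If the amplitude at \<open>f\<close> or at its flip is nonzero, the support
      forces \<open>f r = v\<close>; otherwise both sides vanish.\<close>
    show "ap (CNOT r y) ?\<phi> f = (if v then (\<lambda>f. ?\<phi> (flip {y} f)) else ?\<phi>) f"
      using assms(3)[of f] assms(3)[of "flip {y} f"] r
      by (cases "?\<phi> f = 0"; cases "?\<phi> (flip {y} f) = 0") (auto simp: fan)
  qed
  also have "\<dots> = fold (fold ap) ls ?\<psi>'"
    using layers_flip[of ls y \<psi>] assms(1) by simp
  finally show ?thesis
    using rev_involutive[of ls ?\<psi>'] assms(1) by simp
qed

subsection \<open>Reflections\<close>

text \<open>All one-qubit gates of the circuit are reflections and thus self-inverse; \<open>reflection 4 0 1\<close> is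
  the Hadamard gate.\<close>

definition reflection_code :: "nat \<Rightarrow> nat \<Rightarrow> nat \<Rightarrow> gate_code" where
  "reflection_code g p q = ((0, 0, 1), (0, 1, g), (1, p, q), (0, q + p, q))"

text \<open>Angle codes have natural numerators, so a negative angle needs the constant
  \<open>- pi\<close>. With \<open>\<zeta> = pi * p / q\<close> the last two angles are
  \<open>- \<zeta>\<close> and \<open>pi + \<zeta>\<close>; their sum \<open>pi\<close> makes the
  lower right entry the negative of the upper left one.\<close>

definition reflection :: "nat \<Rightarrow> nat \<Rightarrow> nat \<Rightarrow> complex^bool^bool" where
  "reflection g p q = gate_of [pi, - pi] (reflection_code g p q)"

lemma reflection_entries:
  fixes g p q :: nat
  assumes "0 < q"
  defines "\<zeta> \<equiv> pi * real p / real q" and "\<gamma> \<equiv> pi / real g"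
  shows "reflection g p q $ False $ False = cos \<gamma>" "reflection g p q $ False $ True = cis \<zeta> * sin \<gamma>"
    "reflection g p q $ True $ False = cis (- \<zeta>) * sin \<gamma>" "reflection g p q $ True $ True = - cos \<gamma>"
proof -
  have 1: "real (q + p) / real q * pi = pi + \<zeta>" "real p / real q * - pi = - \<zeta>"
    using assms(1) by (simp_all add: \<zeta>_def field_simps)
  have "reflection g p q = u_gate 0 \<gamma> (- \<zeta>) (pi + \<zeta>)"
    using 1 by (simp add: reflection_def reflection_code_def \<gamma>_def)
  then show "reflection g p q $ False $ False = cos \<gamma>" "reflection g p q $ False $ True = cis \<zeta> * sin \<gamma>"
    "reflection g p q $ True $ False = cis (- \<zeta>) * sin \<gamma>" "reflection g p q $ True $ True = - cos \<gamma>"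
    by (simp_all add: u_gate_def cis_mult[symmetric])
qed

lemma reflection_involutive: "0 < q \<Longrightarrow> reflection g p q ** reflection g p q = mat 1"
proof -
  assume q: "0 < q"
  note e = reflection_entries[OF q, of g p]
  define C S Z Z' where "C = complex_of_real (cos (pi / real g))" "S = complex_of_real (sin (pi / real g))"
    "Z = cis (pi * real p / real q)" "Z' = cis (- (pi * real p / real q))"
  note defs = this
  have "C\<^sup>2 + S\<^sup>2 = 1" unfolding defs by (metis of_real_1 of_real_add of_real_power sin_cos_squared_add2)
  moreover have "Z * Z' = 1" by (simp add: defs cis_mult)
  ultimately have prods: "C * C + Z * S * (Z' * S) = 1" "C * (Z * S) + Z * S * - C = 0"
    "Z' * S * C + - C * (Z' * S) = 0" "Z' * S * (Z * S) + - C * - C = 1"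
    by algebra+
  show ?thesis
    unfolding vec_eq_iff all_bool_eq matrix_matrix_mult_def mat_def UNIV_bool
    by (simp add: e defs(1,2)[symmetric] defs(3,4)[symmetric] del: mult_minus_left mult_minus_right)
       (use prods in \<open>simp add: add.commute\<close>)
qed

subsection \<open>The rotation gadget\<close>

text \<open>Inputs \<open>a < A\<close> sit on wires \<open>iw a\<close> and outputs \<open>b < B\<close> on wires \<open>ow b\<close>; every edge has its own
  wire \<open>W a b\<close>, which receives the parity of input and output, so that one-qubit gates on the edge
  wires rotate the phase of output \<open>b\<close> by an angle proportional to the number of its input ones.\<close>

definition edges :: "nat \<Rightarrow> nat \<Rightarrow> (nat \<Rightarrow> nat \<Rightarrow> bool) \<Rightarrow> (nat \<times> nat) list" where
  "edges A B edge = concat (map (\<lambda>b. map (\<lambda>a. (a, b)) (filter (\<lambda>a. edge a b) [0..<A])) [0..<B])"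

text \<open>Write \<open>x\<close> for input \<open>a\<close> and \<open>y\<close> for output
  \<open>b\<close>, and let \<open>R = reflection\<close>. The edge wire first receives
  \<open>x\<close> and, once the outputs are in superposition, \<open>x XOR y\<close>. The gate
  \<open>R 2 1 (q b)\<close> flips this bit with a phase whose sign depends on the bit, so each edge
  contributes the relative angle \<open>pi / q b * (2 - 4 * x)\<close> between \<open>y = 1\<close>
  and \<open>y = 0\<close>. Repeating the fan-out removes \<open>y\<close> from the edge wire, which
  otherwise would stay entangled with the output and prevent interference; the wire is left with the
  negation of \<open>x\<close>.\<close>

definition stage :: "(nat \<Rightarrow> nat \<Rightarrow> nat \<Rightarrow> 'u) \<Rightarrow> nat \<Rightarrow> nat \<Rightarrow> (nat \<Rightarrow> nat \<Rightarrow> bool) \<Rightarrow> (nat \<Rightarrow> nat) \<Rightarrow>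
    (nat \<Rightarrow> nat) \<Rightarrow> (nat \<Rightarrow> nat \<Rightarrow> nat) \<Rightarrow> (nat \<Rightarrow> nat) \<Rightarrow> (nat \<Rightarrow> nat) \<Rightarrow> 'u gate list list" where
  "stage R A B edge iw ow W p q =
    [map (\<lambda>a. Fanout (iw a) (map (W a) (filter (edge a) [0..<B]))) [0..<A],
     map (\<lambda>b. One (R 4 0 1) (ow b)) [0..<B],
     map (\<lambda>b. Fanout (ow b) (map (\<lambda>a. W a b) (filter (\<lambda>a. edge a b) [0..<A]))) [0..<B],
     map (\<lambda>(a, b). One (R 2 1 (q b)) (W a b)) (edges A B edge),
     map (\<lambda>b. Fanout (ow b) (map (\<lambda>a. W a b) (filter (\<lambda>a. edge a b) [0..<A]))) [0..<B],
     map (\<lambda>b. One (R 4 (p b) (q b)) (ow b)) [0..<B]]"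

lemma set_edges: "set (edges A B edge) = {(a, b). a < A \<and> b < B \<and> edge a b}"
  by (auto simp: edges_def)

lemma distinct_concat_map:
  "distinct xs \<Longrightarrow> (\<And>x. x \<in> set xs \<Longrightarrow> distinct (h x)) \<Longrightarrow>
    (\<And>x y. x \<in> set xs \<Longrightarrow> y \<in> set xs \<Longrightarrow> x \<noteq> y \<Longrightarrow> set (h x) \<inter> set (h y) = {}) \<Longrightarrow> distinct (concat (map h xs))"
proof (induction xs)
  case (Cons x xs)
  have "set (h x) \<inter> set (h y) = {}" if "y \<in> set xs" for y
    using Cons.prems(1) that by (intro Cons.prems(3)) auto
  moreover have "distinct (concat (map h xs))"
    by (rule Cons.IH) (use Cons.prems in auto)
  ultimately show ?case using Cons.prems(2)[of x] by auto
qed simp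

lemma distinct_edges: "distinct (edges A B edge)"
  unfolding edges_def by (rule distinct_concat_map) (auto simp: distinct_map inj_on_def)

text \<open>With disjoint target sets and all controls outside of them the gates act simultaneously;
  \<open>o'\<close> leads from a target to its control.\<close>

lemma fold_ap_Fanouts:
  assumes "distinct bs" "\<And>b. b \<in> set bs \<Longrightarrow> T b \<subseteq> set (ts b) \<and> set (ts b) \<subseteq> T b"
    "\<And>b i. b \<in> set bs \<Longrightarrow> i \<in> T b \<Longrightarrow> o' i = c b"
    "\<And>b b'. b \<in> set bs \<Longrightarrow> b' \<in> set bs \<Longrightarrow> c b \<notin> T b'"
    "\<And>b b'. b \<in> set bs \<Longrightarrow> b' \<in> set bs \<Longrightarrow> b \<noteq> b' \<Longrightarrow> T b \<inter> T b' = {}"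
  shows "fold ap (map (\<lambda>b. Fanout (c b) (ts b)) bs) \<psi> = (\<lambda>f. \<psi> (fan o' (\<Union>b\<in>set bs. T b) f))"
  using assms
proof (induction bs arbitrary: \<psi>)
  case Nil
  then show ?case by (simp add: fan_def)
next
  case (Cons b bs)
  have ts: "set (ts b) = T b" using Cons.prems(2)[of b] by auto
  have "fan (\<lambda>_. c b) (T b) (fan o' (\<Union>b\<in>set bs. T b) f) = fan o' (\<Union>b\<in>set (b # bs). T b) f" for f
  proof
    fix i
    have d: "T b \<inter> T b' = {}" if "b' \<in> set bs" for b'
      using Cons.prems(1,5) that by (metis distinct.simps(2) list.set_intros)
    have n: "c b \<notin> (\<Union>b\<in>set bs. T b)" "i \<in> T b \<Longrightarrow> i \<notin> (\<Union>b\<in>set bs. T b)"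
      using Cons.prems(4)[of b] d by auto
    show "fan (\<lambda>_. c b) (T b) (fan o' (\<Union>b\<in>set bs. T b) f) i = fan o' (\<Union>b\<in>set (b # bs). T b) f i"
      using n Cons.prems(3)[of b i] by (auto simp: fan_def)
  qed
  moreover have "fold ap (map (\<lambda>b. Fanout (c b) (ts b)) bs) \<psi>' = (\<lambda>f. \<psi>' (fan o' (\<Union>b\<in>set bs. T b) f))" for \<psi>'
    by (rule Cons.IH) (use Cons.prems in auto)
  ultimately show ?case by (simp add: ts)
qed

text \<open>An off-diagonal matrix leaves one summand per gate, so the layer is a product of phases
  and a bit flip, without any sum over paths.\<close>

lemma fold_ap_off_diagonal:
  assumes "distinct (map w es)" "\<And>e. e \<in> set es \<Longrightarrow> U e $ False $ False = 0 \<and> U e $ True $ True = 0"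
  shows "fold ap (map (\<lambda>e. One (U e) (w e)) es) \<psi> =
    (\<lambda>f. (\<Prod>e\<in>set es. U e $ f (w e) $ (\<not> f (w e))) * \<psi> (flip (w ` set es) f))"
  using assms
proof (induction es arbitrary: \<psi>)
  case Nil
  then show ?case by (simp add: flip_def)
next
  case (Cons e es)
  let ?d = "\<lambda>e f. U e $ f (w e) $ (\<not> f (w e))"
  have we: "w e \<notin> w ` set es" and e: "e \<notin> set es" using Cons.prems(1) by auto
  have 1: "ap (One (U e) (w e)) \<psi> f = ?d e f * \<psi> (f(w e := \<not> f (w e)))" for f
    using Cons.prems(2)[of e] by (cases "f (w e)") (simp_all add: UNIV_bool)
  have "?d e (flip (w ` set es) f) = ?d e f" for f using we by (simp add: flip_def)
  moreover have "(flip (w ` set es) f)(w e := \<not> flip (w ` set es) f (w e)) = flip (w ` set (e # es)) f" for f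
    using we by (auto simp: flip_def fun_eq_iff)
  moreover have "fold ap (map (\<lambda>e. One (U e) (w e)) es) \<psi>' = (\<lambda>f. (\<Prod>e\<in>set es. ?d e f) * \<psi>' (flip (w ` set es) f))" for \<psi>'
    by (rule Cons.IH) (use Cons.prems in auto)
  ultimately show ?case using e by (simp add: 1 mult_ac del: ap.simps)
qed

lemma fold_invariant: "P \<psi> \<Longrightarrow> (\<And>g \<psi>. g \<in> set l \<Longrightarrow> P \<psi> \<Longrightarrow> P (ap g \<psi>)) \<Longrightarrow> P (fold ap l \<psi>)"
  by (induction l arbitrary: \<psi>) auto

section \<open>Support of a state and relative phase of a qubit\<close>

definition supported :: "((nat \<Rightarrow> bool) \<Rightarrow> bool) \<Rightarrow> ((nat \<Rightarrow> bool) \<Rightarrow> complex) \<Rightarrow> bool" where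
  "supported S \<psi> \<longleftrightarrow> (\<forall>f. \<psi> f \<noteq> 0 \<longrightarrow> S f)"

text \<open>For fixed values of the other wires, qubit \<open>v\<close> is proportional to
  \<open>|0> + \<sigma> |1>\<close>. Such statements survive gates on other wires and determine the
  outcome of the last reflection.\<close>

definition phase_ratio :: "nat \<Rightarrow> ((nat \<Rightarrow> bool) \<Rightarrow> complex) \<Rightarrow> ((nat \<Rightarrow> bool) \<Rightarrow> complex) \<Rightarrow> bool" where
  "phase_ratio v \<sigma> \<psi> \<longleftrightarrow> (\<forall>f. \<psi> (f(v := True)) = \<sigma> f * \<psi> (f(v := False)))"

lemma supported_One:
  assumes "supported S \<psi>" "\<And>f b. S (f(w := b)) = S f"
  shows "supported S (ap (One U w) \<psi>)"
  unfolding supported_def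
proof (intro allI impI)
  fix f
  assume "ap (One U w) \<psi> f \<noteq> 0"
  then have "\<psi> (f(w := False)) \<noteq> 0 \<or> \<psi> (f(w := True)) \<noteq> 0" by (auto simp: UNIV_bool)
  then obtain b where "\<psi> (f(w := b)) \<noteq> 0" by blast
  then show "S f" using assms by (auto simp: supported_def)
qed

lemma phase_ratio_One:
  assumes "phase_ratio v \<sigma> \<psi>" "w \<noteq> v" "\<And>f b. \<sigma> (f(w := b)) = \<sigma> f"
  shows "phase_ratio v \<sigma> (ap (One U w) \<psi>)"
  unfolding phase_ratio_def
proof
  fix f
  have "\<psi> (f(v := True, w := b)) = \<sigma> f * \<psi> (f(v := False, w := b))" for b
    using assms(1)[unfolded phase_ratio_def, rule_format, of "f(w := b)"] assms(2,3)
    by (simp add: fun_upd_twist)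
  then show "ap (One U w) \<psi> (f(v := True)) = \<sigma> f * ap (One U w) \<psi> (f(v := False))"
    using assms(2) by (simp add: UNIV_bool algebra_simps)
qed

lemma reflection_4:
  fixes p q :: nat
  assumes "0 < q"
  defines "\<zeta> \<equiv> pi * real p / real q"
  obtains s where "s \<noteq> 0" "reflection 4 p q $ False $ False = s" "reflection 4 p q $ False $ True = s * cis \<zeta>"
    "reflection 4 p q $ True $ False = s * cis (- \<zeta>)" "reflection 4 p q $ True $ True = - s"
proof (rule that[of "complex_of_real (cos (pi / 4))"])
  show "complex_of_real (cos (pi / 4)) \<noteq> 0" by (simp add: cos_45)
qed (use reflection_entries[OF assms(1), of 4 p] in \<open>simp_all add: \<zeta>_def cos_45 sin_45 mult.commute\<close>)

lemma phase_ratio_hadamard: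
  assumes "supported (\<lambda>f. \<not> f v) \<psi>"
  shows "phase_ratio v (\<lambda>_. 1) (ap (One (reflection 4 0 1) v) \<psi>)"
proof -
  obtain s where s: "reflection 4 0 (Suc 0) $ False $ False = s" "reflection 4 0 (Suc 0) $ True $ False = s"
    using reflection_4[of "Suc 0" 0] by force
  have 0: "\<psi> (f(v := True)) = 0" for f using assms by (auto simp: supported_def)
  show ?thesis unfolding phase_ratio_def by (simp add: UNIV_bool s 0)
qed

text \<open>Let \<open>z\<close> be the phase of the gate. Applied to
  \<open>|0> + \<sigma> |1>\<close> it gives the amplitude of 0 the factor
  \<open>1 + z * \<sigma>\<close> and that of 1 the factor \<open>1 - z * \<sigma>\<close>, so one
  of the two outcomes is excluded when \<open>z * \<sigma>\<close> is 1 or -1.\<close>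

lemma supported_reflection:
  assumes "phase_ratio v \<sigma> \<psi>" "0 < q"
  shows "supported (\<lambda>f. (cis (pi * real p / real q) * \<sigma> f = 1 \<longrightarrow> \<not> f v) \<and> (cis (pi * real p / real q) * \<sigma> f = -1 \<longrightarrow> f v))
    (ap (One (reflection 4 p q) v) \<psi>)"
  unfolding supported_def
proof (intro allI impI)
  let ?z = "cis (pi * real p / real q)" and ?z' = "cis (- (pi * real p / real q))"
  obtain s where s: "s \<noteq> 0" "reflection 4 p q $ False $ False = s" "reflection 4 p q $ False $ True = s * ?z"
    "reflection 4 p q $ True $ False = s * ?z'" "reflection 4 p q $ True $ True = - s"
    using assms(2) by (rule reflection_4)
  have z: "?z' * ?z = 1" by (simp add: cis_mult)
  fix f
  have 1: "\<psi> (f(v := True)) = \<sigma> f * \<psi> (f(v := False))" using assms(1) by (simp add: phase_ratio_def)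
  assume nz: "ap (One (reflection 4 p q) v) \<psi> f \<noteq> 0"
  show "(?z * \<sigma> f = 1 \<longrightarrow> \<not> f v) \<and> (?z * \<sigma> f = -1 \<longrightarrow> f v)"
  proof (cases "f v")
    case True
    have "ap (One (reflection 4 p q) v) \<psi> f = s * ?z' * \<psi> (f(v := False)) - s * \<psi> (f(v := True))"
      using True by (simp add: UNIV_bool s)
    also have "\<dots> = s * ?z' * \<psi> (f(v := False)) * (1 - ?z * \<sigma> f)"
      unfolding 1 using z by algebra
    finally show ?thesis using nz True by auto
  next
    case False
    have "ap (One (reflection 4 p q) v) \<psi> f = s * \<psi> (f(v := False)) + s * ?z * \<psi> (f(v := True))"
      using False by (simp add: UNIV_bool s)
    also have "\<dots> = s * \<psi> (f(v := False)) * (1 + ?z * \<sigma> f)"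
      unfolding 1 by algebra
    finally show ?thesis using nz False by auto
  qed
qed

lemma cis_eq_1: "x = 2 * pi * of_int k \<Longrightarrow> cis x = 1"
  by (simp add: cis_multiple_2pi)

lemma cis_eq_minus_1: "x = 2 * pi * of_int k + pi \<Longrightarrow> cis x = -1"
  using cis_mult[of "2 * pi * of_int k" pi] by (simp add: cis_multiple_2pi)

section \<open>Effect of the rotation gadget\<close>

locale gadget =
  fixes A B :: nat and edge :: "nat \<Rightarrow> nat \<Rightarrow> bool" and iw ow :: "nat \<Rightarrow> nat" and W :: "nat \<Rightarrow> nat \<Rightarrow> nat"
    and p q :: "nat \<Rightarrow> nat"
  assumes W_inj: "a < A \<Longrightarrow> b < B \<Longrightarrow> a' < A \<Longrightarrow> b' < B \<Longrightarrow> W a b = W a' b' \<longleftrightarrow> a = a' \<and> b = b'"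
    and W_iw: "a < A \<Longrightarrow> b < B \<Longrightarrow> a' < A \<Longrightarrow> W a b \<noteq> iw a'"
    and W_ow: "a < A \<Longrightarrow> b < B \<Longrightarrow> b' < B \<Longrightarrow> W a b \<noteq> ow b'"
    and iw_ow: "a < A \<Longrightarrow> b < B \<Longrightarrow> iw a \<noteq> ow b"
    and iw_inj: "inj_on iw {..<A}"
    and ow_inj: "inj_on ow {..<B}"
    and q_pos: "b < B \<Longrightarrow> 0 < q b"
begin

definition E where "E = {(a, b). a < A \<and> b < B \<and> edge a b}"

definition Ew where "Ew = (\<lambda>(a, b). W a b) ` E"

definition deg where "deg b = card {a. a < A \<and> edge a b}"

definition weight where "weight b f = card {a. a < A \<and> edge a b \<and> f (iw a)}"

lemma finite_E: "finite E"
  by (rule finite_subset[of _ "{..<A} \<times> {..<B}"]) (auto simp: E_def)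

lemma iw_W: "a < A \<Longrightarrow> b < B \<Longrightarrow> a' < A \<Longrightarrow> iw a' \<noteq> W a b"
  using W_iw by metis

lemma ow_W: "a < A \<Longrightarrow> b < B \<Longrightarrow> b' < B \<Longrightarrow> ow b' \<noteq> W a b"
  using W_ow by metis

lemma wf_stage:
  fixes R :: "nat \<Rightarrow> nat \<Rightarrow> nat \<Rightarrow> 'u"
  assumes "l \<in> set (stage R A B edge iw ow W p q)"
  shows "distinct (concat (map gate_qubits l))"
proof -
  have 1: "distinct (concat (map (\<lambda>a. iw a # map (W a) (filter (edge a) [0..<B])) [0..<A]))"
  proof (rule distinct_concat_map)
    fix a assume "a \<in> set [0..<A]"
    then show "distinct (iw a # map (W a) (filter (edge a) [0..<B]))"
      by (auto simp: distinct_map inj_on_def W_inj iw_W)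
  next
    fix a a' assume "a \<in> set [0..<A]" "a' \<in> set [0..<A]" "a \<noteq> a'"
    then show "set (iw a # map (W a) (filter (edge a) [0..<B])) \<inter> set (iw a' # map (W a') (filter (edge a') [0..<B])) = {}"
      using inj_onD[OF iw_inj, of a a'] by (auto simp: W_inj iw_W W_iw)
  qed simp
  have 2: "distinct (map ow [0..<B])"
    using ow_inj by (simp add: distinct_map lessThan_atLeast0)
  have 3: "distinct (concat (map (\<lambda>b. ow b # map (\<lambda>a. W a b) (filter (\<lambda>a. edge a b) [0..<A])) [0..<B]))"
  proof (rule distinct_concat_map)
    fix b assume "b \<in> set [0..<B]"
    then show "distinct (ow b # map (\<lambda>a. W a b) (filter (\<lambda>a. edge a b) [0..<A]))"
      by (auto simp: distinct_map inj_on_def W_inj ow_W)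
  next
    fix b b' assume "b \<in> set [0..<B]" "b' \<in> set [0..<B]" "b \<noteq> b'"
    then show "set (ow b # map (\<lambda>a. W a b) (filter (\<lambda>a. edge a b) [0..<A])) \<inter>
        set (ow b' # map (\<lambda>a. W a b') (filter (\<lambda>a. edge a b') [0..<A])) = {}"
      using inj_onD[OF ow_inj, of b b'] by (auto simp: W_inj ow_W W_ow)
  qed simp
  have 4: "distinct (map (\<lambda>(a, b). W a b) (edges A B edge))"
    using distinct_edges by (auto simp: distinct_map inj_on_def set_edges W_inj)
  have s: "concat (map gate_qubits (map (\<lambda>b. One (R' b) (w b)) bs)) = map w bs" for R' w and bs :: "'z list"
    by (induction bs) auto
  have s': "concat (map gate_qubits (map (\<lambda>(a, b). One (R' b) (W a b)) bs)) = map (\<lambda>(a, b). W a b) bs" for R' bs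
    by (induction bs) auto
  let ?D = "\<lambda>l :: 'u gate list. distinct (concat (map gate_qubits l))"
  have c: "?D (map (\<lambda>a. Fanout (iw a) (map (W a) (filter (edge a) [0..<B]))) [0..<A])"
    "?D (map (\<lambda>b. Fanout (ow b) (map (\<lambda>a. W a b) (filter (\<lambda>a. edge a b) [0..<A]))) [0..<B])"
    using 1 3 by (simp_all add: comp_def)
  have c': "?D (map (\<lambda>b. One (R' b) (ow b)) [0..<B])" for R'
    unfolding s by (rule 2)
  have c'': "?D (map (\<lambda>(a, b). One (R' b) (W a b)) (edges A B edge))" for R'
    unfolding s' by (rule 4)
  have "list_all ?D (stage R A B edge iw ow W p q)"
    unfolding stage_def list.pred_inject(2) by (intro conjI c c' c'') simp
  then show ?thesis using assms by (simp add: list_all_iff)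
qed

lemma stage_involutive:
  assumes "l \<in> set (stage reflection A B edge iw ow W p q)" "g \<in> set l"
  shows "involutive g"
  using assms by (auto simp: stage_def reflection_involutive set_edges iw_W ow_W q_pos)

text \<open>The edges turn output \<open>b\<close> by
  \<open>pi / q b * (2 * deg b - 4 * weight b f)\<close>, and the last layer adds
  \<open>pi * p b / q b\<close>. An even multiple of pi yields 0, an odd one yields 1; for other
  angles nothing is claimed. \<open>G\<close> carries along what is known about wires that the stage
  does not write.\<close>

theorem stage_support:
  assumes supp: "supported (\<lambda>f. G f \<and> (\<forall>(a, b)\<in>E. \<not> f (W a b)) \<and> (\<forall>b<B. \<not> f (ow b))) \<psi>"
    and G: "\<And>f f'. (\<And>i. i \<notin> Ew \<Longrightarrow> i \<notin> ow ` {..<B} \<Longrightarrow> f i = f' i) \<Longrightarrow> G f = G f'"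
  shows "supported (\<lambda>f. G f \<and> (\<forall>b<B.
       (\<forall>k. int (p b) + 2 * int (deg b) - 4 * int (weight b f) = 2 * int (q b) * k \<longrightarrow> \<not> f (ow b)) \<and>
       (\<forall>k. int (p b) + 2 * int (deg b) - 4 * int (weight b f) = 2 * int (q b) * k + int (q b) \<longrightarrow> f (ow b))))
     (fold (fold ap) (stage reflection A B edge iw ow W p q) \<psi>)"
proof -
  have "inj_on (\<lambda>(a, b). W a b) E" using W_inj by (auto simp: inj_on_def E_def)
  \<comment> \<open>\<open>dec\<close> recovers the edge from its wire, so that \<open>oi\<close>
    and \<open>ou\<close> can serve as control functions of the fan-out layers.\<close>
  then obtain dec where dec: "\<And>a b. (a, b) \<in> E \<Longrightarrow> dec (W a b) = (a, b)"
    using the_inv_into_f_f by (metis (mono_tags, lifting) case_prod_conv)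
  define oi where "oi = iw \<circ> fst \<circ> dec"
  define ou where "ou = ow \<circ> snd \<circ> dec"
  have oi: "oi (W a b) = iw a" and ou: "ou (W a b) = ow b" if "(a, b) \<in> E" for a b
    using that by (simp_all add: oi_def ou_def dec)
  have Ew_iw: "iw a \<notin> Ew" if "a < A" for a using W_iw that by (fastforce simp: Ew_def E_def)
  have Ew_ow: "ow b \<notin> Ew" if "b < B" for b using W_ow that by (fastforce simp: Ew_def E_def)
  have Ew: "W a b \<in> Ew" if "(a, b) \<in> E" for a b using that by (auto simp: Ew_def)

  let ?l1 = "map (\<lambda>a. Fanout (iw a) (map (W a) (filter (edge a) [0..<B]))) [0..<A]"
  let ?l2 = "map (\<lambda>b. One (reflection 4 0 1) (ow b)) [0..<B]"
  let ?l3 = "map (\<lambda>b. Fanout (ow b) (map (\<lambda>a. W a b) (filter (\<lambda>a. edge a b) [0..<A]))) [0..<B]"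
  let ?l4 = "map (\<lambda>(a, b). One (reflection 2 1 (q b)) (W a b)) (edges A B edge)"
  let ?l6 = "map (\<lambda>b. One (reflection 4 (p b) (q b)) (ow b)) [0..<B]"
  define \<psi>1 where "\<psi>1 = fold ap ?l1 \<psi>"
  define \<psi>2 where "\<psi>2 = fold ap ?l2 \<psi>1"
  define \<psi>5 where "\<psi>5 = fold ap ?l3 (fold ap ?l4 (fold ap ?l3 \<psi>2))"

  have U1: "(\<Union>a\<in>set [0..<A]. {W a b |b. (a, b) \<in> E}) = Ew" by (auto simp: Ew_def E_def)
  have l1: "fold ap ?l1 \<psi>' = (\<lambda>f. \<psi>' (fan oi Ew f))" for \<psi>'
    unfolding U1[symmetric]
  proof (rule fold_ap_Fanouts)
    fix a a' assume "a \<in> set [0..<A]" "a' \<in> set [0..<A]"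
    then show "iw a \<notin> {W a' b |b. (a', b) \<in> E}" using Ew_iw[of a] by (auto simp: Ew_def)
  next
    fix a a' assume "a \<in> set [0..<A]" "a' \<in> set [0..<A]" "a \<noteq> a'"
    then show "{W a b |b. (a, b) \<in> E} \<inter> {W a' b |b. (a', b) \<in> E} = {}"
      using W_inj by (auto simp: E_def)
  qed (auto simp: oi, auto simp: E_def)
  have U3: "(\<Union>b\<in>set [0..<B]. {W a b |a. (a, b) \<in> E}) = Ew" by (auto simp: Ew_def E_def)
  have l3: "fold ap ?l3 \<psi>' = (\<lambda>f. \<psi>' (fan ou Ew f))" for \<psi>'
    unfolding U3[symmetric]
  proof (rule fold_ap_Fanouts)
    fix b b' assume "b \<in> set [0..<B]" "b' \<in> set [0..<B]"
    then show "ow b \<notin> {W a b' |a. (a, b') \<in> E}" using Ew_ow[of b] by (auto simp: Ew_def)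
  next
    fix b b' assume "b \<in> set [0..<B]" "b' \<in> set [0..<B]" "b \<noteq> b'"
    then show "{W a b |a. (a, b) \<in> E} \<inter> {W a b' |a. (a, b') \<in> E} = {}"
      using W_inj by (auto simp: E_def)
  qed (auto simp: ou, auto simp: E_def)
  define z where "z b = pi / real (q b)" for b
  define d where "d = (\<lambda>(a, b) f. cis (if f (W a b) then - z b else z b))"
  have l4: "fold ap ?l4 \<psi>' = (\<lambda>f. (\<Prod>e\<in>E. d e f) * \<psi>' (flip Ew f))" for \<psi>'
  proof -
    have s: "set (edges A B edge) = E" by (simp add: set_edges E_def)
    have eq: "?l4 = map (\<lambda>e. One (reflection 2 1 (q (snd e))) (case e of (a, b) \<Rightarrow> W a b)) (edges A B edge)"
      by (simp add: case_prod_beta)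
    have "fold ap ?l4 \<psi>' = (\<lambda>f. (\<Prod>e\<in>E. reflection 2 1 (q (snd e)) $ f (case e of (a, b) \<Rightarrow> W a b) $ (\<not> f (case e of (a, b) \<Rightarrow> W a b))) * \<psi>' (flip Ew f))"
      unfolding eq Ew_def s[symmetric]
    proof (rule fold_ap_off_diagonal)
      show "distinct (map (\<lambda>(a, b). W a b) (edges A B edge))"
        using W_inj distinct_edges by (auto simp: distinct_map inj_on_def set_edges)
      fix e assume "e \<in> set (edges A B edge)"
      then have "0 < q (snd e)" using q_pos by (auto simp: set_edges)
      then show "reflection 2 1 (q (snd e)) $ False $ False = 0 \<and> reflection 2 1 (q (snd e)) $ True $ True = 0"
        by (simp add: reflection_entries)
    qed
    moreover have "(\<Prod>e\<in>E. reflection 2 1 (q (snd e)) $ f (case e of (a, b) \<Rightarrow> W a b) $ (\<not> f (case e of (a, b) \<Rightarrow> W a b)))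
        = (\<Prod>e\<in>E. d e f)" for f
    proof (rule prod.cong[OF refl])
      fix e assume "e \<in> E"
      then obtain a b where e: "e = (a, b)" "0 < q b" using q_pos by (auto simp: E_def)
      show "reflection 2 1 (q (snd e)) $ f (case e of (a, b) \<Rightarrow> W a b) $ (\<not> f (case e of (a, b) \<Rightarrow> W a b)) = d e f"
        using reflection_entries[OF e(2), of 2 1] by (cases "f (W a b)") (simp_all add: e(1) d_def z_def)
    qed
    ultimately show ?thesis by simp
  qed

  define copied where "copied f \<longleftrightarrow> G f \<and> (\<forall>(a, b)\<in>E. f (W a b) = f (iw a))" for f
  have copied_ow: "copied (f(ow b := x)) = copied f" if "b < B" for f b x
  proof -
    have "G (f(ow b := x)) = G f" by (rule G) (use that in auto)
    moreover have "W a b' \<noteq> ow b" "iw a \<noteq> ow b" if "(a, b') \<in> E" for a b'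
      using that \<open>b < B\<close> W_ow iw_ow by (auto simp: E_def)
    ultimately show ?thesis by (auto simp: copied_def)
  qed
  have s1: "supported (\<lambda>f. copied f \<and> (\<forall>b<B. \<not> f (ow b))) \<psi>1"
    unfolding supported_def
  proof (intro allI impI)
    fix f assume "\<psi>1 f \<noteq> 0"
    then have h: "G (fan oi Ew f)" "\<forall>(a, b)\<in>E. \<not> fan oi Ew f (W a b)" "\<forall>b<B. \<not> fan oi Ew f (ow b)"
      using supp by (auto simp: \<psi>1_def l1 supported_def)
    have "G f" using h(1) G[of "fan oi Ew f" f] by (simp add: fan_def)
    moreover have "f (W a b) = f (iw a)" if "(a, b) \<in> E" for a b
      using h(2) that Ew[OF that] oi[OF that] by (auto simp: fan_def)
    moreover have "\<not> f (ow b)" if "b < B" for b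
      using h(3) that Ew_ow[OF that] by (auto simp: fan_def)
    ultimately show "copied f \<and> (\<forall>b<B. \<not> f (ow b))" by (auto simp: copied_def)
  qed
  have s2: "supported copied \<psi>2"
    unfolding \<psi>2_def
  proof (rule fold_invariant[where P = "supported copied"])
    show "supported copied \<psi>1" using s1 by (simp add: supported_def)
    fix g \<psi> assume "g \<in> set ?l2" "supported copied \<psi>"
    then show "supported copied (ap g \<psi>)"
      by (auto simp del: ap.simps intro!: supported_One simp: copied_ow)
  qed
  \<comment> \<open>The layer is cut at the gate on \<open>ow b\<close>; all gates before and after
    it act on other wires and preserve the invariant.\<close>
  have split: "[0..<B] = [0..<b] @ b # [Suc b..<B]" if "b < B" for b
    using that upt_add_eq_append[of 0 b "B - b"] by (simp add: upt_conv_Cons)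
  have ow_neq: "ow b \<noteq> ow b'" if "b < B" "b' < B" "b \<noteq> b'" for b b'
    using that ow_inj by (auto simp: inj_on_def)
  have r2: "phase_ratio (ow b) (\<lambda>_. 1) \<psi>2" if b: "b < B" for b
  proof -
    let ?l = "\<lambda>bs. map (\<lambda>b. One (reflection 4 0 1) (ow b)) bs"
    have "supported (\<lambda>f. \<not> f (ow b)) (fold ap (?l [0..<b]) \<psi>1)"
    proof (rule fold_invariant[where P = "supported (\<lambda>f. \<not> f (ow b))"])
      show "supported (\<lambda>f. \<not> f (ow b)) \<psi>1" using s1 b unfolding supported_def by blast
      fix g \<psi> assume "g \<in> set (?l [0..<b])" "supported (\<lambda>f. \<not> f (ow b)) \<psi>"
      then show "supported (\<lambda>f. \<not> f (ow b)) (ap g \<psi>)"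
        using ow_neq b by (auto simp del: ap.simps intro!: supported_One)
    qed
    then have "phase_ratio (ow b) (\<lambda>_. 1) (ap (One (reflection 4 0 1) (ow b)) (fold ap (?l [0..<b]) \<psi>1))"
      by (rule phase_ratio_hadamard)
    then have "phase_ratio (ow b) (\<lambda>_. 1) (fold ap (?l [Suc b..<B]) (ap (One (reflection 4 0 1) (ow b)) (fold ap (?l [0..<b]) \<psi>1)))"
    proof (rule fold_invariant)
      fix g \<psi> assume "g \<in> set (?l [Suc b..<B])" "phase_ratio (ow b) (\<lambda>_. 1) \<psi>"
      then show "phase_ratio (ow b) (\<lambda>_. 1) (ap g \<psi>)"
        using ow_neq b by (auto simp del: ap.simps intro!: phase_ratio_One)
    qed
    then show ?thesis unfolding \<psi>2_def split[OF b] by (simp del: ap.simps)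
  qed

  \<comment> \<open>The controls lie outside the edge wires, so the two fan-outs around the flip
    cancel; only the phases see the bits shifted by the outputs.\<close>
  have \<psi>5: "\<psi>5 f = (\<Prod>e\<in>E. d e (fan ou Ew f)) * \<psi>2 (flip Ew f)" for f
  proof -
    have "fan ou Ew (flip Ew (fan ou Ew f)) = flip Ew f"
    proof
      fix i
      show "fan ou Ew (flip Ew (fan ou Ew f)) i = flip Ew f i"
      proof (cases "i \<in> Ew")
        case True
        then obtain a b where "i = W a b" "(a, b) \<in> E" by (auto simp: Ew_def)
        then have "ou i \<notin> Ew" using ou Ew_ow[of b] by (auto simp: E_def)
        then show ?thesis using True by (auto simp: fan_def flip_def)
      qed (simp add: fan_def flip_def)
    qed
    then show ?thesis unfolding \<psi>5_def l3 l4 by simp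
  qed
  have flip_copied: "G f \<and> (\<forall>(a, b)\<in>E. f (W a b) \<noteq> f (iw a))" if "\<psi>2 (flip Ew f) \<noteq> 0" for f
  proof -
    have c: "copied (flip Ew f)" using s2 that by (simp add: supported_def)
    have "G (flip Ew f) = G f" by (rule G) (simp add: flip_def)
    moreover have "flip Ew f (W a b) = (\<not> f (W a b))" "flip Ew f (iw a) = f (iw a)" if "(a, b) \<in> E" for a b
      using Ew[OF that] Ew_iw[of a] that by (auto simp: flip_def E_def)
    ultimately show ?thesis using c by (auto simp: copied_def)
  qed
  have s5: "supported G \<psi>5" unfolding supported_def using flip_copied by (auto simp: \<psi>5)

  define \<sigma> where "\<sigma> b f = cis (z b * (2 * real (deg b) - 4 * real (weight b f)))" for b f
  have weight_ow: "weight b (f(ow b' := x)) = weight b f" if "b' < B" for b b' f x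
  proof -
    have "{a. a < A \<and> edge a b \<and> (f(ow b' := x)) (iw a)} = {a. a < A \<and> edge a b \<and> f (iw a)}"
      using iw_ow that by auto
    then show ?thesis by (simp add: weight_def)
  qed
  have r5: "phase_ratio (ow b) (\<sigma> b) \<psi>5" if b: "b < B" for b
    unfolding phase_ratio_def
  proof
    fix f :: "nat \<Rightarrow> bool"
    let ?f = "\<lambda>x. f(ow b := x)"
    have fl: "flip Ew (?f x) = (flip Ew f)(ow b := x)" for x
      using Ew_ow[OF b] by (auto simp: flip_def fun_eq_iff)
    have eq: "\<psi>2 (flip Ew (?f True)) = \<psi>2 (flip Ew (?f False))"
      using r2[OF b] by (simp add: phase_ratio_def fl)
    show "\<psi>5 (?f True) = \<sigma> b f * \<psi>5 (?f False)"
    proof (cases "\<psi>2 (flip Ew (?f False)) = 0")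
      case False
      have ne: "f (W a b') \<noteq> f (iw a)" if "(a, b') \<in> E" for a b'
      proof -
        have "?f False (W a b') \<noteq> ?f False (iw a)" using flip_copied[OF False] that by blast
        then show ?thesis using that b W_ow[of a b' b] iw_ow[of a b] by (auto simp: E_def)
      qed
      \<comment> \<open>Setting output \<open>b\<close> negates the bit on the edge wire and
        exchanges the angles \<open>z b\<close> and \<open>- z b\<close>. The ratio is
        \<open>cis (- 2 * z b)\<close> if the input is one and \<open>cis (2 * z b)\<close> if it is
        zero.\<close>
      let ?c = "\<lambda>(a, b'). if b' = b then cis (z b * (2 - 4 * of_bool (f (iw a)))) else 1"
      have "d e (fan ou Ew (?f True)) = ?c e * d e (fan ou Ew (?f False))" if e: "e \<in> E" for e
      proof -
        obtain a b' where ab: "e = (a, b')" by (cases e)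
        have E: "(a, b') \<in> E" using e ab by simp
        have v: "fan ou Ew (?f x) (W a b') = (f (W a b') \<noteq> (if b' = b then x else f (ow b')))" for x
          using Ew[OF E] ou[OF E] E b W_ow[of a b' b] ow_neq[of b b'] by (auto simp: fan_def E_def)
        have "cis (z b) = cis (z b * 2) * cis (- z b)" "cis (- z b) = cis (z b * (2 - 4)) * cis (z b)"
          unfolding cis_mult by (simp_all add: algebra_simps)
        then show ?thesis
          using ne[OF E] by (auto simp: ab d_def v)
      qed
      then have "(\<Prod>e\<in>E. d e (fan ou Ew (?f True))) = (\<Prod>e\<in>E. ?c e) * (\<Prod>e\<in>E. d e (fan ou Ew (?f False)))"
        by (simp add: prod.distrib)
      moreover have "(\<Prod>e\<in>E. ?c e) = \<sigma> b f"
      proof -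
        let ?A = "{a. a < A \<and> edge a b}"
        have "(\<Prod>e\<in>E. ?c e) = (\<Prod>e\<in>(\<lambda>a. (a, b)) ` ?A. ?c e)"
          using b finite_E by (intro prod.mono_neutral_right) (auto simp: E_def)
        also have "\<dots> = (\<Prod>a\<in>?A. cis (z b * (2 - 4 * of_bool (f (iw a)))))"
          by (subst prod.reindex) (auto simp: inj_on_def)
        also have "\<dots> = cis (\<Sum>a\<in>?A. z b * (2 - 4 * of_bool (f (iw a))))"
          by (induction rule: infinite_finite_induct) (auto simp: cis_mult)
        also have "(\<Sum>a\<in>?A. z b * (2 - 4 * of_bool (f (iw a)))) = z b * (2 * real (deg b) - 4 * real (weight b f))"
        proof -
          have "{a \<in> ?A. f (iw a)} = {a. a < A \<and> edge a b \<and> f (iw a)}" by auto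
          then have "(\<Sum>a\<in>?A. of_bool (f (iw a))) = real (weight b f)"
            by (simp add: weight_def of_bool_def sum.If_cases Int_def)
          then show ?thesis
            by (simp add: deg_def sum_subtractf flip: sum_distrib_left)
        qed
        finally show ?thesis by (simp add: \<sigma>_def)
      qed
      ultimately show ?thesis by (simp add: \<psi>5 eq)
    qed (simp add: \<psi>5 eq)
  qed

  let ?S = "\<lambda>b f. (cis (pi * real (p b) / real (q b)) * \<sigma> b f = 1 \<longrightarrow> \<not> f (ow b)) \<and>
      (cis (pi * real (p b) / real (q b)) * \<sigma> b f = -1 \<longrightarrow> f (ow b))"
  have s6: "supported G (fold ap ?l6 \<psi>5)"
  proof (rule fold_invariant[where P = "supported G", OF s5])
    have "G (f(ow b := x)) = G f" if "b < B" for b f x by (rule G) (use that in auto)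
    moreover fix g \<psi> assume "g \<in> set ?l6" "supported G \<psi>"
    ultimately show "supported G (ap g \<psi>)"
      by (auto simp del: ap.simps intro!: supported_One)
  qed
  have t6: "supported (?S b) (fold ap ?l6 \<psi>5)" if b: "b < B" for b
  proof -
    let ?l = "\<lambda>bs. map (\<lambda>b. One (reflection 4 (p b) (q b)) (ow b)) bs"
    have \<sigma>: "\<sigma> b (f(ow b' := x)) = \<sigma> b f" if "b' < B" for b' f x
      using weight_ow[OF that] by (simp add: \<sigma>_def)
    have "phase_ratio (ow b) (\<sigma> b) (fold ap (?l [0..<b]) \<psi>5)"
    proof (rule fold_invariant[where P = "phase_ratio (ow b) (\<sigma> b)", OF r5[OF b]])
      fix g \<psi> assume "g \<in> set (?l [0..<b])" "phase_ratio (ow b) (\<sigma> b) \<psi>"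
      then show "phase_ratio (ow b) (\<sigma> b) (ap g \<psi>)"
        using ow_neq b \<sigma> by (auto simp del: ap.simps intro!: phase_ratio_One)
    qed
    then have "supported (?S b) (ap (One (reflection 4 (p b) (q b)) (ow b)) (fold ap (?l [0..<b]) \<psi>5))"
      using q_pos[OF b] by (rule supported_reflection)
    then have "supported (?S b) (fold ap (?l [Suc b..<B]) (ap (One (reflection 4 (p b) (q b)) (ow b)) (fold ap (?l [0..<b]) \<psi>5)))"
    proof (rule fold_invariant)
      fix g \<psi> assume g: "g \<in> set (?l [Suc b..<B])" and s: "supported (?S b) \<psi>"
      then obtain b' where b': "g = One (reflection 4 (p b') (q b')) (ow b')" "b' < B" "b' \<noteq> b" by auto
      show "supported (?S b) (ap g \<psi>)"
        unfolding b'(1) by (rule supported_One[OF s]) (use b' b ow_neq[of b b'] \<sigma> in simp)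
    qed
    then show ?thesis unfolding split[OF b] by (simp del: ap.simps)
  qed
  have ang: "cis (pi * real (p b) / real (q b)) * \<sigma> b f =
      cis (pi * of_int (int (p b) + 2 * int (deg b) - 4 * int (weight b f)) / real (q b))" for b f
    by (simp add: \<sigma>_def cis_mult z_def add_divide_distrib diff_divide_distrib ring_distribs add_diff_eq)
  have fin: "fold (fold ap) (stage reflection A B edge iw ow W p q) \<psi> = fold ap ?l6 \<psi>5"
    by (simp add: stage_def \<psi>5_def \<psi>2_def \<psi>1_def)
  show ?thesis
    unfolding supported_def
  proof (intro allI impI conjI)
    fix f assume nz: "fold (fold ap) (stage reflection A B edge iw ow W p q) \<psi> f \<noteq> 0"
    then show "G f" using s6 unfolding fin supported_def by blast
    fix b assume b: "b < B"
    have S: "?S b f" using t6[OF b] nz unfolding fin supported_def by blast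
    {
      fix k assume k: "int (p b) + 2 * int (deg b) - 4 * int (weight b f) = 2 * int (q b) * k"
      have "cis (pi * real (p b) / real (q b)) * \<sigma> b f = 1"
        unfolding ang k using q_pos[OF b] by (intro cis_eq_1[of _ k]) simp
      then show "\<not> f (ow b)" using S by blast
    next
      fix k assume k: "int (p b) + 2 * int (deg b) - 4 * int (weight b f) = 2 * int (q b) * k + int (q b)"
      have "cis (pi * real (p b) / real (q b)) * \<sigma> b f = -1"
        unfolding ang k using q_pos[OF b] by (intro cis_eq_minus_1[of _ k]) (simp add: field_simps)
      then show "f (ow b)" using S by blast
    }
  qed
qed

end

section \<open>The circuit for the exact gate\<close>

definition pow2 :: "nat \<Rightarrow> bool" where
  "pow2 n \<longleftrightarrow> (\<exists>k. n = 2 ^ k)"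

text \<open>With \<open>m\<close> powers of two up to \<open>n + 1\<close> this is
  \<open>2 ^ m\<close>, the number of sets of qubits. The sum makes it computable with
  counters.\<close>

definition parities :: "nat \<Rightarrow> nat" where
  "parities n = 1 + (\<Sum>c<n + 1. if pow2 (c + 1) then c + 1 else 0)"

lemma pow2_bij: "\<exists>m>0. bij_betw (\<lambda>k. 2 ^ k - 1) {..<m} {c. c < n + 1 \<and> pow2 (c + 1)} \<and> 2 ^ (m - 1) \<le> n + 1 \<and> n + 1 < 2 ^ m"
proof -
  define m where "m = (LEAST m. n + 1 < (2::nat) ^ m)"
  have m: "n + 1 < 2 ^ m"
    unfolding m_def by (rule LeastI[of _ "n + 1"]) (rule less_exp)
  have le: "2 ^ k \<le> n + 1" if "k < m" for k
    using not_less_Least[of k "\<lambda>m. n + 1 < 2 ^ m"] that by (simp add: m_def)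
  have lt: "k < m" if "2 ^ k \<le> n + 1" for k
  proof -
    have "(2::nat) ^ k < 2 ^ m" using that m by linarith
    then show ?thesis by simp
  qed
  have "m \<noteq> 0" using m by (cases m) auto
  moreover have "bij_betw (\<lambda>k. 2 ^ k - 1) {..<m} {c. c < n + 1 \<and> pow2 (c + 1)}"
    unfolding bij_betw_def
  proof
    show "inj_on (\<lambda>k. (2::nat) ^ k - 1) {..<m}"
    proof (rule inj_onI)
      fix j k assume "(2::nat) ^ j - 1 = 2 ^ k - 1"
      moreover have "0 < (2::nat) ^ j" "0 < (2::nat) ^ k" by simp_all
      ultimately have "(2::nat) ^ j = 2 ^ k" by linarith
      then show "j = k" by simp
    qed
    show "(\<lambda>k. 2 ^ k - 1) ` {..<m} = {c. c < n + 1 \<and> pow2 (c + 1)}"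
    proof (intro equalityI subsetI)
      fix c :: nat assume "c \<in> (\<lambda>k. 2 ^ k - 1) ` {..<m}"
      then obtain k where k: "k < m" "c = 2 ^ k - 1" by auto
      then have "c + 1 = 2 ^ k" by simp
      then show "c \<in> {c. c < n + 1 \<and> pow2 (c + 1)}" using le[OF k(1)] by (auto simp: pow2_def)
    next
      fix c :: nat assume "c \<in> {c. c < n + 1 \<and> pow2 (c + 1)}"
      then obtain k where "c + 1 = 2 ^ k" "c < n + 1" by (auto simp: pow2_def)
      then have "k < m" "c = 2 ^ k - 1" by (auto intro!: lt)
      then show "c \<in> (\<lambda>k. 2 ^ k - 1) ` {..<m}" by blast
    qed
  qed
  ultimately show ?thesis using m le[of "m - 1"] by auto
qed

lemma parities_power:
  obtains m where "0 < m" "parities n = 2 ^ m" "2 ^ (m - 1) \<le> n + 1" "n + 1 < 2 ^ m"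
    "card {c. c < n + 1 \<and> pow2 (c + 1)} = m" "\<And>k. 2 ^ k \<le> n + 1 \<Longrightarrow> k < m"
proof -
  obtain m where m: "0 < m" "bij_betw (\<lambda>k. 2 ^ k - 1) {..<m} {c. c < n + 1 \<and> pow2 (c + 1)}"
    "2 ^ (m - 1) \<le> n + 1" "n + 1 < 2 ^ m"
    using pow2_bij by blast
  have "(\<Sum>c<n + 1. if pow2 (c + 1) then c + 1 else 0) = (\<Sum>c\<in>{c. c < n + 1 \<and> pow2 (c + 1)}. c + 1)"
  proof -
    have "{..<n + 1} \<inter> {c. pow2 (c + 1)} = {c. c < n + 1 \<and> pow2 (c + 1)}" by auto
    then show ?thesis by (subst sum.If_cases) simp_all
  qed
  also have "\<dots> = (\<Sum>k<m. 2 ^ k - 1 + 1)"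
    by (rule sum.reindex_bij_betw[OF m(2), symmetric])
  also have "\<dots> = (\<Sum>k<m. 2 ^ k)" by simp
  finally have "parities n = 1 + (\<Sum>k<m. 2 ^ k)" by (simp add: parities_def)
  then have "parities n = 2 ^ m" using sum_power2[of m] by (simp add: lessThan_atLeast0)
  moreover have "k < m" if "2 ^ k \<le> n + 1" for k
  proof -
    have "(2::nat) ^ k < 2 ^ m" using that m(4) by linarith
    then show ?thesis by simp
  qed
  moreover have "card {c. c < n + 1 \<and> pow2 (c + 1)} = m"
    using bij_betw_same_card[OF m(2)] by simp
  ultimately show thesis using m(1,3,4) by (intro that) blast+
qed

lemma parities_le: "parities n \<le> 2 * n + 2" and parities_even: "2 dvd parities n"
proof -
  obtain m where m: "0 < m" "parities n = 2 ^ m" "2 ^ (m - 1) \<le> n + 1" by (rule parities_power[of n]) blast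
  then have "parities n = 2 * 2 ^ (m - 1)" by (cases m) auto
  then show "parities n \<le> 2 * n + 2" "2 dvd parities n" using m(3) by auto
qed

subsection \<open>Parities of a nonzero vector\<close>

text \<open>\<open>s\<close> encodes a set of qubits: for \<open>a + 1 = 2 ^ j\<close> the condition
  \<open>odd (s div (a + 1))\<close> says that bit \<open>j\<close> of \<open>s\<close> is
  set.\<close>

definition parity_weight :: "nat \<Rightarrow> (nat \<Rightarrow> bool) \<Rightarrow> nat \<Rightarrow> nat" where
  "parity_weight n y s = card {a. a < n + 1 \<and> (pow2 (a + 1) \<and> odd (s div (a + 1))) \<and> y a}"

text \<open>Flipping the bit of \<open>s\<close> that selects a qubit with value one changes the
  parity, hence pairs odd selections with even ones.\<close>

lemma card_odd_parities:
  assumes "a < n + 1" "pow2 (a + 1)" "y a"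
  shows "2 * card {s. s < parities n \<and> odd (parity_weight n y s)} = parities n"
proof -
  obtain m where m: "parities n = 2 ^ m" "\<And>k. 2 ^ k \<le> n + 1 \<Longrightarrow> k < m"
    by (rule parities_power[of n]) blast
  obtain k where k: "a + 1 = 2 ^ k" using assms(2) by (auto simp: pow2_def)
  have "k < m" by (rule m(2)) (use k assms(1) in linarith)
  let ?X = "\<lambda>s. {a. a < n + 1 \<and> (pow2 (a + 1) \<and> odd (s div (a + 1))) \<and> y a}"
  have lt: "flip_bit k s < 2 ^ m" if "s < 2 ^ m" for s :: nat
  proof -
    have "take_bit m (flip_bit k s) = flip_bit k s"
      using that \<open>k < m\<close> by (simp add: take_bit_flip_bit_eq take_bit_nat_eq_self)
    then show ?thesis by (simp add: take_bit_nat_eq_self_iff)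
  qed
  have fb: "odd (flip_bit k s div 2 ^ j) \<longleftrightarrow> odd (s div 2 ^ j) \<noteq> (j = k)" for s j :: nat
    unfolding bit_iff_odd[symmetric] by (auto simp: bit_flip_bit_iff)
  have odd: "odd (parity_weight n y (flip_bit k s)) \<longleftrightarrow> even (parity_weight n y s)" for s
  proof -
    have mem: "b \<in> ?X (flip_bit k s) \<longleftrightarrow> b \<in> ?X s" if "b \<noteq> a" for b
    proof (cases "pow2 (b + 1)")
      case True
      then obtain j where j: "b + 1 = 2 ^ j" by (auto simp: pow2_def)
      then have "j \<noteq> k" using that k by auto
      then have "odd (flip_bit k s div (b + 1)) = odd (s div (b + 1))"
        unfolding j fb by simp
      then show ?thesis by simp
    qed simp
    have "odd (flip_bit k s div (a + 1)) \<longleftrightarrow> even (s div (a + 1))"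
      unfolding k fb by simp
    then have "a \<in> ?X (flip_bit k s) \<longleftrightarrow> a \<notin> ?X s" using assms by simp
    then have eq: "?X (flip_bit k s) = (if a \<in> ?X s then ?X s - {a} else insert a (?X s))"
      using mem by (intro set_eqI) (metis (no_types, lifting) Diff_iff insert_iff singletonD singletonI)
    have "finite (?X s)" by simp
    then show ?thesis
      unfolding parity_weight_def eq by (auto simp: card_Diff_singleton card_gt_0_iff)
  qed
  then have ev: "even (parity_weight n y (flip_bit k s)) \<longleftrightarrow> odd (parity_weight n y s)" for s
    by blast
  have inv: "flip_bit k (flip_bit k s) = s" for s :: nat
    by (rule bit_eqI) (auto simp: bit_flip_bit_iff)
  let ?O = "{s. s < parities n \<and> odd (parity_weight n y s)}"
  let ?E = "{s. s < parities n \<and> even (parity_weight n y s)}"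
  have "bij_betw (flip_bit k) ?O ?E"
    by (rule bij_betw_byWitness[where f' = "flip_bit k"]) (auto simp: inv ev m(1) lt)
  then have "card ?O = card ?E" by (rule bij_betw_same_card)
  moreover have "card ?O + card ?E = card (?O \<union> ?E)"
    by (rule card_Un_disjoint[symmetric]) auto
  moreover have "?O \<union> ?E = {..<parities n}" by auto
  ultimately show ?thesis by simp
qed

lemma card_odd_parities_zero:
  assumes "\<And>a. a < n + 1 \<Longrightarrow> pow2 (a + 1) \<Longrightarrow> \<not> y a"
  shows "card {s. s < parities n \<and> odd (parity_weight n y s)} = 0"
proof -
  have "parity_weight n y s = 0" for s
    unfolding parity_weight_def using assms by auto
  then show ?thesis by simp
qed

text \<open>\<open>c\<close> is the largest power of two dividing \<open>d\<close>. The bound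
  \<open>c <= |d|\<close> guarantees later that stage 0 has a qubit for \<open>c\<close>.\<close>

lemma two_power_times_odd:
  assumes "d \<noteq> (0 :: int)"
  obtains c k where "pow2 c" "int c \<le> \<bar>d\<bar>" "d = 2 * int c * k + int c"
proof -
  have "\<exists>c k. pow2 c \<and> int c \<le> \<bar>d\<bar> \<and> d = 2 * int c * k + int c"
    using assms
  proof (induction "nat \<bar>d\<bar>" arbitrary: d rule: less_induct)
    case less
    show ?case
    proof (cases "even d")
      case True
      then obtain d' where d': "d = 2 * d'" by auto
      have "\<exists>c k. pow2 c \<and> int c \<le> \<bar>d'\<bar> \<and> d' = 2 * int c * k + int c"
        by (rule less(1)) (use less(2) d' in auto)
      then obtain c k where c: "pow2 c" "int c \<le> \<bar>d'\<bar>" "d' = 2 * int c * k + int c" by blast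
      have "pow2 (2 * c)" using c(1) unfolding pow2_def by (metis power_Suc)
      moreover have "int (2 * c) \<le> \<bar>d\<bar>" using c(2) d' by simp
      moreover have "d = 2 * int (2 * c) * k + int (2 * c)" using c(3) d' by simp
      ultimately show ?thesis by blast
    next
      case False
      then obtain k where "d = 2 * k + 1" by (elim oddE)
      then show ?thesis by (intro exI[of _ 1] exI[of _ k]) (use less(2) in \<open>auto simp: pow2_def intro: exI[of _ 0]\<close>)
    qed
  qed
  then show thesis using that by blast
qed

subsection \<open>The three stages\<close>

text \<open>Stage 0 rotates qubit \<open>b\<close> by an angle proportional to \<open>t - \<bar>x\<bar>\<close>: if \<open>\<bar>x\<bar> = t\<close>, the qubits with
  \<open>b + 1\<close> a power of two are all zero, otherwise at least one of them is one. Stage 1 computes all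
  parities of these qubits, half of which are one unless the qubits are all zero. Stage 2 rotates
  a single qubit by an angle proportional to the number of parities that are one.\<close>

definition ins :: "nat \<Rightarrow> nat \<Rightarrow> nat" where
  "ins n st = (if st = 0 then n else if st - 1 = 0 then n + 1 else parities n)"

definition outs :: "nat \<Rightarrow> nat \<Rightarrow> nat" where
  "outs n st = (if st = 0 then n + 1 else if st - 1 = 0 then parities n else 1)"

text \<open>Cases are distinguished by tests for zero, the branching that the counter programs
  offer. In stage 1, \<open>b\<close> is read as a set of qubits as in
  \<open>parity_weight\<close>.\<close>

definition edge :: "nat \<Rightarrow> nat \<Rightarrow> nat \<Rightarrow> nat \<Rightarrow> bool" where
  "edge n st a b \<longleftrightarrow> (if st = 0 then pow2 (b + 1) else if st - 1 = 0 then pow2 (a + 1) \<and> odd (b div (a + 1)) else True)"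

definition denom :: "nat \<Rightarrow> nat \<Rightarrow> nat \<Rightarrow> nat" where
  "denom n st b = (if st = 0 then 4 * (b + 1) else if st - 1 = 0 then 4 else 2 * parities n)"

text \<open>The offsets correct the degree term of \<open>stage_support\<close> modulo
  \<open>2 * denom\<close>, within the natural numbers. Let \<open>D\<close> be the denominator and
  \<open>w\<close> the weight. Stage 0: \<open>4 * t + 2 * n * (D - 1) + 2 * n - 4 * w = 4 * (t - w)
  + 2 * n * D\<close>. Stage 1: \<open>6 * deg + 2 * deg - 4 * w\<close> is \<open>- 4 * w\<close>
  modulo 8. Stage 2 needs no offset: \<open>2 * M - 4 * w\<close> with \<open>M = parities n\<close>
  is \<open>D\<close> for \<open>w = 0\<close> and 0 for \<open>w = M / 2\<close>.\<close>

definition numer :: "nat \<Rightarrow> nat \<Rightarrow> nat \<Rightarrow> nat \<Rightarrow> nat" where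
  "numer n t st b = (if st = 0 then 4 * t + 2 * n * (denom n st b - 1)
     else if st - 1 = 0 then 6 * (\<Sum>a<ins n st. of_bool (edge n st a b)) else 0)"

text \<open>A numeral in base \<open>2 * n + 3\<close>, which exceeds all indices because
  \<open>parities n <= 2 * n + 2\<close>. Blocks 0 to 3 hold the inputs and the outputs of the three
  stages, blocks 4 to 6 the edge wires. Block 0 starts at wire 0, so the inputs and the target
  \<open>n\<close> keep their numbers.\<close>

definition idx :: "nat \<Rightarrow> nat \<Rightarrow> nat \<Rightarrow> nat \<Rightarrow> nat" where
  "idx n c i j = (c * (2 * n + 3) + i) * (2 * n + 3) + j"

definition vertex :: "nat \<Rightarrow> nat \<Rightarrow> nat \<Rightarrow> nat" where
  "vertex n st a = idx n st 0 a"

definition edge_wire :: "nat \<Rightarrow> nat \<Rightarrow> nat \<Rightarrow> nat \<Rightarrow> nat" where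
  "edge_wire n st a b = idx n (4 + st) b a"

definition exact_stage :: "(nat \<Rightarrow> nat \<Rightarrow> nat \<Rightarrow> 'u) \<Rightarrow> nat \<Rightarrow> nat \<Rightarrow> nat \<Rightarrow> 'u gate list list" where
  "exact_stage R n t st = stage R (ins n st) (outs n st) (edge n st) (vertex n st) (vertex n (Suc st))
     (edge_wire n st) (numer n t st) (denom n st)"

definition compute_layers :: "(nat \<Rightarrow> nat \<Rightarrow> nat \<Rightarrow> 'u) \<Rightarrow> nat \<Rightarrow> nat \<Rightarrow> 'u gate list list" where
  "compute_layers R n t = exact_stage R n t 0 @ exact_stage R n t 1 @ exact_stage R n t 2"

definition exact_circuit :: "(nat \<Rightarrow> nat \<Rightarrow> nat \<Rightarrow> 'u) \<Rightarrow> nat \<Rightarrow> nat \<Rightarrow> 'u circuit" where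
  "exact_circuit R n t = Circuit (7 * (2 * n + 3) * (2 * n + 3))
     (compute_layers R n t @ [[CNOT (vertex n 3 0) n]] @ rev (compute_layers R n t))"

section \<open>Layout of the wires\<close>

lemma idx_inj:
  assumes "i < 2 * n + 3" "j < 2 * n + 3" "i' < 2 * n + 3" "j' < 2 * n + 3"
  shows "idx n c i j = idx n c' i' j' \<longleftrightarrow> c = c' \<and> i = i' \<and> j = j'"
proof
  assume eq: "idx n c i j = idx n c' i' j'"
  let ?K = "2 * n + 3"
  have "idx n c i j mod ?K = j" "idx n c i j div ?K = c * ?K + i"
    "idx n c' i' j' mod ?K = j'" "idx n c' i' j' div ?K = c' * ?K + i'"
    using assms by (simp_all add: idx_def)
  then have "j = j'" "c * ?K + i = c' * ?K + i'" using eq by auto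
  moreover have "(c * ?K + i) mod ?K = i" "(c * ?K + i) div ?K = c" "(c' * ?K + i') mod ?K = i'" "(c' * ?K + i') div ?K = c'"
    using assms by simp_all
  ultimately show "c = c' \<and> i = i' \<and> j = j'" by metis
qed simp

lemma idx_less: "c < 7 \<Longrightarrow> i < 2 * n + 3 \<Longrightarrow> j < 2 * n + 3 \<Longrightarrow> idx n c i j < 7 * (2 * n + 3) * (2 * n + 3)"
proof -
  let ?K = "2 * n + 3"
  assume h: "c < 7" "i < ?K" "j < ?K"
  have "c * ?K + i < (c + 1) * ?K" using h by simp
  also have "\<dots> \<le> 7 * ?K" using h by (intro mult_right_mono) auto
  finally have "c * ?K + i + 1 \<le> 7 * ?K" by simp
  then have "(c * ?K + i + 1) * ?K \<le> 7 * ?K * ?K" by (rule mult_right_mono) simp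
  then show ?thesis using h(3) by (simp add: idx_def)
qed

lemma ins_less: "a < ins n st \<Longrightarrow> a < 2 * n + 3" and outs_less: "b < outs n st \<Longrightarrow> b < 2 * n + 3"
  using parities_le[of n] by (auto simp: ins_def outs_def split: if_splits)

lemma denom_pos: "0 < denom n st b"
  by (simp add: denom_def parities_def)

lemma gadget_stage:
  "gadget (ins n st) (outs n st) (vertex n st) (vertex n (Suc st)) (edge_wire n st) (denom n st)"
  by unfold_locales
    (auto simp: vertex_def edge_wire_def idx_inj ins_less outs_less denom_pos inj_on_def)

lemma stage_qubits:
  assumes "l \<in> set (stage R A B E iw ow W p q)" "g \<in> set l" "i \<in> set (gate_qubits g)"
  shows "i \<in> iw ` {..<A} \<union> ow ` {..<B} \<union> {W a b |a b. a < A \<and> b < B}"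
  using assms by (auto simp: stage_def set_edges)

lemma compute_layers_cases:
  assumes "l \<in> set (compute_layers R n t)"
  obtains st where "st < 3" "l \<in> set (exact_stage R n t st)"
  using assms that[of 0] that[of 1] that[of 2] by (auto simp: compute_layers_def)

lemma compute_layers_qubits:
  assumes "l \<in> set (compute_layers R n t)" "g \<in> set l" "i \<in> set (gate_qubits g)"
  shows "i < 7 * (2 * n + 3) * (2 * n + 3)" "i \<noteq> n"
proof -
  obtain st where st: "st < 3" "l \<in> set (exact_stage R n t st)"
    using assms(1) by (rule compute_layers_cases)
  have target: "n = idx n 0 0 n" by (simp add: idx_def)
  consider a where "a < ins n st" "i = idx n st 0 a" | b where "b < outs n st" "i = idx n (Suc st) 0 b"
    | a b where "a < ins n st" "b < outs n st" "i = idx n (4 + st) b a"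
    using stage_qubits[OF st(2)[unfolded exact_stage_def] assms(2,3)]
    by (auto simp: vertex_def edge_wire_def simp del: mult_Suc)
  then have "i < 7 * (2 * n + 3) * (2 * n + 3) \<and> i \<noteq> idx n 0 0 n"
  proof cases
    case 1
    then have "a < 2 * n + 3" by (simp add: ins_less)
    moreover have "st = 0 \<Longrightarrow> a < n" using 1 by (simp add: ins_def)
    ultimately show ?thesis using st(1) idx_less[of st 0 n a] by (auto simp: 1 idx_inj)
  next
    case 2
    then have "b < 2 * n + 3" by (simp add: outs_less)
    then show ?thesis using st(1) idx_less[of "Suc st" 0 n b] by (auto simp: 2 idx_inj)
  next
    case 3
    then have "a < 2 * n + 3" "b < 2 * n + 3" by (simp_all add: ins_less outs_less)
    then show ?thesis using st(1) idx_less[of "4 + st" b n a] by (auto simp: 3 idx_inj)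
  qed
  then show "i < 7 * (2 * n + 3) * (2 * n + 3)" "i \<noteq> n" using target by auto
qed

lemma compute_layers_distinct:
  assumes "l \<in> set (compute_layers R n t)"
  shows "distinct (concat (map gate_qubits l))"
proof -
  obtain st where st: "st < 3" "l \<in> set (exact_stage R n t st)"
    using assms(1) by (rule compute_layers_cases)
  show ?thesis
    using gadget.wf_stage[OF gadget_stage st(2)[unfolded exact_stage_def]] .
qed

lemma compute_layers_involutive:
  assumes "l \<in> set (compute_layers reflection n t)" "g \<in> set l"
  shows "involutive g"
proof -
  obtain st where st: "st < 3" "l \<in> set (exact_stage reflection n t st)"
    using assms(1) by (rule compute_layers_cases)
  show ?thesis
    using gadget.stage_involutive[OF gadget_stage st(2)[unfolded exact_stage_def] assms(2)] .
qed

section \<open>The state computed by the three stages\<close>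

definition touched :: "nat \<Rightarrow> nat \<Rightarrow> nat set" where
  "touched n st = {edge_wire n st a b |a b. a < ins n st \<and> b < outs n st} \<union> vertex n (Suc st) ` {..<outs n st}"

definition stage_result :: "nat \<Rightarrow> nat \<Rightarrow> nat \<Rightarrow> (nat \<Rightarrow> bool) \<Rightarrow> bool" where
  "stage_result n t st f \<longleftrightarrow> (\<forall>b<outs n st.
     let r = int (numer n t st b) + 2 * int (card {a. a < ins n st \<and> edge n st a b})
           - 4 * int (card {a. a < ins n st \<and> edge n st a b \<and> f (vertex n st a)}) in
       (\<forall>k. r = 2 * int (denom n st b) * k \<longrightarrow> \<not> f (vertex n (Suc st) b)) \<and>
       (\<forall>k. r = 2 * int (denom n st b) * k + int (denom n st b) \<longrightarrow> f (vertex n (Suc st) b)))"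

text \<open>A frame rule: since the state agrees with \<open>f0\<close> off the wires
  \<open>P\<close> written so far, the wires of the new stage are still zero, and the knowledge
  \<open>C\<close> about older wires persists.\<close>

lemma exact_stage_support:
  assumes "supported (\<lambda>f. (\<forall>i. i \<notin> P \<longrightarrow> f i = f0 i) \<and> C f) \<psi>"
    and "touched n st \<inter> P = {}" "\<And>i. i \<in> touched n st \<Longrightarrow> \<not> f0 i"
    and C: "\<And>f f'. (\<And>i. i \<notin> touched n st \<Longrightarrow> f i = f' i) \<Longrightarrow> C f = C f'"
  shows "supported (\<lambda>f. (\<forall>i. i \<notin> P \<union> touched n st \<longrightarrow> f i = f0 i) \<and> C f \<and> stage_result n t st f)
   (fold (fold ap) (exact_stage reflection n t st) \<psi>)"
proof -
  interpret gadget "ins n st" "outs n st" "edge n st" "vertex n st" "vertex n (Suc st)" "edge_wire n st"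
    "numer n t st" "denom n st"
    by (rule gadget_stage)
  let ?G = "\<lambda>f. (\<forall>i. i \<notin> P \<union> touched n st \<longrightarrow> f i = f0 i) \<and> C f"
  have sub: "Ew \<subseteq> touched n st" "vertex n (Suc st) ` {..<outs n st} \<subseteq> touched n st"
    by (auto simp: Ew_def E_def touched_def)
  have "supported (\<lambda>f. ?G f \<and> (\<forall>b<outs n st.
       (\<forall>k. int (numer n t st b) + 2 * int (deg b) - 4 * int (weight b f) = 2 * int (denom n st b) * k \<longrightarrow> \<not> f (vertex n (Suc st) b)) \<and>
       (\<forall>k. int (numer n t st b) + 2 * int (deg b) - 4 * int (weight b f) = 2 * int (denom n st b) * k + int (denom n st b) \<longrightarrow> f (vertex n (Suc st) b))))
     (fold (fold ap) (stage reflection (ins n st) (outs n st) (edge n st) (vertex n st) (vertex n (Suc st))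
        (edge_wire n st) (numer n t st) (denom n st)) \<psi>)"
  proof (rule stage_support)
    show "supported (\<lambda>f. ?G f \<and> (\<forall>(a, b)\<in>E. \<not> f (edge_wire n st a b)) \<and> (\<forall>b<outs n st. \<not> f (vertex n (Suc st) b))) \<psi>"
      unfolding supported_def
    proof (intro allI impI)
      fix f assume "\<psi> f \<noteq> 0"
      then have f: "\<And>i. i \<notin> P \<Longrightarrow> f i = f0 i" "C f" using assms(1) by (auto simp: supported_def)
      have z: "\<not> f i" if "i \<in> touched n st" for i using f(1)[of i] assms(2,3) that by blast
      have "\<not> f (edge_wire n st a b)" if "(a, b) \<in> E" for a b
        using that by (intro z) (auto simp: touched_def E_def)
      moreover have "\<not> f (vertex n (Suc st) b)" if "b < outs n st" for b
        using that by (intro z) (auto simp: touched_def)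
      ultimately show "?G f \<and> (\<forall>(a, b)\<in>E. \<not> f (edge_wire n st a b)) \<and> (\<forall>b<outs n st. \<not> f (vertex n (Suc st) b))"
        using f by auto
    qed
    fix f f' :: "nat \<Rightarrow> bool"
    assume "\<And>i. i \<notin> Ew \<Longrightarrow> i \<notin> vertex n (Suc st) ` {..<outs n st} \<Longrightarrow> f i = f' i"
    then have eq: "f i = f' i" if "i \<notin> touched n st" for i using that sub by blast
    then show "?G f = ?G f'" using C[of f f'] by auto
  qed
  then show ?thesis
    by (simp add: exact_stage_def stage_result_def deg_def weight_def Let_def conj_assoc)
qed

lemma supported_mono: "supported S \<psi> \<Longrightarrow> (\<And>f. S f \<Longrightarrow> S' f) \<Longrightarrow> supported S' \<psi>"
  by (auto simp: supported_def)

lemma vertex_notin_touched: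
  "a < 2 * n + 3 \<Longrightarrow> st \<le> 3 \<Longrightarrow> st \<noteq> Suc st' \<Longrightarrow> vertex n st a \<notin> touched n st'"
  by (auto simp: touched_def vertex_def edge_wire_def idx_inj ins_less outs_less)

lemma touched_disjoint: "st < 3 \<Longrightarrow> st' < 3 \<Longrightarrow> st \<noteq> st' \<Longrightarrow> touched n st \<inter> touched n st' = {}"
  by (auto simp: touched_def vertex_def edge_wire_def idx_inj ins_less outs_less)

lemma compute_layers_support:
  assumes f0: "\<And>i. f0 i \<Longrightarrow> i \<le> n" and t: "t \<le> n"
  shows "supported (\<lambda>f. f (vertex n 3 0) = (card {a. a < n \<and> f0 a} = t))
    (fold (fold ap) (compute_layers reflection n t) (\<lambda>f. of_bool (f = f0)))"
proof -
  let ?\<psi>0 = "\<lambda>f. of_bool (f = f0) :: complex"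
  let ?w = "card {a. a < n \<and> f0 a}"
  define y where "y f a = f (vertex n 1 a)" for f :: "nat \<Rightarrow> bool" and a
  \<comment> \<open>What is kept from stage 0. If the weight differs from \<open>t\<close>, it only
    matters that some qubit is one, not which.\<close>
  define C0 where "C0 f \<longleftrightarrow> (if ?w = t then \<forall>b<n + 1. pow2 (b + 1) \<longrightarrow> \<not> y f b
     else \<exists>b<n + 1. pow2 (b + 1) \<and> y f b)" for f
  define C1 where "C1 f \<longleftrightarrow> C0 f \<and> (\<forall>s<parities n. f (vertex n 2 s) = odd (parity_weight n (y f) s))" for f
  have v0: "vertex n 0 i = i" for i by (simp add: vertex_def idx_def)
  have small: "i \<notin> touched n st" if "i \<le> n" for i st
    using vertex_notin_touched[of i n 0 st] that by (simp add: v0)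
  have f0T: "\<not> f0 i" if "i \<in> touched n st" for i st using small f0 that by blast

  let ?P0 = "{} \<union> touched n 0"
  define \<psi>1 where "\<psi>1 = fold (fold ap) (exact_stage reflection n t 0) ?\<psi>0"
  have "supported (\<lambda>f. (\<forall>i. i \<notin> {} \<longrightarrow> f i = f0 i) \<and> True) ?\<psi>0"
    by (auto simp: supported_def)
  from exact_stage_support[OF this, of n 0 t] have
    "supported (\<lambda>f. (\<forall>i. i \<notin> ?P0 \<longrightarrow> f i = f0 i) \<and> True \<and> stage_result n t 0 f) \<psi>1"
    using f0T by (simp add: \<psi>1_def)
  then have s1: "supported (\<lambda>f. (\<forall>i. i \<notin> ?P0 \<longrightarrow> f i = f0 i) \<and> C0 f) \<psi>1"
  proof (rule supported_mono)
    fix f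
    assume h: "(\<forall>i. i \<notin> ?P0 \<longrightarrow> f i = f0 i) \<and> True \<and> stage_result n t 0 f"
    have r: "int (numer n t 0 b) + 2 * int (card {a. a < ins n 0 \<and> edge n 0 a b})
        - 4 * int (card {a. a < ins n 0 \<and> edge n 0 a b \<and> f (vertex n 0 a)})
        = 4 * (int t - int ?w) + 8 * int n * int (b + 1)" if "pow2 (b + 1)" for b
    proof -
      have "{a. a < n \<and> edge n 0 a b \<and> f (vertex n 0 a)} = {a. a < n \<and> f0 a}"
        using h small[of _ 0] that by (auto simp: edge_def v0)
      moreover have "{a. a < n \<and> edge n 0 a b} = {..<n}" using that by (auto simp: edge_def)
      ultimately show ?thesis
        by (simp add: numer_def ins_def denom_def of_nat_diff algebra_simps)
    qed
    have out: "(\<forall>k. 4 * (int t - int ?w) + 8 * int n * int (b + 1) = 8 * int (b + 1) * k \<longrightarrow> \<not> y f b) \<and>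
        (\<forall>k. 4 * (int t - int ?w) + 8 * int n * int (b + 1) = 8 * int (b + 1) * k + 4 * int (b + 1) \<longrightarrow> y f b)"
      if "b < n + 1" "pow2 (b + 1)" for b
    proof -
      have "2 * int (denom n 0 b) = 8 * int (b + 1)" "int (denom n 0 b) = 4 * int (b + 1)" "b < outs n 0"
        using that by (simp_all add: denom_def outs_def)
      then show ?thesis
        using h[THEN conjunct2, THEN conjunct2, unfolded stage_result_def, rule_format, of b] r[OF that(2)] unfolding Let_def y_def
        by (simp only: One_nat_def True_implies_equals)
    qed
    have "C0 f"
    proof (cases "?w = t")
      case True
      \<comment> \<open>The offset \<open>8 * n * (b + 1)\<close> amounts to \<open>n\<close> full
        turns, hence the witness \<open>int n\<close> here and \<open>k + int n\<close> in the other
        case.\<close>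
      have "\<not> y f b" if "b < n + 1" "pow2 (b + 1)" for b
        using out[OF that, THEN conjunct1, rule_format, of "int n"] True by simp
      then show ?thesis using True by (simp add: C0_def)
    next
      case False
      then obtain c k where c: "pow2 c" "int c \<le> \<bar>int t - int ?w\<bar>" "int t - int ?w = 2 * int c * k + int c"
        using two_power_times_odd[of "int t - int ?w"] by auto
      have "?w \<le> card {..<n}" by (rule card_mono) auto
      then have "c \<le> n" using c(2) t by simp
      have "0 < c" using c(1) by (auto simp: pow2_def)
      then obtain b where b: "c = b + 1" by (cases c) auto
      have "y f b"
        using out[of b, THEN conjunct2, rule_format, of "k + int n"] c \<open>c \<le> n\<close> b
        by (simp add: algebra_simps)
      then show ?thesis using False \<open>c \<le> n\<close> c(1) b by (auto simp: C0_def intro!: exI[of _ b])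
    qed
    then show "(\<forall>i. i \<notin> ?P0 \<longrightarrow> f i = f0 i) \<and> C0 f" using h by blast
  qed

  let ?P1 = "?P0 \<union> touched n 1"
  define \<psi>2 where "\<psi>2 = fold (fold ap) (exact_stage reflection n t 1) \<psi>1"
  have y_cong: "y f b = y f' b" if "\<And>i. i \<notin> touched n st \<Longrightarrow> f i = f' i" "b < n + 1" "st \<noteq> 0" for f f' b st
    using that vertex_notin_touched[of b n 1 st] by (simp add: y_def)
  have C0_cong: "C0 f = C0 f'" if "\<And>i. i \<notin> touched n st \<Longrightarrow> f i = f' i" "st \<noteq> 0" for f f' st
    using y_cong[OF that(1) _ that(2)] by (auto simp: C0_def)
  have "supported (\<lambda>f. (\<forall>i. i \<notin> ?P1 \<longrightarrow> f i = f0 i) \<and> C0 f \<and> stage_result n t 1 f) \<psi>2"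
    unfolding \<psi>2_def
  proof (rule exact_stage_support[OF s1])
    show "touched n 1 \<inter> ?P0 = {}" using touched_disjoint[of 1 0 n] by simp
    show "C0 f = C0 f'" if "\<And>i. i \<notin> touched n 1 \<Longrightarrow> f i = f' i" for f f'
      by (rule C0_cong[of 1 f f']) (simp_all add: that)
  qed (rule f0T)
  then have s2: "supported (\<lambda>f. (\<forall>i. i \<notin> ?P1 \<longrightarrow> f i = f0 i) \<and> C1 f) \<psi>2"
  proof (rule supported_mono)
    fix f
    assume h: "(\<forall>i. i \<notin> ?P1 \<longrightarrow> f i = f0 i) \<and> C0 f \<and> stage_result n t 1 f"
    have "f (vertex n 2 s) = odd (parity_weight n (y f) s)" if s: "s < parities n" for s
    proof -
      let ?d = "card {a. a < ins n 1 \<and> edge n 1 a s}"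
      let ?c = "parity_weight n (y f) s"
      have "{a. a < ins n 1 \<and> edge n 1 a s \<and> f (vertex n 1 a)} =
          {a. a < n + 1 \<and> (pow2 (a + 1) \<and> odd (s div (a + 1))) \<and> y f a}"
        by (simp add: ins_def edge_def y_def)
      moreover have "(\<Sum>a<ins n 1. of_bool (edge n 1 a s)) = ?d"
        by (simp add: of_bool_def sum.If_cases Int_def)
      ultimately have r: "int (numer n t 1 s) + 2 * int ?d
          - 4 * int (card {a. a < ins n 1 \<and> edge n 1 a s \<and> f (vertex n 1 a)}) = 8 * int ?d - 4 * int ?c"
        by (simp add: numer_def parity_weight_def)
      have out: "(\<forall>k. 8 * int ?d - 4 * int ?c = 8 * k \<longrightarrow> \<not> f (vertex n 2 s)) \<and>
          (\<forall>k. 8 * int ?d - 4 * int ?c = 8 * k + 4 \<longrightarrow> f (vertex n 2 s))"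
      proof -
        have d: "2 * int (denom n 1 s) = 8" "int (denom n 1 s) = 4" "Suc 1 = 2" and "s < outs n 1"
          using s by (simp_all add: denom_def outs_def)
        from h[THEN conjunct2, THEN conjunct2, unfolded stage_result_def, rule_format, OF this(4)] show ?thesis
          unfolding Let_def r d by simp
      qed
      show ?thesis
      proof (cases "even ?c")
        case True
        then obtain j where "?c = 2 * j" by auto
        then show ?thesis using out[THEN conjunct1, rule_format, of "int ?d - int j"] True by simp
      next
        case False
        then obtain j where "?c = 2 * j + 1" by (elim oddE)
        \<comment> \<open>\<open>8 * d - 4 * (2 * j + 1) = 8 * (d - j - 1) + 4\<close>.\<close>
        then show ?thesis using out[THEN conjunct2, rule_format, of "int ?d - int j - 1"] False by simp
      qed
    qed
    then show "(\<forall>i. i \<notin> ?P1 \<longrightarrow> f i = f0 i) \<and> C1 f" using h unfolding C1_def by blast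
  qed

  let ?P2 = "?P1 \<union> touched n 2"
  define \<psi>3 where "\<psi>3 = fold (fold ap) (exact_stage reflection n t 2) \<psi>2"
  have "supported (\<lambda>f. (\<forall>i. i \<notin> ?P2 \<longrightarrow> f i = f0 i) \<and> C1 f \<and> stage_result n t 2 f) \<psi>3"
    unfolding \<psi>3_def
  proof (rule exact_stage_support[OF s2])
    show "touched n 2 \<inter> ?P1 = {}" using touched_disjoint[of 2 0 n] touched_disjoint[of 2 1 n] by auto
    fix f f' :: "nat \<Rightarrow> bool" assume e: "\<And>i. i \<notin> touched n 2 \<Longrightarrow> f i = f' i"
    have "parity_weight n (y f) s = parity_weight n (y f') s" for s
      using y_cong[of 2 f f'] e by (auto simp: parity_weight_def intro!: arg_cong[of _ _ card])
    moreover have "f (vertex n 2 s) = f' (vertex n 2 s)" if "s < parities n" for s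
      using that parities_le[of n] by (intro e vertex_notin_touched) auto
    moreover have "C0 f = C0 f'" by (rule C0_cong[of 2 f f']) (simp_all add: e)
    ultimately show "C1 f = C1 f'" by (auto simp: C1_def)
  qed (rule f0T)
  then have "supported (\<lambda>f. f (vertex n 3 0) = (?w = t)) \<psi>3"
  proof (rule supported_mono)
    fix f
    assume h: "(\<forall>i. i \<notin> ?P2 \<longrightarrow> f i = f0 i) \<and> C1 f \<and> stage_result n t 2 f"
    let ?O = "{s. s < parities n \<and> odd (parity_weight n (y f) s)}"
    have C: "C0 f" "\<And>s. s < parities n \<Longrightarrow> f (vertex n 2 s) = odd (parity_weight n (y f) s)"
      using h by (auto simp: C1_def)
    have "{a. a < ins n 2 \<and> edge n 2 a 0} = {..<parities n}"
      "{a. a < ins n 2 \<and> edge n 2 a 0 \<and> f (vertex n 2 a)} = ?O"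
      using C(2) by (auto simp: ins_def edge_def)
    then have r: "int (numer n t 2 0) + 2 * int (card {a. a < ins n 2 \<and> edge n 2 a 0})
        - 4 * int (card {a. a < ins n 2 \<and> edge n 2 a 0 \<and> f (vertex n 2 a)})
        = 2 * int (parities n) - 4 * int (card ?O)"
      by (simp add: numer_def)
    have d: "int (denom n 2 0) = 2 * int (parities n)" "Suc 2 = 3" and "0 < outs n 2"
      by (simp_all add: denom_def outs_def)
    from h[THEN conjunct2, THEN conjunct2, unfolded stage_result_def, rule_format, OF this(3)]
    have out: "(\<forall>k. 2 * int (parities n) - 4 * int (card ?O) = 2 * (2 * int (parities n)) * k \<longrightarrow> \<not> f (vertex n 3 0)) \<and>
       (\<forall>k. 2 * int (parities n) - 4 * int (card ?O) = 2 * (2 * int (parities n)) * k + 2 * int (parities n) \<longrightarrow> f (vertex n 3 0))"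
      unfolding Let_def r d .
    show "f (vertex n 3 0) = (?w = t)"
    proof (cases "?w = t")
      case True
      then have "card ?O = 0"
        using C(1) by (intro card_odd_parities_zero) (auto simp: C0_def)
      then show ?thesis using out[THEN conjunct2, rule_format, of 0] True by simp
    next
      case False
      then obtain b where "b < n + 1" "pow2 (b + 1)" "y f b" using C(1) by (auto simp: C0_def)
      then have "2 * card ?O = parities n" by (rule card_odd_parities)
      then have "int (parities n) = 2 * int (card ?O)" by linarith
      then have "2 * int (parities n) - 4 * int (card ?O) = 2 * (2 * int (parities n)) * 0" by simp
      then have "\<not> f (vertex n 3 0)" by (rule out[THEN conjunct1, rule_format])
      then show ?thesis using False by simp
    qed
  qed
  then show ?thesis by (simp add: compute_layers_def \<psi>1_def \<psi>2_def \<psi>3_def)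
qed

subsection \<open>The description of the circuit is computable in logarithmic space\<close>

text \<open>The double sum counts the odd divisors greater than one. Bounded sums and comparisons are all
  that the programs can compute.\<close>

lemma pow2_iff: "pow2 x \<longleftrightarrow> (\<Sum>u<x. \<Sum>v<x + 1. of_bool ((2 * u + 3) * v = x)) + of_bool (x = 0) = (0 :: nat)"
proof
  assume "pow2 x"
  then obtain k where k: "x = 2 ^ k" by (auto simp: pow2_def)
  have "(2 * u + 3) * v \<noteq> x" for u v
  proof
    assume "(2 * u + 3) * v = x"
    then have "2 * u + 3 dvd 2 ^ k" using k by (metis dvd_triv_left)
    then obtain i where "2 * u + 3 = 2 ^ i" using divides_primepow_nat[OF two_is_prime_nat] by blast
    then show False by (cases i) (auto, presburger)
  qed
  then show "(\<Sum>u<x. \<Sum>v<x + 1. of_bool ((2 * u + 3) * v = x)) + of_bool (x = 0) = (0 :: nat)"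
    using k by simp
next
  assume s: "(\<Sum>u<x. \<Sum>v<x + 1. of_bool ((2 * u + 3) * v = x)) + of_bool (x = 0) = (0 :: nat)"
  then have "x \<noteq> 0" and no: "\<And>u v. u < x \<Longrightarrow> v < x + 1 \<Longrightarrow> (2 * u + 3) * v \<noteq> x"
    by (simp_all only: add_is_0 sum_eq_0_iff finite_lessThan of_bool_eq_0_iff lessThan_iff Ball_def) blast+
  then have pos: "0 < x" by simp
  have "int x \<noteq> 0" using pos by simp
  then obtain c j where c: "pow2 c" "int c \<le> \<bar>int x\<bar>" "int x = 2 * int c * j + int c"
    by (rule two_power_times_odd)
  have "0 < c" using c(1) by (auto simp: pow2_def)
  have x: "int x = int c * (2 * j + 1)" using c(3) by (simp add: algebra_simps)
  then have "0 \<le> j" using pos \<open>0 < c\<close> by (smt (verit) mult_pos_neg of_nat_0_less_iff mult_le_0_iff)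
  then obtain i where i: "j = int i" using zero_le_imp_eq_int by blast
  have x: "x = c * (2 * i + 1)" using x unfolding i by (metis (mono_tags) of_nat_eq_iff of_nat_mult of_nat_1 of_nat_add of_nat_numeral)
  have "i = 0"
  proof (rule ccontr)
    assume "i \<noteq> 0"
    then obtain u where u: "i = Suc u" by (cases i) auto
    have "1 * (2 * i + 1) \<le> c * (2 * i + 1)" using \<open>0 < c\<close> by (intro mult_right_mono) auto
    then have "2 * i + 1 \<le> x" unfolding x mult_1 .
    then have "u < x" unfolding u by simp
    moreover have "c < x + 1" using c(2) by simp
    moreover have "(2 * u + 3) * c = x" using x u by (simp add: algebra_simps)
    ultimately show False using no by blast
  qed
  then show "pow2 x" using c(1) x by simp
qed

text \<open>Division with remainder as a bounded search: the quotient is \<open>2 * u + 1\<close>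
  and the remainder \<open>v\<close>.\<close>

lemma odd_div_iff:
  assumes "0 < (d::nat)"
  shows "odd (s div d) \<longleftrightarrow> (\<Sum>u<s + 1. \<Sum>v<d. of_bool (s = (2 * u + 1) * d + v)) \<noteq> (0 :: nat)"
proof
  assume "odd (s div d)"
  then obtain u where u: "s div d = 2 * u + 1" by (elim oddE)
  then have s: "s = (2 * u + 1) * d + s mod d" by (metis div_mult_mod_eq)
  have "u \<le> s div d" using u by simp
  also have "\<dots> \<le> s" by (rule div_le_dividend)
  finally have "u < s + 1" by simp
  moreover have "s mod d < d" using assms by simp
  ultimately have "\<exists>u<s + 1. \<exists>v<d. s = (2 * u + 1) * d + v" using s by blast
  then show "(\<Sum>u<s + 1. \<Sum>v<d. of_bool (s = (2 * u + 1) * d + v)) \<noteq> (0 :: nat)"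
    by (simp only: sum_eq_0_iff finite_lessThan of_bool_eq_0_iff lessThan_iff Ball_def) blast
next
  assume "(\<Sum>u<s + 1. \<Sum>v<d. of_bool (s = (2 * u + 1) * d + v)) \<noteq> (0 :: nat)"
  then obtain u v where v: "v < d" "s = (2 * u + 1) * d + v"
    by (simp only: sum_eq_0_iff finite_lessThan of_bool_eq_0_iff lessThan_iff Ball_def) blast
  have "s div d = 2 * u + 1" unfolding v(2) using v(1) by (subst div_mult_self3) simp_all
  then show "odd (s div d)" by simp
qed

lemma computable_and:
  "computable k (\<lambda>e. of_bool (P e)) \<Longrightarrow> computable k (\<lambda>e. of_bool (Q e)) \<Longrightarrow> computable k (\<lambda>e. of_bool (P e \<and> Q e))"
  unfolding of_bool_conj by (rule computable_mult)

lemma computable_nonzero: "computable k f \<Longrightarrow> computable k (\<lambda>e. of_bool (f e \<noteq> 0))"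
  using computable_not[OF computable_not[of k f]] by simp

lemma computable_pow2:
  assumes "computable k f"
  shows "computable k (\<lambda>e. of_bool (pow2 (f e)))"
proof -
  \<comment> \<open>\<open>f\<close> occurs outside the sums and below one and two bound
    variables.\<close>
  note f = assms computable_weaken[OF assms] computable_weaken[OF computable_weaken[OF assms]]
  show ?thesis
    unfolding pow2_iff
    by (intro computable_not computable_add computable_sum computable_eq computable_mult computable_const
        computable_hd computable_weaken[OF computable_hd] f)
qed

lemma computable_odd_div:
  assumes "computable k f" "computable k g"
  shows "computable k (\<lambda>e. of_bool (odd (f e div (g e + 1))))"
proof -
  note fg = assms assms[THEN computable_weaken] assms[THEN computable_weaken, THEN computable_weaken]
  have "(\<lambda>e. of_bool (odd (f e div (g e + 1)))) = (\<lambda>e. of_bool ((\<Sum>u<f e + 1. \<Sum>v<g e + 1.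
      of_bool (f e = (2 * u + 1) * (g e + 1) + v)) \<noteq> (0 :: nat)) :: nat)"
    by (intro ext arg_cong[of _ _ of_bool] odd_div_iff) simp
  then show ?thesis
    by (simp only:) (intro computable_nonzero computable_add computable_sum computable_eq computable_mult
        computable_const computable_hd computable_weaken[OF computable_hd] fg)
qed

lemma computable_parities:
  assumes "computable k f"
  shows "computable k (\<lambda>e. parities (f e))"
proof -
  have "parities n = 1 + (\<Sum>c<n + 1. of_bool (pow2 (c + 1)) * (c + 1))" for n
    unfolding parities_def by (intro arg_cong[of _ _ "(+) 1"] sum.cong) auto
  then show ?thesis
    by (simp only:) (intro computable_add computable_sum computable_mult computable_pow2 computable_const computable_hd assms)
qed

lemma computable_if_bool:
  assumes "computable k f" "computable k (\<lambda>e. of_bool (P e))" "computable k (\<lambda>e. of_bool (Q e))"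
  shows "computable k (\<lambda>e. of_bool (if f e = 0 then P e else Q e))"
  using computable_if[OF assms] by (simp add: if_distrib[of of_bool])

lemmas computable_arith = computable_add computable_diff computable_mult computable_const computable_if
  computable_and computable_pow2 computable_odd_div computable_parities computable_if_bool

lemma computable_ins: "computable k N \<Longrightarrow> computable k S \<Longrightarrow> computable k (\<lambda>e. ins (N e) (S e))"
  unfolding ins_def by (intro computable_arith)

lemma computable_outs: "computable k N \<Longrightarrow> computable k S \<Longrightarrow> computable k (\<lambda>e. outs (N e) (S e))"
  unfolding outs_def by (intro computable_arith)

lemma computable_edge:
  "computable k N \<Longrightarrow> computable k S \<Longrightarrow> computable k A \<Longrightarrow> computable k B \<Longrightarrow>
    computable k (\<lambda>e. of_bool (edge (N e) (S e) (A e) (B e)))"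
  unfolding edge_def by (intro computable_arith)

lemma computable_denom:
  "computable k N \<Longrightarrow> computable k S \<Longrightarrow> computable k B \<Longrightarrow> computable k (\<lambda>e. denom (N e) (S e) (B e))"
  unfolding denom_def by (intro computable_arith)

lemma computable_vertex:
  "computable k N \<Longrightarrow> computable k S \<Longrightarrow> computable k A \<Longrightarrow> computable k (\<lambda>e. vertex (N e) (S e) (A e))"
  unfolding vertex_def idx_def by (intro computable_arith)

lemma computable_edge_wire:
  "computable k N \<Longrightarrow> computable k S \<Longrightarrow> computable k A \<Longrightarrow> computable k B \<Longrightarrow>
    computable k (\<lambda>e. edge_wire (N e) (S e) (A e) (B e))"
  unfolding edge_wire_def idx_def by (intro computable_arith)

lemmas computable_circuit_parameters = computable_ins computable_outs computable_edge computable_denom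
  computable_vertex computable_edge_wire

lemma computable_numer:
  assumes "computable k N" "computable k T" "computable k S" "computable k B"
  shows "computable k (\<lambda>e. numer (N e) (T e) (S e) (B e))"
  unfolding numer_def
  by (intro computable_arith computable_sum computable_circuit_parameters computable_hd assms
      assms[THEN computable_weaken])

section \<open>Printing the layers\<close>

definition encode_layer :: "gate_code gate list \<Rightarrow> token list" where
  "encode_layer l = Layer_Tok # concat (map encode_gate l)"

text \<open>A loop over all indices that prints nothing for the rejected ones replaces the filtered
  list, which programs cannot form.\<close>

lemma encode_nats_filter:
  "encode_nats (map h (filter P xs)) = concat (map (\<lambda>b. if P b then encode_nats [h b] else []) xs)"
  by (induction xs) (auto simp: encode_nats_def)

lemma encode_fanouts:
  "encode_layer (map (\<lambda>a. Fanout (c a) (map (w a) (filter (P a) xs))) ys) =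
    Layer_Tok # concat (map (\<lambda>a. Fanout_Tok # encode_nats [c a] @
      concat (map (\<lambda>b. if P a b then encode_nats [w a b] else []) xs)) ys)"
proof -
  have "encode_gate (Fanout (c a) (map (w a) (filter (P a) xs))) = Fanout_Tok # encode_nats [c a] @
      concat (map (\<lambda>b. if P a b then encode_nats [w a b] else []) xs)" for a
    unfolding encode_nats_filter[symmetric] by (simp add: encode_nats_def)
  then show ?thesis by (simp add: encode_layer_def comp_def del: encode_gate.simps)
qed

lemma encode_reflections:
  "encode_layer (map (\<lambda>b. One (reflection_code g (p b) (q b)) (w b)) ys) =
    Layer_Tok # concat (map (\<lambda>b. One_Tok #
      encode_nats [w b, 0, 0, 1, 0, 1, g, 1, p b, q b, 0, q b + p b, q b]) ys)"
  by (simp add: encode_layer_def comp_def reflection_code_def)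

lemma encode_edge_reflections:
  "encode_layer (map (\<lambda>(a, b). One (reflection_code g 1 (q b)) (w a b)) (edges A B E)) =
    Layer_Tok # concat (map (\<lambda>b. concat (map (\<lambda>a. if E a b then One_Tok #
      encode_nats [w a b, 0, 0, 1, 0, 1, g, 1, 1, q b, 0, q b + 1, q b] else []) [0..<A])) [0..<B])"
proof -
  have f: "concat (map h (filter P xs)) = concat (map (\<lambda>a. if P a then h a else []) xs)"
    for h :: "nat \<Rightarrow> token list" and P xs
    by (induction xs) auto
  have "concat (map encode_gate (map (\<lambda>(a, b). One (reflection_code g 1 (q b)) (w a b)) (edges A B E))) =
    concat (map (\<lambda>b. concat (map (\<lambda>a. encode_gate (One (reflection_code g 1 (q b)) (w a b)))
      (filter (\<lambda>a. E a b) [0..<A]))) [0..<B])"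
    unfolding edges_def by (induction B) (simp_all add: comp_def)
  moreover have "encode_gate (One (reflection_code g 1 (q b)) (w a b)) =
      One_Tok # encode_nats [w a b, 0, 0, 1, 0, 1, g, 1, 1, q b, 0, q b + 1, q b]" for a b
    by (simp add: reflection_code_def)
  ultimately show ?thesis unfolding encode_layer_def f by (simp only:)
qed

lemma prints_nats_Nil: "prints k (\<lambda>_. encode_nats [])"
  by (simp add: encode_nats_def prints_Nil)

lemma prints_exact_stage:
  assumes "computable k N" "computable k T"
  shows "prints k (\<lambda>e. concat (map encode_layer (exact_stage reflection_code (N e) (T e) st)))"
    and "prints k (\<lambda>e. concat (map encode_layer (rev (exact_stage reflection_code (N e) (T e) st))))"
proof -
  note v = assms(1,2) assms(1,2)[THEN computable_weaken] assms(1,2)[THEN computable_weaken, THEN computable_weaken]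
    computable_hd computable_weaken[OF computable_hd]
  note rules = prints_Cons prints_append prints_concat prints_if prints_nats_Cons prints_nats_Nil prints_Nil
    computable_circuit_parameters computable_numer computable_add computable_const v
  have 1: "prints k (\<lambda>e. encode_layer (map (\<lambda>a. Fanout (vertex (N e) st a)
      (map (edge_wire (N e) st a) (filter (edge (N e) st a) [0..<outs (N e) st]))) [0..<ins (N e) st]))"
    unfolding encode_fanouts by (intro rules)
  have 2: "prints k (\<lambda>e. encode_layer (map (\<lambda>b. One (reflection_code 4 0 1) (vertex (N e) (Suc st) b)) [0..<outs (N e) st]))"
    unfolding encode_reflections by (intro rules)
  have 3: "prints k (\<lambda>e. encode_layer (map (\<lambda>b. Fanout (vertex (N e) (Suc st) b)
      (map (\<lambda>a. edge_wire (N e) st a b) (filter (\<lambda>a. edge (N e) st a b) [0..<ins (N e) st]))) [0..<outs (N e) st]))"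
    unfolding encode_fanouts by (intro rules)
  have 4: "prints k (\<lambda>e. encode_layer (map (\<lambda>(a, b). One (reflection_code 2 1 (denom (N e) st b)) (edge_wire (N e) st a b))
      (edges (ins (N e) st) (outs (N e) st) (edge (N e) st))))"
    unfolding encode_edge_reflections by (intro rules)
  have 5: "prints k (\<lambda>e. encode_layer (map (\<lambda>b. One (reflection_code 4 (numer (N e) (T e) st b) (denom (N e) st b))
      (vertex (N e) (Suc st) b)) [0..<outs (N e) st]))"
    unfolding encode_reflections by (intro rules)
  show "prints k (\<lambda>e. concat (map encode_layer (exact_stage reflection_code (N e) (T e) st)))"
    unfolding exact_stage_def stage_def list.map concat.simps
    by (intro prints_append prints_Nil 1 2 3 4 5)
  show "prints k (\<lambda>e. concat (map encode_layer (rev (exact_stage reflection_code (N e) (T e) st))))"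
    unfolding exact_stage_def stage_def rev.simps append.simps list.map concat.simps
    by (intro prints_append prints_Nil 1 2 3 4 5)
qed

lemma encode_circuit_alt:
  "encode_circuit D = encode_nats [wires D] @ concat (map encode_layer (layers D))"
  by (simp add: encode_circuit_def encode_layer_def[abs_def])

lemma prints_exact_circuit:
  "prints 2 (\<lambda>e. encode_circuit (exact_circuit reflection_code (e ! 0) (e ! 1)))"
proof -
  have n: "computable 2 (\<lambda>e. e ! 0)" and t: "computable 2 (\<lambda>e. e ! 1)"
    by (rule computable_nth; simp)+
  have mid: "prints 2 (\<lambda>e. encode_layer [CNOT (vertex (e ! 0) 3 0) (e ! 0)])"
    unfolding encode_layer_def list.map concat.simps encode_gate.simps append_Nil2
    by (intro prints_Cons prints_nats_Cons prints_nats_Nil computable_circuit_parameters computable_const n)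
  have w: "prints 2 (\<lambda>e. encode_nats [7 * (2 * (e ! 0) + 3) * (2 * (e ! 0) + 3)])"
    by (intro prints_nats_Cons prints_nats_Nil computable_mult computable_add computable_const n)
  show ?thesis
    unfolding encode_circuit_alt exact_circuit_def circuit.sel compute_layers_def rev_append
      map_append concat_append list.map concat.simps append_Nil2
    by (intro prints_append w mid prints_exact_stage n t)
qed

lemma log_space_uniform_exact: "log_space_uniform (exact_circuit reflection_code)"
proof -
  obtain M where "wf_machine M"
    "\<And>n t. tm_outputs M (index_word n t) (encode_circuit (exact_circuit reflection_code ([n, t] ! 0) ([n, t] ! 1)))"
    "\<exists>c. \<forall>\<^sub>F n in at_top. \<forall>t\<le>n. tm_space_le M (index_word n t) (c * log 2 (real n))"
    using machine_for[OF prints_exact_circuit[unfolded prints_def]] by blast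
  then show ?thesis unfolding log_space_uniform_def by auto
qed

subsection \<open>Correctness\<close>

text \<open>\<open>stage\<close> is parametric in the labels \<open>R\<close>, so the printed codes
  and the actual matrices come from one and the same definition.\<close>

lemma map_stage: "map (map (map_gate h)) (stage R A B E iw ow W p q) = stage (\<lambda>g p q. h (R g p q)) A B E iw ow W p q"
  by (simp add: stage_def comp_def case_prod_beta)

lemma map_exact_circuit: "map_circuit h (exact_circuit R n t) = exact_circuit (\<lambda>g p q. h (R g p q)) n t"
  by (simp add: exact_circuit_def compute_layers_def exact_stage_def map_stage flip: rev_map)

lemma unitary_gate_of: "unitary (gate_of \<theta>s c)"
  unfolding unitary_iff_u_gate by (cases c) auto

lemma target_neq_result: "vertex n 3 0 \<noteq> n" "vertex n 3 0 < 7 * (2 * n + 3) * (2 * n + 3)" "n < 7 * (2 * n + 3) * (2 * n + 3)"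
proof -
  have "n = idx n 0 0 n" by (simp add: idx_def)
  then show "vertex n 3 0 \<noteq> n" using idx_inj[of 0 n 0 0 n 3 0] by (simp add: vertex_def)
  show "vertex n 3 0 < 7 * (2 * n + 3) * (2 * n + 3)" unfolding vertex_def by (rule idx_less) auto
  have "n * 1 < (2 * n + 3) * (7 * (2 * n + 3))" by (rule mult_strict_mono) auto
  then show "n < 7 * (2 * n + 3) * (2 * n + 3)" by (simp add: mult_ac)
qed

lemma exact_circuit_layers_qubits:
  assumes "l \<in> set (layers (exact_circuit R n t))" "g \<in> set l" "i \<in> set (gate_qubits g)"
  shows "i < wires (exact_circuit R n t)"
  using assms compute_layers_qubits(1)[of l R n t g i] target_neq_result[of n]
  by (auto simp: exact_circuit_def simp del: mult_Suc)

lemma wf_exact_circuit: "wf_circuit (map_circuit (gate_of \<theta>s) (exact_circuit R n t))"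
proof -
  let ?C = "exact_circuit (\<lambda>g p q. gate_of \<theta>s (R g p q)) n t"
  have "distinct (concat (map gate_qubits l))" if "l \<in> set (layers ?C)" for l
    using that compute_layers_distinct target_neq_result(1)[of n] by (auto simp: exact_circuit_def)
  moreover have "\<forall>U\<in>set_circuit (map_circuit (gate_of \<theta>s) (exact_circuit R n t)). unitary U"
    by (simp add: circuit.set_map unitary_gate_of)
  ultimately show ?thesis
    unfolding wf_circuit_def map_exact_circuit using exact_circuit_layers_qubits by blast
qed

lemma exact_circuit_computes:
  assumes t: "t \<le> n"
  shows "computes (exact_circuit reflection n t) (exact_gate n t)"
proof -
  let ?C = "exact_circuit reflection n t"
  let ?N = "wires ?C"
  let ?anc = "replicate (?N - (n + 1)) False"
  have N: "n + 1 \<le> ?N" using target_neq_result(3)[of n] by (simp add: exact_circuit_def)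
  have "run_circuit ?C (ket (x @ ?anc)) =
      (\<lambda>z. \<Sum>y | length y = n + 1. snd (exact_gate n t) y x * ket (y @ ?anc) z)" if x: "length x = n + 1" for x
  proof -
    let ?v = "count_list (butlast x) True = t"
    let ?x' = "butlast x @ [last x \<noteq> ?v]"
    define f0 where "f0 = assignment (x @ ?anc)"
    have xs: "x = butlast x @ [last x]" using x by (metis append_butlast_last_id list.size(3) add_is_0 one_neq_zero)
    have nth: "x ! i = butlast x ! i" if "i < n" for i using that x by (simp add: nth_butlast)
    have f0: "f0 i \<Longrightarrow> i \<le> n" for i
      using x by (auto simp: f0_def assignment_def nth_append split: if_splits)
    have "{a. a < n \<and> f0 a} = {i. i < length (butlast x) \<and> True = butlast x ! i}"
      using x N by (auto simp: f0_def assignment_def nth_append nth)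
    then have w: "card {a. a < n \<and> f0 a} = count_list (butlast x) True"
      by (simp add: count_list_eq_length_filter length_filter_conv_card)
    have f0': "assignment (?x' @ ?anc) = (if ?v then flip {n} f0 else f0)"
    proof
      fix i
      consider "i < n" | "i = n" | "n < i" by linarith
      then show "assignment (?x' @ ?anc) i = (if ?v then flip {n} f0 else f0) i"
      proof cases
        case 1
        then show ?thesis using x by (auto simp: f0_def assignment_def flip_def nth_append nth)
      next
        case 2
        have "x ! n = last x" using x by (metis add_diff_cancel_right' last_conv_nth list.size(3) add_is_0 one_neq_zero)
        then show ?thesis using x N 2 by (auto simp: f0_def assignment_def flip_def nth_append)
      next
        case 3
        then show ?thesis using x by (auto simp: f0_def assignment_def flip_def nth_append)
      qed
    qed
    have "ket (x @ ?anc) = lift_state ?N (\<lambda>f. of_bool (f = f0))"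
      using ket_lift[of "x @ ?anc"] x N by (simp add: f0_def)
    moreover have "run_circuit ?C (lift_state ?N \<phi>) = lift_state ?N (fold (fold ap) (layers ?C) \<phi>)" for \<phi>
      by (rule run_circuit_lift) (use exact_circuit_layers_qubits in blast)
    ultimately have "run_circuit ?C (ket (x @ ?anc)) =
        lift_state ?N (fold (fold ap) (layers ?C) (\<lambda>f. of_bool (f = f0)))"
      by simp
    also have "fold (fold ap) (layers ?C) (\<lambda>f. of_bool (f = f0)) =
        (if ?v then (\<lambda>f. of_bool (flip {n} f = f0)) else (\<lambda>f. of_bool (f = f0)))"
      unfolding exact_circuit_def circuit.sel
    proof (rule compute_copy_uncompute)
      show "\<forall>l\<in>set (compute_layers reflection n t). distinct (concat (map gate_qubits l)) \<and>
          (\<forall>g\<in>set l. involutive g \<and> n \<notin> set (gate_qubits g))"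
        using compute_layers_distinct compute_layers_involutive compute_layers_qubits(2) by blast
      show "vertex n 3 0 \<noteq> n" by (rule target_neq_result)
      fix f assume "fold (fold ap) (compute_layers reflection n t) (\<lambda>f. of_bool (f = f0)) f \<noteq> 0"
      then show "f (vertex n 3 0) = ?v"
        using compute_layers_support[of f0 n t] f0 t w by (auto simp: supported_def)
    qed
    also have "\<dots> = (\<lambda>f. of_bool (f = assignment (?x' @ ?anc)))"
    proof -
      have "flip {n} (flip {n} f) = f" for f by (auto simp: flip_def fun_eq_iff)
      then have "flip {n} f = f0 \<longleftrightarrow> f = flip {n} f0" for f by metis
      then show ?thesis unfolding f0' by simp
    qed
    also have "lift_state ?N \<dots> = ket (?x' @ ?anc)"
      using ket_lift[of "?x' @ ?anc"] x N by simp
    also have "ket (?x' @ ?anc) = (\<lambda>z. \<Sum>y | length y = n + 1. snd (exact_gate n t) y x * ket (y @ ?anc) z)"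
    proof
      fix z
      have fin: "finite {y :: bool list. length y = n + 1}"
        using finite_lists_length_eq[of "UNIV :: bool set" "n + 1"] by simp
      have "(\<Sum>y | length y = n + 1. snd (exact_gate n t) y x * ket (y @ ?anc) z) =
          (\<Sum>y | length y = n + 1. if y = ?x' then ket (?x' @ ?anc) z else 0)"
        by (intro sum.cong) (auto simp: exact_gate_def Let_def)
      also have "\<dots> = ket (?x' @ ?anc) z"
        using fin x by (subst sum.delta) auto
      finally show "ket (?x' @ ?anc) z = (\<Sum>y | length y = n + 1. snd (exact_gate n t) y x * ket (y @ ?anc) z)" ..
    qed
    finally show ?thesis .
  qed
  then show ?thesis using N by (simp add: exact_gate_def Let_def)
qed

subsection \<open>Depth and size\<close>

text \<open>Beyond 2 a logarithm lowers its argument by at least 1, and from 2 on two more suffice.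
  This makes the set in \<open>log_star_def\<close> finite, without which its \<open>Max\<close>
  could not be bounded.\<close>

lemma iterated_log_nonpos: "x \<le> real k + 2 \<Longrightarrow> \<exists>j\<le>k + 2. (log 2 ^^ j) x \<le> 0"
proof (induction k arbitrary: x)
  case 0
  show ?case
  proof (cases "x \<le> 0")
    case True
    then show ?thesis by (intro exI[of _ 0]) simp
  next
    case False
    then have 1: "log 2 x \<le> 1" using 0 by simp
    show ?thesis
    proof (cases "log 2 x \<le> 0")
      case True
      then show ?thesis by (intro exI[of _ 1]) simp
    next
      case False
      then have "log 2 (log 2 x) \<le> 0" using 1 by simp
      then show ?thesis by (intro exI[of _ 2]) (simp add: numeral_2_eq_2)
    qed
  qed
next
  case (Suc k)
  have "\<exists>j\<le>k + 2. (log 2 ^^ j) (if x \<le> 2 then x else log 2 x) \<le> 0"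
  proof (rule Suc.IH)
    have "log 2 x \<le> x - 1" if "2 < x"
    proof -
      \<comment> \<open>\<open>(x - 2) / 2\<close> is the tangent bound for
        \<open>ln (x / 2)\<close>. It is at most \<open>(x - 2) * ln 2\<close>, and adding
        \<open>ln 2\<close> bounds \<open>ln x\<close> by \<open>(x - 1) * ln 2\<close>.\<close>
      have h: "(x - 2) * (1 / 2) \<le> (x - 2) * ln 2"
        using that ln2_ge_two_thirds by (intro mult_left_mono) linarith+
      have "ln x = ln (x / 2) + ln 2" using that by (simp add: ln_div)
      also have "ln (x / 2) \<le> x / 2 - 1" using that by (intro ln_le_minus_one) simp
      also have "\<dots> \<le> (x - 2) * ln 2"
        using h by simp
      finally show ?thesis by (simp add: log_def divide_simps algebra_simps)
    qed
    then show "(if x \<le> 2 then x else log 2 x) \<le> real k + 2" using Suc.prems by fastforce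
  qed
  then obtain j where "j \<le> k + 2" "(log 2 ^^ j) (if x \<le> 2 then x else log 2 x) \<le> 0" by blast
  then show ?case
    by (intro exI[of _ "if x \<le> 2 then j else Suc j"]) (auto simp: funpow_swap1)
qed

lemma log_star_pos: "0 < x \<Longrightarrow> 1 \<le> log_star x"
proof -
  assume x: "0 < x"
  let ?A = "{k. \<forall>j<k. 0 < (log 2 ^^ j) x}"
  obtain n where "x \<le> real n" using real_arch_simple by blast
  then obtain j where "(log 2 ^^ j) x \<le> 0" using iterated_log_nonpos[of x n] by auto
  then have "?A \<subseteq> {..j}" by (auto simp: not_less[symmetric])
  then have "finite ?A" by (rule finite_subset) simp
  moreover have "1 \<in> ?A" using x by auto
  ultimately show ?thesis unfolding log_star_def by (rule Max_ge)
qed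

text \<open>Three stages of six layers, run forwards and backwards, and the copying layer:
  \<open>2 * 18 + 1\<close>.\<close>

lemma depth_exact_circuit: "depth (exact_circuit R n t) = 37"
  by (simp add: depth_def exact_circuit_def compute_layers_def exact_stage_def stage_def)

definition layers_size :: "'u gate list list \<Rightarrow> nat" where
  "layers_size ls = (\<Sum>l\<leftarrow>ls. \<Sum>g\<leftarrow>l. length (gate_qubits g))"

lemma length_filter_upt: "length (filter P [0..<k]) = (\<Sum>i<k. of_bool (P i))"
  by (induction k) auto

text \<open>The controls contribute \<open>A + 2 * B\<close> and the gates on the outputs
  \<open>2 * B\<close>. Each edge wire is met by three fan-outs and one gate of its own.\<close>

lemma layers_size_stage:
  "layers_size (stage R A B E iw ow W p q) = A + 4 * B + 4 * (\<Sum>a<A. \<Sum>b<B. of_bool (E a b))"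
proof -
  let ?S = "\<Sum>a<A. \<Sum>b<B. of_bool (E a b) :: nat"
  have swap: "(\<Sum>b<B. \<Sum>a<A. of_bool (E a b)) = ?S" by (rule sum.swap)
  have len: "length (edges A B E) = ?S"
    unfolding swap[symmetric] edges_def
    by (simp add: length_concat comp_def length_filter_upt sum_list_sum_nth atLeast0LessThan)
  have one: "(\<Sum>g\<leftarrow>map (\<lambda>b. One (R' b) (w b)) xs. length (gate_qubits g)) = length xs"
    for R' w and xs :: "'z list" by (induction xs) auto
  have fan: "(\<Sum>g\<leftarrow>map (\<lambda>b. Fanout (c b) (map (w b) (filter (P b) [0..<k]))) [0..<m]. length (gate_qubits g))
      = m + (\<Sum>b<m. \<Sum>a<k. of_bool (P b a))" for c w P k m
    by (induction m) (simp_all add: length_filter_upt)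
  have edge: "(\<Sum>g\<leftarrow>map (\<lambda>(a, b). One (R' b) (W a b)) xs. length (gate_qubits g)) = length xs" for R' xs
    by (induction xs) auto
  show ?thesis
    unfolding layers_size_def stage_def list.map sum_list.Cons sum_list.Nil one fan edge swap len by simp
qed

lemma circuit_size_exact_circuit:
  assumes "0 < n"
  shows "real (circuit_size (exact_circuit R n t)) \<le> 144 * (real n * (log 2 (real n) + 2))"
proof -
  obtain m where m: "0 < m" "parities n = 2 ^ m" "2 ^ (m - 1) \<le> n + 1"
    "card {c. c < n + 1 \<and> pow2 (c + 1)} = m"
    by (rule parities_power[of n]) blast
  let ?M = "parities n"
  have M: "?M \<le> 2 * n + 2" by (rule parities_le)
  have c: "(\<Sum>c<n + 1. of_bool (pow2 (c + 1))) = m"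
  proof -
    have "{..<n + 1} \<inter> {c. pow2 (c + 1)} = {c. c < n + 1 \<and> pow2 (c + 1)}" by auto
    then show ?thesis using m(4) unfolding of_bool_def by (subst sum.If_cases) simp_all
  qed
  have rev: "layers_size (rev ls) = layers_size ls" for ls :: "'u gate list list"
    unfolding layers_size_def by (simp add: rev_map[symmetric] sum_list_rev del: rev_map)
  have app: "layers_size (ls @ ls') = layers_size ls + layers_size ls'" for ls ls' :: "'u gate list list"
    by (simp add: layers_size_def)
  have 0: "layers_size (exact_stage R n t 0) = n + 4 * (n + 1) + 4 * (n * m)"
    unfolding exact_stage_def layers_size_stage using c by (simp add: ins_def outs_def edge_def)
  have "(\<Sum>a<n + 1. \<Sum>b<?M. of_bool (edge n 1 a b)) \<le> (\<Sum>a<n + 1. of_bool (pow2 (a + 1)) * ?M)"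
  proof (rule sum_mono)
    fix a
    have "(\<Sum>b<?M. of_bool (edge n 1 a b)) \<le> (\<Sum>b<?M. of_bool (pow2 (a + 1)) :: nat)"
      by (rule sum_mono) (simp add: edge_def)
    also have "\<dots> = of_bool (pow2 (a + 1)) * ?M" by simp
    finally show "(\<Sum>b<?M. of_bool (edge n 1 a b)) \<le> of_bool (pow2 (a + 1)) * ?M" .
  qed
  also have "\<dots> = m * ?M" unfolding sum_distrib_right[symmetric] c ..
  finally have 1: "layers_size (exact_stage R n t 1) \<le> n + 1 + 4 * ?M + 4 * (m * ?M)"
    unfolding exact_stage_def layers_size_stage by (simp add: ins_def outs_def)
  have 2: "layers_size (exact_stage R n t 2) = ?M + 4 + 4 * ?M"
    unfolding exact_stage_def layers_size_stage by (simp add: ins_def outs_def edge_def)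
  have "m * ?M \<le> m * (2 * n + 2)" using M by (rule mult_left_mono) simp
  then have "layers_size (compute_layers R n t) \<le> 24 * n + 27 + 12 * (n * m) + 8 * m"
    unfolding compute_layers_def app using 0 1 2 M by (simp add: algebra_simps)
  \<comment> \<open>Each of \<open>n\<close>, \<open>m\<close> and 1 is at most
    \<open>n * m\<close>, and \<open>24 + 27 + 12 + 8 = 71\<close>. Uncomputing and the copying gate
    lead to \<open>2 * 71 + 2 = 144\<close>.\<close>
  also have "\<dots> \<le> 71 * (n * m)"
  proof -
    have "n * 1 \<le> n * m" "1 * m \<le> n * m" "1 * 1 \<le> n * m"
      using m(1) assms by (intro mult_mono; simp)+
    then show ?thesis by linarith
  qed
  finally have L: "layers_size (compute_layers R n t) \<le> 71 * (n * m)" .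
  have "circuit_size (exact_circuit R n t) = 2 * layers_size (compute_layers R n t) + 2"
    unfolding circuit_size_def layers_size_def[symmetric] exact_circuit_def circuit.sel app rev
    by (simp add: layers_size_def)
  moreover have "1 \<le> n * m" using m(1) assms by simp
  ultimately have "circuit_size (exact_circuit R n t) \<le> 144 * (n * m)" using L by linarith
  then have "real (circuit_size (exact_circuit R n t)) \<le> real (144 * (n * m))"
    by (rule of_nat_mono)
  also have "\<dots> = 144 * (real n * real m)" by simp
  also have "\<dots> \<le> 144 * (real n * (log 2 (real n) + 2))"
  proof (intro mult_left_mono)
    \<comment> \<open>\<open>n + 1 <= 2 * n\<close> costs one unit in the logarithm and
      \<open>m - 1\<close> another: this is the summand 2.\<close>
    have "real (2 ^ (m - 1)) \<le> real (2 * n)" using m(3) assms by (intro of_nat_mono) linarith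
    then have "log 2 (2 ^ (m - 1)) \<le> log 2 (2 * real n)" by (intro log_mono) simp_all
    moreover have "log 2 (2 ^ (m - 1)) = real (m - 1)" by (simp add: log_nat_power)
    moreover have "log 2 (2 * real n) = 1 + log 2 (real n)" using assms by (simp add: log_mult)
    ultimately show "real m \<le> log 2 (real n) + 2" using m(1) by simp
  qed simp_all
  finally show ?thesis .
qed

lemma fanout_computable_mono:
  assumes "fanout_computable F d s" "\<forall>\<^sub>F n in at_top. s n \<le> s' n" "\<forall>\<^sub>F n in at_top. 0 \<le> s n"
  shows "fanout_computable F d s'"
proof -
  obtain \<theta>s D c where D: "log_space_uniform D"
    "\<forall>n. \<forall>t\<le>n. let C = map_circuit (gate_of \<theta>s) (D n t) in wf_circuit C \<and> computes C (F n t)"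
    "\<exists>c. \<forall>\<^sub>F n in at_top. \<forall>t\<le>n. real (depth (D n t)) \<le> c * d n"
    and c: "\<forall>\<^sub>F n in at_top. \<forall>t\<le>n. real (circuit_size (D n t)) \<le> c * s n"
    using assms(1) unfolding fanout_computable_def by blast
  have "\<forall>\<^sub>F n in at_top. \<forall>t\<le>n. real (circuit_size (D n t)) \<le> \<bar>c\<bar> * s' n"
    using c assms(2,3)
  proof eventually_elim
    case (elim n)
    have "c * s n \<le> \<bar>c\<bar> * s' n" using elim(2,3) by (intro mult_mono) auto
    then show ?case using elim(1) by (meson order_trans)
  qed
  then show ?thesis using D unfolding fanout_computable_def by blast
qed

lemma fanout_computable_exact_gate:
  "fanout_computable exact_gate (\<lambda>n. real (log_star (real n))) (\<lambda>n. real n * log 2 (real n))"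
  unfolding fanout_computable_def
proof (intro exI[of _ "[pi, - pi]"] exI[of _ "exact_circuit reflection_code"] conjI allI impI)
  show "log_space_uniform (exact_circuit reflection_code)" by (rule log_space_uniform_exact)
  fix n t :: nat assume "t \<le> n"
  then have "computes (map_circuit (gate_of [pi, - pi]) (exact_circuit reflection_code n t)) (exact_gate n t)"
    using exact_circuit_computes[of t n] unfolding map_exact_circuit reflection_def[abs_def] by simp
  then show "let C = map_circuit (gate_of [pi, - pi]) (exact_circuit reflection_code n t) in
      wf_circuit C \<and> computes C (exact_gate n t)"
    by (simp add: wf_exact_circuit)
next
  have "real (depth (exact_circuit reflection_code n t)) \<le> 37 * real (log_star (real n))" if "1 \<le> n" for n t
    using log_star_pos[of "real n"] that by (simp add: depth_exact_circuit)
  then show "\<exists>c. \<forall>\<^sub>F n in at_top. \<forall>t\<le>n. real (depth (exact_circuit reflection_code n t)) \<le> c * real (log_star (real n))"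
    by (intro exI[of _ 37] eventually_at_top_linorderI[of 1]) auto
next
  have "real (circuit_size (exact_circuit reflection_code n t)) \<le> 432 * (real n * log 2 (real n))" if "2 \<le> n" for n t
  proof -
    have "1 \<le> log 2 (real n)" using that by (simp add: le_log_iff)
    then have "real n * (log 2 (real n) + 2) \<le> real n * (3 * log 2 (real n))"
      by (intro mult_left_mono) auto
    also have "\<dots> = 3 * (real n * log 2 (real n))" by simp
    finally have "144 * (real n * (log 2 (real n) + 2)) \<le> 432 * (real n * log 2 (real n))" by linarith
    moreover have "0 < n" using that by simp
    ultimately show ?thesis using circuit_size_exact_circuit[of n reflection_code t] by linarith
  qed
  then show "\<exists>c. \<forall>\<^sub>F n in at_top. \<forall>t\<le>n. real (circuit_size (exact_circuit reflection_code n t)) \<le> c * (real n * log 2 (real n))"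
    by (intro exI[of _ 432] eventually_at_top_linorderI[of 2]) auto
qed

theorem theorem20:
  "exact_gate \<in> QNC_f (\<lambda>n. real (log_star (real n))) \<and>
   fanout_computable exact_gate (\<lambda>n. real (log_star (real n))) (\<lambda>n. real n * log 2 (real n))"
proof
  have "real n * log 2 (real n) \<le> real n ^ 2" if "1 \<le> n" for n
  proof -
    have "log 2 (real n) \<le> log 2 (2 ^ n)" using that less_exp[of n] by (intro log_mono) (simp_all add: of_nat_less_numeral_power_cancel_iff less_imp_le)
    then show ?thesis by (simp add: power2_eq_square mult_left_mono)
  qed
  then have "\<forall>\<^sub>F n in at_top. real n * log 2 (real n) \<le> real n ^ 2"
    by (rule eventually_at_top_linorderI)
  moreover have "\<forall>\<^sub>F n in at_top. 0 \<le> real n * log 2 (real n)"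
    by (rule eventually_at_top_linorderI[of 1]) simp
  ultimately have "fanout_computable exact_gate (\<lambda>n. real (log_star (real n))) (\<lambda>n. real n ^ 2)"
    by (rule fanout_computable_mono[OF fanout_computable_exact_gate])
  then show "exact_gate \<in> QNC_f (\<lambda>n. real (log_star (real n)))"
    by (auto simp: QNC_f_def)
  show "fanout_computable exact_gate (\<lambda>n. real (log_star (real n))) (\<lambda>n. real n * log 2 (real n))"
    by (rule fanout_computable_exact_gate)
qed

end
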